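(* Let $\alpha\in(0,2]$ and let $X$ be the rotationally symmetric $\alpha$-stable process on $\mathbb{R}^d$. Let $V$ be a positive Borel measurable function on $\mathbb{R}^d$ such that (V.1) $V$ is locally bounded: for any relatively compact open subset $G\subset\mathbb{R}^d$, $\sup_{x\in G}V(x)<\infty$; (V.2) $\lim_{|x|\to\infty}V(x)=\infty$. Let $X^V$ be the subprocess of $X$ obtained by killing with the multiplicative functional $\exp(-A_t)$, $A_t=\int_0^tV(X_s)\,ds$. Then $X^V$ satisfies the following three conditions: I. (Semigroup strong Feller) for any $t>0$, $p_t^V(\mathcal{B}_b(\mathbb{R}^d))\subset C_b(\mathbb{R}^d)$; II. (Tightness property) $\lim_{|x|\to\infty}R_1^V\mathbf{1}_{\mathbb{R}^d}(x)=0$; III. (Local $L^\infty$-compactness) for any $t>0$ and any open subset $U\subset\mathbb{R}^d$ with $m(U)<\infty$, $p_t^{V,U}$ is a compact operator on $L^\infty(U,m)$.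
   Context: $m$ is Lebesgue measure on $\mathbb{R}^d$. The rotationally symmetric $\alpha$-stable process $X=(\{X_t\},\{P_x\})$ is the Lévy process with $E_x[e^{i\xi\cdot(X_t-x)}]=e^{-ct|\xi|^\alpha}$ for a fixed normalizing constant $c>0$ (Brownian motion if $\alpha=2$). "Positive" means $V>0$ everywhere. $\mathcal{B}_b$ and $C_b$ denote bounded Borel and bounded continuous functions. The process $X^V$ has law $dP_x^V=\exp(-A_t)\,dP_x$, is $m$-symmetric, and has semigroup $p_t^Vf(x)=E_x[\exp(-A_t)f(X_t)]$ and $1$-resolvent $R_1^Vf(x)=\int_0^\infty e^{-t}p_t^Vf(x)\,dt$. For an open set $U$, $\tau_U=\inf\{t>0\mid X_t\notin U\}$, and $p_t^{V,U}f(x)=E_x[\exp(-A_t)f(X_t):t<\tau_U]$ is the semigroup of the part of $X^V$ on $U$, extended canonically to $L^\infty(U,m)$. *)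

theory Defs
  imports "HOL-Probability.Probability"
begin

section \<open>The rotationally symmetric stable process\<close>

text \<open>
  A Markov family \<open>({X\<^sub>t}, {P\<^sub>x})\<close> on a common measurable space \<open>\<Omega>\<close> such that, under
  each \<open>P\<^sub>x\<close>, \<open>X\<close> is a Levy process started at \<open>x\<close> with Fourier exponent \<open>c |\<xi>|\<^sup>\<alpha>\<close>.
  Times are real numbers, of which only the nonnegative ones matter. As usual for Hunt
  processes, every path is right continuous with left limits.
\<close>

locale symmetric_stable_process =
  fixes \<alpha> c :: real
    and \<Omega> :: "'w measure"
    and P :: "'a::euclidean_space \<Rightarrow> 'w measure"
    and X :: "real \<Rightarrow> 'w \<Rightarrow> 'a"
  assumes prob_space_P: "prob_space (P x)"
    and sets_P: "sets (P x) = sets \<Omega>"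
    and measurable_X: "0 \<le> t \<Longrightarrow> X t \<in> borel_measurable \<Omega>"
    and right_continuous_paths:
      "\<omega> \<in> space \<Omega> \<Longrightarrow> 0 \<le> t \<Longrightarrow> ((\<lambda>s. X s \<omega>) \<longlongrightarrow> X t \<omega>) (at_right t)"
    and left_limits_paths:
      "\<omega> \<in> space \<Omega> \<Longrightarrow> 0 < t \<Longrightarrow> \<exists>l. ((\<lambda>s. X s \<omega>) \<longlongrightarrow> l) (at_left t)"
    and start: "AE \<omega> in P x. X 0 \<omega> = x"
    and independent_increments:
      "mono (\<tau> :: nat \<Rightarrow> real) \<Longrightarrow> 0 \<le> \<tau> 0 \<Longrightarrow>
        prob_space.indep_vars (P x) (\<lambda>_. borel)
          (\<lambda>i \<omega>. X (\<tau> (Suc i)) \<omega> - X (\<tau> i) \<omega>) {..<n}"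
    and stationary_increments:
      "0 \<le> s \<Longrightarrow> 0 \<le> h \<Longrightarrow>
        distr (P x) borel (\<lambda>\<omega>. X (s + h) \<omega> - X s \<omega>) =
        distr (P x) borel (\<lambda>\<omega>. X h \<omega> - X 0 \<omega>)"
    and characteristic_function:
      "0 \<le> t \<Longrightarrow>
        (CLINT \<omega>|P x. iexp (\<xi> \<bullet> (X t \<omega> - x))) =
        complex_of_real (exp (- (c * t * norm \<xi> powr \<alpha>)))"


section \<open>The subprocess killed by the functional of a potential\<close>

definition additive_functional ::
    "(real \<Rightarrow> 'w \<Rightarrow> 'a) \<Rightarrow> ('a::euclidean_space \<Rightarrow> real) \<Rightarrow> real \<Rightarrow> 'w \<Rightarrow> real" where
  "additive_functional X V t \<omega> = (LINT s:{0..t}|lborel. V (X s \<omega>))"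

definition killed_semigroup ::
    "('a::euclidean_space \<Rightarrow> 'w measure) \<Rightarrow> (real \<Rightarrow> 'w \<Rightarrow> 'a) \<Rightarrow> ('a \<Rightarrow> real) \<Rightarrow>
     real \<Rightarrow> ('a \<Rightarrow> real) \<Rightarrow> 'a \<Rightarrow> real" where
  "killed_semigroup P X V t f x =
    (LINT \<omega>|P x. exp (- additive_functional X V t \<omega>) * f (X t \<omega>))"

definition killed_resolvent1 ::
    "('a::euclidean_space \<Rightarrow> 'w measure) \<Rightarrow> (real \<Rightarrow> 'w \<Rightarrow> 'a) \<Rightarrow> ('a \<Rightarrow> real) \<Rightarrow>
     ('a \<Rightarrow> real) \<Rightarrow> 'a \<Rightarrow> real" where
  "killed_resolvent1 P X V f x =
    (LINT t:{0..}|lborel. exp (- t) * killed_semigroup P X V t f x)"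

definition exit_time :: "(real \<Rightarrow> 'w \<Rightarrow> 'a) \<Rightarrow> 'a set \<Rightarrow> 'w \<Rightarrow> ereal" where
  "exit_time X U \<omega> = Inf {ereal t |t. 0 < t \<and> X t \<omega> \<notin> U}"

text \<open>
  The exit time of an open set is in general measurable only with respect to the completed
  \<open>\<sigma>\<close>-algebra, so the expectation is taken under the completion of \<open>P\<^sub>x\<close>. For \<open>t > 0\<close> the
  law of \<open>X\<^sub>t\<close> is absolutely continuous, so the same formula makes sense for essentially
  bounded \<open>f\<close> and depends only on the class of \<open>f\<close> on \<open>U\<close>; this is the canonical extension
  to \<open>L\<^sup>\<infinity>(U, m)\<close>. Note that \<open>X\<^sub>t \<in> U\<close> on \<open>t < \<tau>\<^sub>U\<close>, so that values of \<open>f\<close> off \<open>U\<close> are irrelevant.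
\<close>

definition part_semigroup ::
    "('a::euclidean_space \<Rightarrow> 'w measure) \<Rightarrow> (real \<Rightarrow> 'w \<Rightarrow> 'a) \<Rightarrow> ('a \<Rightarrow> real) \<Rightarrow>
     'a set \<Rightarrow> real \<Rightarrow> ('a \<Rightarrow> real) \<Rightarrow> 'a \<Rightarrow> real" where
  "part_semigroup P X V U t f x =
    (LINT \<omega>|completion (P x).
      indicator {\<omega>. ereal t < exit_time X U \<omega>} \<omega> *
      (exp (- additive_functional X V t \<omega>) * f (X t \<omega>)))"


section \<open>The space of essentially bounded functions and its compact operators\<close>

definition Linf_functions :: "'a measure \<Rightarrow> ('a \<Rightarrow> real) set" where
  "Linf_functions M = {f \<in> borel_measurable M. \<exists>C. AE x in M. \<bar>f x\<bar> \<le> C}"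

definition Linf_rel :: "'a measure \<Rightarrow> (('a \<Rightarrow> real) \<times> ('a \<Rightarrow> real)) set" where
  "Linf_rel M =
    {(f, g). f \<in> Linf_functions M \<and> g \<in> Linf_functions M \<and> (AE x in M. f x = g x)}"

definition Linf :: "'a measure \<Rightarrow> ('a \<Rightarrow> real) set set" where
  "Linf M = Linf_functions M // Linf_rel M"

text \<open>On a null space \<^const>\<open>esssup\<close> is \<open>-\<infinity>\<close>, which \<^const>\<open>real_of_ereal\<close> maps to \<open>0\<close>.\<close>

definition Linf_norm :: "'a measure \<Rightarrow> ('a \<Rightarrow> real) \<Rightarrow> real" where
  "Linf_norm M f = real_of_ereal (esssup M (\<lambda>x. ereal \<bar>f x\<bar>))"

text \<open>
  The distance of two classes is the value common to all pairs of representatives. The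
  default value serves the total laws of \<^locale>\<open>Metric_space\<close>.
\<close>

definition Linf_dist :: "'a measure \<Rightarrow> ('a \<Rightarrow> real) set \<Rightarrow> ('a \<Rightarrow> real) set \<Rightarrow> real" where
  "Linf_dist M F G =
    (if F \<in> Linf M \<and> G \<in> Linf M
     then the_elem (\<Union>f\<in>F. \<Union>g\<in>G. {Linf_norm M (\<lambda>x. f x - g x)}) else 0)"

definition Linf_topology :: "'a measure \<Rightarrow> ('a \<Rightarrow> real) set topology" where
  "Linf_topology M = Metric_space.mtopology (Linf M) (Linf_dist M)"

definition Linf_bounded :: "'a measure \<Rightarrow> ('a \<Rightarrow> real) set set \<Rightarrow> bool" where
  "Linf_bounded M B \<longleftrightarrow> Metric_space.mbounded (Linf M) (Linf_dist M) B"

text \<open>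
  Operators are given on representatives; this predicate says that \<open>T\<close> descends to a linear
  operator on the quotient, and the next definition is the induced map of classes.
\<close>

definition Linf_linear :: "'a measure \<Rightarrow> (('a \<Rightarrow> real) \<Rightarrow> 'a \<Rightarrow> real) \<Rightarrow> bool" where
  "Linf_linear M T \<longleftrightarrow>
    (\<forall>f \<in> Linf_functions M. T f \<in> Linf_functions M) \<and>
    (\<forall>f \<in> Linf_functions M. \<forall>g \<in> Linf_functions M.
      (AE x in M. f x = g x) \<longrightarrow> (AE x in M. T f x = T g x)) \<and>
    (\<forall>f \<in> Linf_functions M. \<forall>g \<in> Linf_functions M. \<forall>a b.
      AE x in M. T (\<lambda>y. a * f y + b * g y) x = a * T f x + b * T g x)"

definition Linf_map ::
    "'a measure \<Rightarrow> (('a \<Rightarrow> real) \<Rightarrow> 'a \<Rightarrow> real) \<Rightarrow> ('a \<Rightarrow> real) set \<Rightarrow> ('a \<Rightarrow> real) set" where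
  "Linf_map M T F = (\<Union>f\<in>F. Linf_rel M `` {T f})"

definition Linf_compact_operator :: "'a measure \<Rightarrow> (('a \<Rightarrow> real) \<Rightarrow> 'a \<Rightarrow> real) \<Rightarrow> bool" where
  "Linf_compact_operator M T \<longleftrightarrow>
    Linf_linear M T \<and>
    (\<forall>B. B \<subseteq> Linf M \<and> Linf_bounded M B \<longrightarrow>
      compactin (Linf_topology M) (Linf_topology M closure_of (Linf_map M T ` B)))"

lemma equiv_Linf_rel: "equiv (Linf_functions M) (Linf_rel M)"
proof (rule equivI)
  show "Linf_rel M \<subseteq> Linf_functions M \<times> Linf_functions M" "refl_on (Linf_functions M) (Linf_rel M)"
    by (auto simp: Linf_rel_def refl_on_def)
  show "sym (Linf_rel M)"
    by (auto simp: Linf_rel_def sym_def)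
  show "trans (Linf_rel M)"
  proof (rule transI)
    fix f g h assume "(f, g) \<in> Linf_rel M" "(g, h) \<in> Linf_rel M"
    then show "(f, h) \<in> Linf_rel M"
      unfolding Linf_rel_def by (auto elim: eventually_elim2)
  qed
qed

lemma Linf_functions_diff:
  assumes "f \<in> Linf_functions M" "g \<in> Linf_functions M"
  shows "(\<lambda>x. f x - g x) \<in> Linf_functions M"
proof -
  obtain C D where "AE x in M. \<bar>f x\<bar> \<le> C" "AE x in M. \<bar>g x\<bar> \<le> D"
    using assms by (auto simp: Linf_functions_def)
  then have "AE x in M. \<bar>f x - g x\<bar> \<le> C + D"
    by eventually_elim linarith
  then show ?thesis
    using assms by (auto simp: Linf_functions_def)
qed

lemma Linf_norm_nonneg: "0 \<le> Linf_norm M f"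
proof (cases "ae_filter M = bot \<or> (\<lambda>x. ereal \<bar>f x\<bar>) \<notin> borel_measurable M")
  case True
  then show ?thesis
    by (auto simp: Linf_norm_def esssup_def top_ereal_def bot_ereal_def)
next
  case False
  then have "0 \<le> esssup M (\<lambda>x. ereal \<bar>f x\<bar>)"
    by (auto simp: esssup_def intro!: le_Limsup)
  then show ?thesis
    unfolding Linf_norm_def by (rule real_of_ereal_pos)
qed

lemma Linf_norm_le:
  assumes "f \<in> borel_measurable M" "AE x in M. \<bar>f x\<bar> \<le> C" "0 \<le> C"
  shows "Linf_norm M f \<le> C"
proof -
  have "esssup M (\<lambda>x. ereal \<bar>f x\<bar>) \<le> ereal C"
    using assms by (intro esssup_I) auto
  then show ?thesis
    using assms(3) unfolding Linf_norm_def
    by (cases "esssup M (\<lambda>x. ereal \<bar>f x\<bar>)") auto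
qed

lemma Linf_norm_AE:
  assumes "f \<in> Linf_functions M"
  shows "AE x in M. \<bar>f x\<bar> \<le> Linf_norm M f"
proof -
  obtain C where C: "AE x in M. \<bar>f x\<bar> \<le> C"
    using assms by (auto simp: Linf_functions_def)
  have "esssup M (\<lambda>x. ereal \<bar>f x\<bar>) \<le> ereal C"
    using assms C by (intro esssup_I) (auto simp: Linf_functions_def)
  with esssup_AE[of "\<lambda>x. ereal \<bar>f x\<bar>" M] show ?thesis
    unfolding Linf_norm_def by (cases "esssup M (\<lambda>x. ereal \<bar>f x\<bar>)") auto
qed

lemma Linf_norm_cong:
  assumes "f \<in> borel_measurable M" "g \<in> borel_measurable M" "AE x in M. f x = g x"
  shows "Linf_norm M f = Linf_norm M g"
  unfolding Linf_norm_def using assms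
  by (intro arg_cong[where f = real_of_ereal] esssup_AE_cong) auto

lemma Linf_norm_diff_commute: "Linf_norm M (\<lambda>x. f x - g x) = Linf_norm M (\<lambda>x. g x - f x)"
  by (simp add: Linf_norm_def abs_minus_commute)

lemma Linf_dist_class:
  assumes "f \<in> Linf_functions M" "g \<in> Linf_functions M"
  shows "Linf_dist M (Linf_rel M `` {f}) (Linf_rel M `` {g}) = Linf_norm M (\<lambda>x. f x - g x)"
proof -
  have "Linf_norm M (\<lambda>x. f' x - g' x) = Linf_norm M (\<lambda>x. f x - g x)"
    if "(f, f') \<in> Linf_rel M" "(g, g') \<in> Linf_rel M" for f' g'
  proof (rule Linf_norm_cong)
    have "AE x in M. f x = f' x" "AE x in M. g x = g' x"
      using that by (auto simp: Linf_rel_def)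
    then show "AE x in M. f' x - g' x = f x - g x"
      by eventually_elim simp
  qed (use that in \<open>auto simp: Linf_rel_def Linf_functions_def\<close>)
  moreover have "(f, f) \<in> Linf_rel M" "(g, g) \<in> Linf_rel M"
    using assms by (auto simp: Linf_rel_def)
  ultimately have "(\<Union>f'\<in>Linf_rel M `` {f}. \<Union>g'\<in>Linf_rel M `` {g}.
      {Linf_norm M (\<lambda>x. f' x - g' x)}) = {Linf_norm M (\<lambda>x. f x - g x)}"
    by blast
  with assms show ?thesis
    by (simp add: Linf_dist_def Linf_def quotientI)
qed

lemma Linf_cases:
  assumes "F \<in> Linf M"
  obtains f where "f \<in> Linf_functions M" "F = Linf_rel M `` {f}"
  using assms unfolding Linf_def by (rule quotientE)

lemma Metric_space_Linf: "Metric_space (Linf M) (Linf_dist M)"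
proof
  fix F G
  show "0 \<le> Linf_dist M F G"
  proof (cases "F \<in> Linf M \<and> G \<in> Linf M")
    case True
    then obtain f g where "f \<in> Linf_functions M" "F = Linf_rel M `` {f}"
        "g \<in> Linf_functions M" "G = Linf_rel M `` {g}"
      by (meson Linf_cases)
    then show ?thesis
      by (simp add: Linf_dist_class Linf_norm_nonneg)
  qed (auto simp: Linf_dist_def)
  show "Linf_dist M F G = Linf_dist M G F"
  proof (cases "F \<in> Linf M \<and> G \<in> Linf M")
    case True
    then obtain f g where "f \<in> Linf_functions M" "F = Linf_rel M `` {f}"
        "g \<in> Linf_functions M" "G = Linf_rel M `` {g}"
      by (meson Linf_cases)
    then show ?thesis
      by (simp add: Linf_dist_class Linf_norm_diff_commute[of M f g])
  qed (auto simp: Linf_dist_def)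
next
  fix F G assume "F \<in> Linf M" "G \<in> Linf M"
  then obtain f g where fg: "f \<in> Linf_functions M" "F = Linf_rel M `` {f}"
      "g \<in> Linf_functions M" "G = Linf_rel M `` {g}"
    by (meson Linf_cases)
  have "Linf_norm M (\<lambda>x. f x - g x) = 0 \<longleftrightarrow> (AE x in M. f x = g x)"
  proof
    assume "Linf_norm M (\<lambda>x. f x - g x) = 0"
    with Linf_norm_AE[OF Linf_functions_diff[OF fg(1,3)]] show "AE x in M. f x = g x"
      by simp
  next
    assume "AE x in M. f x = g x"
    then have "AE x in M. \<bar>f x - g x\<bar> \<le> 0"
      by eventually_elim simp
    then have "Linf_norm M (\<lambda>x. f x - g x) \<le> 0"
      using Linf_functions_diff[OF fg(1,3)]
      by (intro Linf_norm_le) (auto simp: Linf_functions_def)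
    then show "Linf_norm M (\<lambda>x. f x - g x) = 0"
      using Linf_norm_nonneg[of M "\<lambda>x. f x - g x"] by simp
  qed
  also have "\<dots> \<longleftrightarrow> (f, g) \<in> Linf_rel M"
    using fg by (simp add: Linf_rel_def)
  also have "\<dots> \<longleftrightarrow> F = G"
    using fg eq_equiv_class_iff[OF equiv_Linf_rel] by blast
  finally show "Linf_dist M F G = 0 \<longleftrightarrow> F = G"
    using fg by (simp add: Linf_dist_class)
next
  fix F G H assume "F \<in> Linf M" "G \<in> Linf M" "H \<in> Linf M"
  then obtain f g h where fgh: "f \<in> Linf_functions M" "F = Linf_rel M `` {f}"
      "g \<in> Linf_functions M" "G = Linf_rel M `` {g}"
      "h \<in> Linf_functions M" "H = Linf_rel M `` {h}"
    by (meson Linf_cases)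
  have "AE x in M. \<bar>f x - h x\<bar> \<le> Linf_norm M (\<lambda>x. f x - g x) + Linf_norm M (\<lambda>x. g x - h x)"
    using Linf_norm_AE[OF Linf_functions_diff[OF fgh(1,3)]]
      Linf_norm_AE[OF Linf_functions_diff[OF fgh(3,5)]]
    by eventually_elim linarith
  then have "Linf_norm M (\<lambda>x. f x - h x) \<le>
      Linf_norm M (\<lambda>x. f x - g x) + Linf_norm M (\<lambda>x. g x - h x)"
    using Linf_functions_diff[OF fgh(1,5)]
    by (intro Linf_norm_le) (auto simp: Linf_functions_def Linf_norm_nonneg)
  then show "Linf_dist M F H \<le> Linf_dist M F G + Linf_dist M G H"
    using fgh by (simp add: Linf_dist_class)
qed

end

theory Submission
  imports Defs "HOL-Complex_Analysis.Great_Picard"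
begin

text \<open>
  For an open set \<open>U\<close> let \<open>K\<^sub>t\<^sup>U f (x)\<close> be the expectation under \<open>P\<^sub>x\<close> of \<open>exp (- A\<^sub>t) f (X\<^sub>t)\<close> over the
  paths that keep a positive distance from the complement of \<open>U\<close> up to time \<open>t\<close> (\<open>kernel\<close> below). For
  the whole space this is the semigroup of the killed process. All three properties come from two
  estimates for \<open>K\<^sub>t\<^sup>U\<close>.

  The first is a bound by \<open>C \<integral>\<^sub>U |f|\<close>. The function \<open>exp (- c t |\<xi>|\<^sup>\<alpha>)\<close> is integrable, so Fourier
  inversion (\<open>density_fourier_density\<close>) shows that \<open>X\<^sub>t - x\<close> has a continuous density that is bounded by
  a constant; this constant is \<open>C\<close> (\<open>abs_kernel_le_L1\<close>).

  The second is that the functions \<open>K\<^sub>t\<^sup>U f\<close> with \<open>|f| \<le> 1\<close> are equicontinuous at every point of \<open>U\<close>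
  (\<open>kernel_equicontinuous\<close>). Without killing this holds because translates of the continuous density
  converge in \<open>L\<^sup>1\<close>, by Scheffe's lemma. With killing, the Markov property gives
  \<open>K\<^sub>t f (x) = E\<^sub>x[exp (- A\<^sub>h) K\<^sub>t\<^sub>-\<^sub>h f (X\<^sub>h)]\<close>, the expectation being over paths that survive up to \<open>h\<close>. For
  small \<open>h\<close> this is close to \<open>E\<^sub>x[K\<^sub>t\<^sub>-\<^sub>h f (X\<^sub>h)]\<close>, locally uniformly in \<open>x\<close> and uniformly in \<open>f\<close>: \<open>V\<close> is
  locally bounded, and the process hardly moves during a short time.

  Equicontinuity for the whole space contains the strong Feller property. Tightness holds because a
  path that starts far away stays far away during \<open>[0, t]\<close> with high probability, and \<open>V\<close> is large
  there; the resolvent follows by dominated convergence. For compactness write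
  \<open>K\<^sub>t = K\<^sub>t\<^sub>/\<^sub>2 K\<^sub>t\<^sub>/\<^sub>2\<close>. If \<open>(f\<^sub>n)\<close> is bounded, then a diagonal argument and equicontinuity give a subsequence
  along which \<open>K\<^sub>t\<^sub>/\<^sub>2 f\<^sub>n\<close> converges pointwise on \<open>U\<close>, hence in \<open>L\<^sup>1(U)\<close> since \<open>U\<close> has finite measure. By
  the first estimate the second factor makes the convergence uniform.

  What remains is to identify \<open>K\<^sub>t\<^sup>U\<close> with the semigroup of the part on \<open>U\<close>, that is, the condition
  \<open>t < \<tau>\<^sub>U\<close> with the positive distance from the complement (\<open>AE_less_exit_time_iff_survives\<close>). This also
  settles the measurability of the exit event. The two conditions differ only if the path approaches
  the complement from the left and jumps back into \<open>U\<close> at that very moment. Such a jump would be a large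
  displacement in an arbitrarily short time after the process first comes near the complement. By the
  Markov property at grid times this has probability zero.
\<close>

section \<open>Integrability of the stable characteristic function\<close>

lemma integrable_inverse_one_plus_square:
  "integrable lborel (\<lambda>x::real. inverse (1 + x\<^sup>2))"
  using integrable_inverse_1_plus_square by (simp add: set_integrable_def einterval_def)

text \<open>
  For small \<open>\<alpha>\<close> the decay is slow, so it is compared with a power: \<open>e\<^sup>y \<ge> y\<^sup>n / n!\<close> with
  \<open>n \<alpha> > 2\<close>.
\<close>

lemma exp_minus_powr_le:
  fixes a \<alpha> :: real
  assumes "0 < a" "0 < \<alpha>"
  obtains C where "\<And>x. exp (- (a * \<bar>x\<bar> powr \<alpha>)) \<le> C * inverse (1 + x\<^sup>2)"
proof -
  obtain n :: nat where n: "2 / \<alpha> < real n" using reals_Archimedean2 by blast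
  then have n2: "2 < real n * \<alpha>" using assms by (simp add: field_simps)
  define C where "C = max 2 (2 * fact n / a ^ n)"
  have C: "2 \<le> C" "2 * fact n / a ^ n \<le> C" by (auto simp: C_def)
  have "exp (- (a * \<bar>x\<bar> powr \<alpha>)) \<le> C * inverse (1 + x\<^sup>2)" for x
  proof (cases "\<bar>x\<bar> \<le> 1")
    case True
    then have "x\<^sup>2 \<le> 1" by (simp add: abs_square_le_1)
    then have "1 \<le> 2 * inverse (1 + x\<^sup>2)"
      by (simp add: field_simps add_pos_nonneg)
    also have "\<dots> \<le> C * inverse (1 + x\<^sup>2)"
      using C by (intro mult_right_mono) auto
    finally have "1 \<le> C * inverse (1 + x\<^sup>2)" .
    moreover have "exp (- (a * \<bar>x\<bar> powr \<alpha>)) \<le> 1" using assms by simp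
    ultimately show ?thesis by linarith
  next
    case False
    then have x: "1 < \<bar>x\<bar>" by simp
    define y where "y = a * \<bar>x\<bar> powr \<alpha>"
    have y: "0 < y" using assms x by (simp add: y_def)
    have "x\<^sup>2 = \<bar>x\<bar> powr 2" using x by simp
    also have "\<dots> \<le> \<bar>x\<bar> powr (\<alpha> * n)"
      using x n2 by (intro powr_mono) (auto simp: mult.commute)
    also have "\<dots> = (\<bar>x\<bar> powr \<alpha>) ^ n" using x by (simp add: powr_powr[symmetric] powr_realpow)
    finally have p: "x\<^sup>2 \<le> (\<bar>x\<bar> powr \<alpha>) ^ n" .
    have "y ^ n / fact n \<le> exp y"
    proof -
      have s: "(\<lambda>k. y ^ k /\<^sub>R fact k) sums exp y" by (rule exp_converges)
      have "(\<Sum>k\<in>{n}. y ^ k /\<^sub>R fact k) \<le> exp y"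
        using s y by (intro sum_le_suminf[THEN order_trans[OF _ eq_refl[OF sums_unique[OF s, symmetric]]]])
          (auto simp: sums_iff)
      then show ?thesis by (simp add: field_simps)
    qed
    then have "exp (- y) \<le> fact n / y ^ n"
      using y by (simp add: exp_minus field_simps)
    also have "\<dots> = fact n / a ^ n * inverse ((\<bar>x\<bar> powr \<alpha>) ^ n)"
      by (simp add: y_def power_mult_distrib field_simps)
    also have "\<dots> \<le> fact n / a ^ n * inverse (x\<^sup>2)"
      using assms p x by (intro mult_left_mono le_imp_inverse_le) auto
    also have "\<dots> \<le> fact n / a ^ n * (2 * inverse (1 + x\<^sup>2))"
    proof (intro mult_left_mono)
      have "1 \<le> x\<^sup>2" using x by (metis less_imp_le one_le_power power2_abs)
      then show "inverse (x\<^sup>2) \<le> 2 * inverse (1 + x\<^sup>2)"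
        by (simp add: divide_simps add_pos_nonneg)
    qed (use assms in auto)
    also have "\<dots> = (2 * fact n / a ^ n) * inverse (1 + x\<^sup>2)" by simp
    also have "\<dots> \<le> C * inverse (1 + x\<^sup>2)" using C by (intro mult_right_mono) auto
    finally show ?thesis by (simp add: y_def)
  qed
  then show ?thesis using that by blast
qed

text \<open>
  Since \<open>|\<xi>|\<^sup>\<alpha>\<close> dominates the average of the \<open>|\<xi>\<^sub>k|\<^sup>\<alpha>\<close> over the coordinates, the function lies below
  a product of integrable functions of one variable.
\<close>

lemma integrable_exp_minus_norm_powr:
  fixes a \<alpha> :: real
  assumes a: "0 < a" and al: "0 < \<alpha>"
  shows "integrable lborel (\<lambda>\<xi>::'a::euclidean_space. exp (- (a * norm \<xi> powr \<alpha>)))"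
proof -
  \<comment> \<open>the average over the coordinates brings in the dimension\<close>
  define b where "b = a / real DIM('a)"
  have b: "0 < b" using a by (simp add: b_def)
  obtain C where C: "\<And>x. exp (- (b * \<bar>x\<bar> powr \<alpha>)) \<le> C * inverse (1 + x\<^sup>2)"
    using exp_minus_powr_le[OF b al] by blast
  have i1: "integrable lborel (\<lambda>x::real. exp (- (b * \<bar>x\<bar> powr \<alpha>)))"
  proof (rule Bochner_Integration.integrable_bound)
    show "integrable lborel (\<lambda>x::real. C * inverse (1 + x\<^sup>2))"
      using integrable_inverse_one_plus_square by (rule integrable_mult_right)
    show "AE x in lborel. norm (exp (- (b * \<bar>x\<bar> powr \<alpha>))) \<le> norm (C * inverse (1 + x\<^sup>2))"
      using C by (auto intro: order_trans[OF _ abs_ge_self])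
  qed measurable
  have "(\<integral>\<^sup>+ \<xi>. ennreal (norm (exp (- (a * norm (\<xi>::'a) powr \<alpha>)))) \<partial>lborel) \<le>
      (\<integral>\<^sup>+ \<xi>. (\<Prod>k\<in>Basis. ennreal (exp (- (b * \<bar>(\<xi>::'a) \<bullet> k\<bar> powr \<alpha>)))) \<partial>lborel)"
  proof (rule nn_integral_mono)
    fix \<xi> :: 'a
    have "(\<Sum>k\<in>Basis. b * \<bar>\<xi> \<bullet> k\<bar> powr \<alpha>) \<le> (\<Sum>k\<in>(Basis::'a set). b * norm \<xi> powr \<alpha>)"
      using b al by (intro sum_mono mult_left_mono powr_mono2) (auto simp: Basis_le_norm)
    also have "\<dots> = a * norm \<xi> powr \<alpha>" by (simp add: b_def)
    finally have "exp (- (a * norm \<xi> powr \<alpha>)) \<le> exp (- (\<Sum>k\<in>Basis. b * \<bar>\<xi> \<bullet> k\<bar> powr \<alpha>))"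
      by simp
    also have "\<dots> = (\<Prod>k\<in>Basis. exp (- (b * \<bar>\<xi> \<bullet> k\<bar> powr \<alpha>)))"
      by (simp add: exp_sum sum_negf[symmetric])
    finally show "ennreal (norm (exp (- (a * norm \<xi> powr \<alpha>)))) \<le>
        (\<Prod>k\<in>Basis. ennreal (exp (- (b * \<bar>\<xi> \<bullet> k\<bar> powr \<alpha>))))"
      by (simp add: prod_ennreal ennreal_leI)
  qed
  also have "\<dots> = (\<Prod>k\<in>(Basis::'a set). (\<integral>\<^sup>+ x. ennreal (exp (- (b * \<bar>x\<bar> powr \<alpha>))) \<partial>lborel))"
    by (rule nn_integral_lborel_prod) auto
  also have "\<dots> < \<infinity>"
    using i1 by (simp add: integrable_iff_bounded less_top[symmetric] power_eq_top_ennreal)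
  finally show ?thesis by (subst integrable_iff_bounded) auto
qed

section \<open>Fourier inversion on Euclidean space\<close>

text \<open>
  The standard normal density on Euclidean space. Its value at \<open>0\<close> is \<open>(2\<pi>)\<^bsup>-d/2\<^esup>\<close>, which is also the
  constant of the Fourier transform, so no power of \<open>\<pi>\<close> has to be written below.
\<close>

definition gauss :: "'a::euclidean_space \<Rightarrow> real" where
  "gauss v = (\<Prod>b\<in>Basis. std_normal_density (v \<bullet> b))"

lemma gauss_nonneg: "0 \<le> gauss v"
  by (simp add: gauss_def prod_nonneg)

lemma power2_norm_eq_sum_Basis: "(norm v)\<^sup>2 = (\<Sum>b\<in>Basis. (v \<bullet> b)\<^sup>2)"
  unfolding power2_norm_eq_inner by (subst euclidean_inner) (simp add: power2_eq_square)

lemma gauss_eq: "gauss (v::'a) = gauss (0::'a::euclidean_space) * exp (- ((norm v)\<^sup>2) / 2)"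
  unfolding power2_norm_eq_sum_Basis
  by (simp add: gauss_def std_normal_density_def prod.distrib[symmetric] exp_sum[symmetric]
      sum_negf sum_divide_distrib power_divide prod_dividef)

lemma gauss_0_pos: "0 < gauss (0 :: 'a::euclidean_space)"
  by (auto simp: gauss_def std_normal_density_def intro!: prod_pos)

lemma continuous_gauss: "continuous_on S (gauss :: 'a::euclidean_space \<Rightarrow> real)"
  by (subst gauss_eq[abs_def]) (auto intro!: continuous_intros)

lemma borel_measurable_gauss [measurable]: "gauss \<in> borel_measurable (borel :: 'a::euclidean_space measure)"
  by (rule borel_measurable_continuous_onI[OF continuous_gauss])

lemma gauss_le: "gauss (v::'a) \<le> gauss (0 :: 'a::euclidean_space)"
  by (subst gauss_eq, rule mult_right_le_one_le) (simp_all add: gauss_nonneg)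

lemma nn_integral_gauss: "(\<integral>\<^sup>+ v. ennreal (gauss (v::'a::euclidean_space)) \<partial>lborel) = 1"
proof -
  have "(\<integral>\<^sup>+ v. ennreal (gauss (v::'a)) \<partial>lborel) =
      (\<integral>\<^sup>+ v. (\<Prod>b\<in>Basis. ennreal (std_normal_density ((v::'a) \<bullet> b))) \<partial>lborel)"
    by (simp add: gauss_def prod_ennreal)
  also have "\<dots> = (\<Prod>b\<in>(Basis::'a set). (\<integral>\<^sup>+ x. ennreal (std_normal_density x) \<partial>lborel))"
    by (rule nn_integral_lborel_prod) auto
  also have "(\<integral>\<^sup>+ x. ennreal (std_normal_density x) \<partial>lborel) = 1"
    using prob_space.emeasure_space_1[OF prob_space_normal_density[of 1 0]]
    by (simp add: emeasure_density)
  finally show ?thesis by simp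
qed

lemma integrable_gauss: "integrable lborel (gauss :: 'a::euclidean_space \<Rightarrow> real)"
  using nn_integral_gauss[where 'a='a]
  by (subst integrable_iff_bounded) (auto simp: gauss_nonneg)

lemma integral_gauss: "(LINT v|lborel. gauss (v::'a::euclidean_space)) = 1"
  using nn_integral_gauss[where 'a='a]
  by (simp add: nn_integral_eq_integral[OF integrable_gauss] gauss_nonneg)

lemma cos_transform_gauss:
  fixes w :: "'a::euclidean_space"
  shows "(LINT \<eta>|lborel. gauss \<eta> * cos (\<eta> \<bullet> w)) = exp (- ((norm w)\<^sup>2) / 2)"
proof -
  interpret P: product_sigma_finite "\<lambda>b::'a. lborel :: real measure" ..
  have i1: "integrable lborel (\<lambda>x::real. of_real (std_normal_density x) * iexp (x * t))" for t
  proof (rule Bochner_Integration.integrable_bound)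
    show "integrable lborel (\<lambda>x::real. std_normal_density x)"
      by (rule integrable_normal_density) simp
  qed (auto simp: norm_mult)
  have one: "(CLINT x|lborel. of_real (std_normal_density x) * iexp (x * t)) = of_real (exp (- t\<^sup>2 / 2))" for t
  proof -
    have "char std_normal_distribution t = (CLINT x|lborel. std_normal_density x *\<^sub>R iexp (t * x))"
      unfolding char_def by (subst integral_density) auto
    then show ?thesis by (simp add: char_std_normal_distribution scaleR_conv_of_real mult.commute[of _ t])
  qed
  have eq: "of_real (gauss \<eta>) * iexp (\<eta> \<bullet> w) =
    (\<Prod>b\<in>Basis. of_real (std_normal_density (\<eta> \<bullet> b)) * iexp ((\<eta> \<bullet> b) * (w \<bullet> b)))" for \<eta> :: 'a
    by (simp add: gauss_def prod.distrib exp_sum[symmetric] sum_distrib_left[symmetric]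
        euclidean_inner[of \<eta> w])
  have "(CLINT \<eta>|lborel. of_real (gauss \<eta>) * iexp (\<eta> \<bullet> w)) =
    (CLINT f|(\<Pi>\<^sub>M b\<in>Basis. lborel). (\<Prod>b\<in>Basis. of_real (std_normal_density (f b)) * iexp ((f b) * (w \<bullet> b))))"
    unfolding eq
    by (subst lborel_eq, subst integral_distr)
      (auto intro!: Bochner_Integration.integral_cong prod.cong simp: inner_sum_left inner_Basis if_distrib sum.delta cong: if_cong)
  also have "\<dots> = (\<Prod>b\<in>Basis. (CLINT x|lborel. of_real (std_normal_density x) * iexp (x * (w \<bullet> b))))"
    by (rule P.product_integral_prod) (rule finite_Basis i1)+
  also have "\<dots> = (\<Prod>b\<in>Basis. of_real (exp (- (w \<bullet> b)\<^sup>2 / 2)))" by (simp only: one)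
  also have "\<dots> = of_real (exp (- ((norm w)\<^sup>2) / 2))"
    unfolding power2_norm_eq_sum_Basis
    by (simp add: exp_sum[symmetric] sum_negf sum_divide_distrib flip: of_real_prod)
  finally have c: "(CLINT \<eta>|lborel. of_real (gauss \<eta>) * iexp (\<eta> \<bullet> w)) = of_real (exp (- ((norm w)\<^sup>2) / 2))" .
  have ic: "complex_integrable lborel (\<lambda>\<eta>::'a. of_real (gauss \<eta>) * iexp (\<eta> \<bullet> w))"
    by (rule Bochner_Integration.integrable_bound[OF integrable_gauss])
      (auto simp: norm_mult)
  have "(LINT \<eta>|lborel. gauss \<eta> * cos (\<eta> \<bullet> w)) = (LINT \<eta>|lborel. Re (of_real (gauss \<eta>) * iexp (\<eta> \<bullet> w)))"
    by (simp add: Re_exp)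
  also have "\<dots> = Re (CLINT \<eta>|lborel. of_real (gauss \<eta>) * iexp (\<eta> \<bullet> w))"
    by (rule integral_Re[OF ic])
  finally show ?thesis using c by simp
qed

lemma lborel_integral_affine:
  fixes f :: "'a::euclidean_space \<Rightarrow> 'b::{banach, second_countable_topology}"
  assumes [measurable]: "f \<in> borel_measurable borel" and "c \<noteq> 0"
  shows "(LINT x|lborel. f x) = \<bar>c\<bar> ^ DIM('a) *\<^sub>R (LINT x|lborel. f (t + c *\<^sub>R x))"
  using assms(2)
  by (subst lborel_affine[of c t])
    (simp_all add: integral_density integral_distr)

lemma lborel_nn_integral_affine:
  fixes f :: "'a::euclidean_space \<Rightarrow> ennreal"
  assumes [measurable]: "f \<in> borel_measurable borel" and "c \<noteq> 0"
  shows "(\<integral>\<^sup>+ x. f x \<partial>lborel) = ennreal (\<bar>c\<bar> ^ DIM('a)) * (\<integral>\<^sup>+ x. f (t + c *\<^sub>R x) \<partial>lborel)"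
  using assms(2)
  by (subst lborel_affine[of c t])
    (simp_all add: nn_integral_density nn_integral_distr nn_integral_cmult ennreal_power)

lemma lborel_integrable_affine:
  fixes f :: "'a::euclidean_space \<Rightarrow> 'b::{banach, second_countable_topology}"
  assumes f: "integrable lborel f" and "c \<noteq> 0"
  shows "integrable lborel (\<lambda>x. f (t + c *\<^sub>R x))"
proof -
  have [measurable]: "f \<in> borel_measurable borel" using f by auto
  have "(\<integral>\<^sup>+ x. ennreal (norm (f x)) \<partial>lborel) < \<infinity>" using f by (simp add: integrable_iff_bounded)
  then have "(\<integral>\<^sup>+ x. ennreal (norm (f (t + c *\<^sub>R x))) \<partial>lborel) < \<infinity>"
    using \<open>c \<noteq> 0\<close> by (subst (asm) lborel_nn_integral_affine[of _ c t])
      (auto simp: ennreal_mult_less_top)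
  then show ?thesis by (simp add: integrable_iff_bounded)
qed

text \<open>
  The Fourier inversion integral of \<open>\<psi>\<close> with a Gaussian factor that disappears for \<open>\<sigma> = 0\<close>. Only real
  characteristic functions occur, hence the cosine. For \<open>\<sigma> = 0\<close> the constant is \<open>(gauss 0)\<^sup>2\<close>, that is
  \<open>(2\<pi>)\<^bsup>-d\<^esup>\<close>. Treating \<open>\<sigma>\<close> as a parameter makes the limit \<open>\<sigma> \<rightarrow> 0\<close> and the continuity in \<open>y\<close>
  one and the same dominated convergence.
\<close>

definition damped_inversion :: "real \<Rightarrow> ('a::euclidean_space \<Rightarrow> real) \<Rightarrow> 'a \<Rightarrow> real" where
  "damped_inversion \<sigma> \<psi> y =
    gauss (0::'a) * (LINT \<xi>|lborel. gauss (\<sigma> *\<^sub>R \<xi>) * (cos (\<xi> \<bullet> y) * \<psi> \<xi>))"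

abbreviation fourier_density :: "('a::euclidean_space \<Rightarrow> real) \<Rightarrow> 'a \<Rightarrow> real" where
  "fourier_density \<equiv> damped_inversion 0"

lemma damped_integrand_le:
  "\<bar>gauss (\<sigma> *\<^sub>R \<xi>) * (cos (\<xi> \<bullet> y) * \<psi> \<xi>)\<bar> \<le> gauss (0::'a::euclidean_space) * \<bar>\<psi> (\<xi>::'a)\<bar>"
  by (auto simp: abs_mult gauss_nonneg intro!: mult_mono gauss_le mult_left_le_one_le)

lemma abs_damped_inversion_le:
  fixes \<psi> :: "'a::euclidean_space \<Rightarrow> real"
  assumes \<psi>: "integrable lborel \<psi>"
  shows "\<bar>damped_inversion \<sigma> \<psi> y\<bar> \<le> (gauss (0::'a))\<^sup>2 * (LINT \<xi>|lborel. \<bar>\<psi> \<xi>\<bar>)"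
proof -
  have i: "integrable lborel (\<lambda>\<xi>. gauss (0::'a) * \<bar>\<psi> \<xi>\<bar>)" using \<psi> by auto
  have "integrable lborel (\<lambda>\<xi>. gauss (\<sigma> *\<^sub>R \<xi>) * (cos (\<xi> \<bullet> y) * \<psi> \<xi>))"
    using damped_integrand_le[of \<sigma> _ y \<psi>] \<psi>
    by (intro Bochner_Integration.integrable_bound[OF i] AE_I2) (auto intro: order_trans[OF _ abs_ge_self])
  from Bochner_Integration.integral_norm_bound_integral[OF this i] damped_integrand_le[of \<sigma> _ y \<psi>]
  have "\<bar>LINT \<xi>|lborel. gauss (\<sigma> *\<^sub>R \<xi>) * (cos (\<xi> \<bullet> y) * \<psi> \<xi>)\<bar> \<le> gauss (0::'a) * (LINT \<xi>|lborel. \<bar>\<psi> \<xi>\<bar>)"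
    by auto
  then show ?thesis
    by (simp add: damped_inversion_def abs_mult gauss_nonneg mult_left_mono power2_eq_square mult.assoc)
qed

lemma damped_inversion_tendsto:
  fixes \<psi> :: "'a::euclidean_space \<Rightarrow> real"
  assumes \<psi>: "integrable lborel \<psi>" and lim: "s \<longlonglongrightarrow> \<sigma>" "u \<longlonglongrightarrow> y"
  shows "(\<lambda>n. damped_inversion (s n) \<psi> (u n)) \<longlonglongrightarrow> damped_inversion \<sigma> \<psi> y"
  unfolding damped_inversion_def
proof (intro tendsto_mult tendsto_const
    integral_dominated_convergence[where w="\<lambda>\<xi>. gauss (0::'a) * \<bar>\<psi> \<xi>\<bar>"])
  show "AE \<xi> in lborel. (\<lambda>n. gauss (s n *\<^sub>R \<xi>) * (cos (\<xi> \<bullet> u n) * \<psi> \<xi>))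
      \<longlonglongrightarrow> gauss (\<sigma> *\<^sub>R \<xi>) * (cos (\<xi> \<bullet> y) * \<psi> \<xi>)"
    by (intro AE_I2 tendsto_intros continuous_on_tendsto_compose[OF continuous_gauss[of UNIV]] lim) auto
  show "AE \<xi> in lborel. norm (gauss (s n *\<^sub>R \<xi>) * (cos (\<xi> \<bullet> u n) * \<psi> \<xi>)) \<le> gauss (0::'a) * \<bar>\<psi> \<xi>\<bar>" for n
    using damped_integrand_le[of "s n" _ "u n" \<psi>] by simp
qed (use \<psi> in auto)

lemma continuous_damped_inversion: "integrable lborel \<psi> \<Longrightarrow> continuous_on UNIV (damped_inversion \<sigma> \<psi>)"
  by (simp add: continuous_on_sequentially o_def damped_inversion_tendsto)

lemma integral_gauss_scaled_cos:
  fixes v :: "'a::euclidean_space"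
  assumes "0 < \<sigma>"
  shows "\<sigma> ^ DIM('a) * gauss (0::'a) * (LINT \<xi>|lborel. gauss (\<sigma> *\<^sub>R \<xi>) * cos (\<xi> \<bullet> v)) = gauss (v /\<^sub>R \<sigma>)"
proof -
  have "(LINT \<eta>|lborel. gauss \<eta> * cos (\<eta> \<bullet> (v /\<^sub>R \<sigma>))) =
      \<sigma> ^ DIM('a) * (LINT \<xi>|lborel. gauss (\<sigma> *\<^sub>R \<xi>) * cos (\<xi> \<bullet> v))"
    using assms by (subst lborel_integral_affine[where c=\<sigma> and t=0]) (simp_all flip: mult.assoc)
  then show ?thesis unfolding cos_transform_gauss
    by (subst gauss_eq) simp
qed

text \<open>
  The Gaussian is its own Fourier transform. By Fubini's theorem, damping the inversion integral
  therefore amounts to convolving \<open>M\<close> with a Gaussian of variance \<open>\<sigma>\<^sup>2\<close>.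
\<close>

lemma damped_inversion_eq_smoothing:
  fixes M :: "'a::euclidean_space measure"
  assumes M: "prob_space M" and sets: "sets M = sets borel"
    and char: "\<And>\<xi>. (CLINT z|M. iexp (\<xi> \<bullet> z)) = of_real (\<psi> \<xi>)"
    and \<sigma>: "0 < \<sigma>"
  shows "(LINT z|M. gauss ((y - z) /\<^sub>R \<sigma>)) = \<sigma> ^ DIM('a) * damped_inversion \<sigma> \<psi> y"
proof -
  interpret M: prob_space M by fact
  interpret pair_sigma_finite lborel M ..
  note [measurable_cong] = sets
  have c1: "(LINT z|M. cos (\<xi> \<bullet> z)) = \<psi> \<xi>" and s1: "(LINT z|M. sin (\<xi> \<bullet> z)) = 0" for \<xi>
  proof -
    have i: "complex_integrable M (\<lambda>z. iexp (\<xi> \<bullet> z))"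
      by (rule M.integrable_const_bound[where B=1]) auto
    show "(LINT z|M. cos (\<xi> \<bullet> z)) = \<psi> \<xi>"
      using integral_Re[OF i] by (simp add: char Re_exp)
    show "(LINT z|M. sin (\<xi> \<bullet> z)) = 0"
      using integral_Im[OF i] by (simp add: char Im_exp)
  qed
  have ic: "integrable M (\<lambda>z. cos (\<xi> \<bullet> z))" "integrable M (\<lambda>z. sin (\<xi> \<bullet> z))" for \<xi>
    by (auto intro!: M.integrable_const_bound[where B=1])
  have inner: "(LINT z|M. cos (\<xi> \<bullet> (y - z))) = cos (\<xi> \<bullet> y) * \<psi> \<xi>" for \<xi>
    using ic[of \<xi>] by (simp add: inner_diff_right cos_diff c1 s1)
  have ig: "integrable lborel (\<lambda>\<xi>::'a. gauss (\<sigma> *\<^sub>R \<xi>))"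
    using lborel_integrable_affine[OF integrable_gauss, of \<sigma> "0::'a"] \<sigma> by simp
  have int: "integrable (lborel \<Otimes>\<^sub>M M) (\<lambda>(\<xi>, z). gauss (\<sigma> *\<^sub>R \<xi>) * cos (\<xi> \<bullet> (y - z)))"
  proof (rule Bochner_Integration.integrable_bound)
    show "integrable (lborel \<Otimes>\<^sub>M M) (\<lambda>(\<xi>::'a, z). gauss (\<sigma> *\<^sub>R \<xi>))"
    proof (rule Fubini_integrable)
      show "integrable lborel (\<lambda>\<xi>::'a. LINT z|M. norm (case (\<xi>, z) of (\<xi>, z) \<Rightarrow> gauss (\<sigma> *\<^sub>R \<xi>)))"
        using ig by (simp add: gauss_nonneg M.prob_space)
    qed auto
  qed (auto simp: abs_mult gauss_nonneg split_beta intro!: AE_I2 mult_right_le_one_le)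
  have "(LINT z|M. gauss ((y - z) /\<^sub>R \<sigma>)) =
      (LINT z|M. \<sigma> ^ DIM('a) * gauss (0::'a) * (LINT \<xi>|lborel. gauss (\<sigma> *\<^sub>R \<xi>) * cos (\<xi> \<bullet> (y - z))))"
    by (simp only: integral_gauss_scaled_cos[OF \<sigma>])
  also have "\<dots> = \<sigma> ^ DIM('a) * gauss (0::'a) * (LINT z|M. LINT \<xi>|lborel. gauss (\<sigma> *\<^sub>R \<xi>) * cos (\<xi> \<bullet> (y - z)))"
    by simp
  also have "(LINT z|M. LINT \<xi>|lborel. gauss (\<sigma> *\<^sub>R \<xi>) * cos (\<xi> \<bullet> (y - z))) =
      (LINT \<xi>|lborel. LINT z|M. gauss (\<sigma> *\<^sub>R \<xi>) * cos (\<xi> \<bullet> (y - z)))"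
    by (rule Fubini_integral[OF int])
  also have "\<dots> = (LINT \<xi>|lborel. gauss (\<sigma> *\<^sub>R \<xi>) * (cos (\<xi> \<bullet> y) * \<psi> \<xi>))"
    by (simp add: inner)
  finally show ?thesis by (simp add: damped_inversion_def mult.assoc)
qed

context
  fixes M :: "'a::euclidean_space measure" and \<psi> :: "'a \<Rightarrow> real"
  assumes M: "prob_space M" and sets: "sets M = sets borel"
    and char: "\<And>\<xi>. (CLINT z|M. iexp (\<xi> \<bullet> z)) = of_real (\<psi> \<xi>)"
    and \<psi>: "integrable lborel \<psi>"
begin

lemma damped_inversion_tendsto_fourier_density:
  "(\<lambda>n. damped_inversion (1 / real (Suc n)) \<psi> y) \<longlonglongrightarrow> fourier_density \<psi> y"
  using LIMSEQ_inverse_real_of_nat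
  by (intro damped_inversion_tendsto[OF \<psi>] tendsto_const) (simp add: inverse_eq_divide)

lemma fourier_density_nonneg: "0 \<le> fourier_density \<psi> y"
proof (rule LIMSEQ_le_const[OF damped_inversion_tendsto_fourier_density], intro exI allI impI)
  fix n
  let ?s = "1 / real (Suc n)"
  have "0 \<le> (LINT z|M. gauss ((y - z) /\<^sub>R ?s))" by (simp add: gauss_nonneg)
  then have "0 \<le> ?s ^ DIM('a) * damped_inversion ?s \<psi> y"
    by (subst (asm) damped_inversion_eq_smoothing[OF M sets char]) simp_all
  then show "0 \<le> damped_inversion ?s \<psi> y"
    using mult_le_cancel_left_pos[of "?s ^ DIM('a)" 0] by (simp only: mult_zero_right zero_less_power) simp
qed

lemma borel_measurable_damped_inversion [measurable]: "damped_inversion \<sigma> \<psi> \<in> borel_measurable borel"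
  by (rule borel_measurable_continuous_onI[OF continuous_damped_inversion[OF \<psi>]])

lemma integral_smoothed_density:
  fixes f :: "'a \<Rightarrow> real"
  assumes f: "integrable lborel f" "\<And>x. \<bar>f x\<bar> \<le> B" and \<sigma>: "0 < \<sigma>"
  shows "(LINT y|lborel. f y * damped_inversion \<sigma> \<psi> y) =
    (LINT z|M. LINT v|lborel. f (z + \<sigma> *\<^sub>R v) * gauss v)"
proof -
  interpret M: prob_space M by fact
  interpret pair_sigma_finite lborel M ..
  note [measurable_cong] = sets
  have [measurable]: "f \<in> borel_measurable borel" using f(1) by auto
  define s where "s = inverse (\<sigma> ^ DIM('a))"
  have s: "s * \<sigma> ^ DIM('a) = 1" "0 < s" using \<sigma> by (auto simp: s_def)
  have int: "integrable (lborel \<Otimes>\<^sub>M M) (\<lambda>(y, z). f y * (s * gauss ((y - z) /\<^sub>R \<sigma>)))"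
  proof (rule Bochner_Integration.integrable_bound)
    show "integrable (lborel \<Otimes>\<^sub>M M) (\<lambda>(y, z). \<bar>f y\<bar> * (s * gauss (0::'a)))"
    proof (rule Fubini_integrable)
      show "integrable lborel (\<lambda>y. LINT z|M. norm (case (y, z) of (y, z) \<Rightarrow> \<bar>f y\<bar> * (s * gauss (0::'a))))"
        using f s by (simp add: gauss_nonneg M.prob_space abs_mult)
      show "AE x in lborel. integrable M (\<lambda>y. case (x, y) of (y, z) \<Rightarrow> \<bar>f y\<bar> * (s * gauss (0::'a)))"
        by simp
    qed auto
  next
    have "\<bar>f y * (s * gauss ((y - z) /\<^sub>R \<sigma>))\<bar> \<le> \<bar>f y\<bar> * (s * gauss (0::'a))" for y z
      using s gauss_le by (auto simp: abs_mult gauss_nonneg intro!: mult_left_mono)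
    then show "AE x in lborel \<Otimes>\<^sub>M M. norm (case x of (y, z) \<Rightarrow> f y * (s * gauss ((y - z) /\<^sub>R \<sigma>)))
        \<le> norm (case x of (y, z) \<Rightarrow> \<bar>f y\<bar> * (s * gauss (0::'a)))"
      by (intro AE_I2) (auto simp: split_beta intro: order_trans[OF _ abs_ge_self] simp del: abs_mult)
  qed measurable
  have "(LINT y|lborel. f y * damped_inversion \<sigma> \<psi> y) =
      (LINT y|lborel. f y * (s * (LINT z|M. gauss ((y - z) /\<^sub>R \<sigma>))))"
    unfolding damped_inversion_eq_smoothing[OF M sets char \<sigma>] using s by (simp flip: mult.assoc)
  also have "\<dots> = (LINT y|lborel. LINT z|M. f y * (s * gauss ((y - z) /\<^sub>R \<sigma>)))" by simp
  also have "\<dots> = (LINT z|M. LINT y|lborel. f y * (s * gauss ((y - z) /\<^sub>R \<sigma>)))"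
    by (rule Fubini_integral[OF int, symmetric])
  also have "\<dots> = (LINT z|M. LINT v|lborel. f (z + \<sigma> *\<^sub>R v) * gauss v)"
  proof (rule Bochner_Integration.integral_cong[OF refl])
    fix z
    show "(LINT y|lborel. f y * (s * gauss ((y - z) /\<^sub>R \<sigma>))) = (LINT v|lborel. f (z + \<sigma> *\<^sub>R v) * gauss v)"
      using \<sigma> s by (subst lborel_integral_affine[where c=\<sigma> and t=z])
        (simp_all add: mult.left_commute[of _ s] mult.assoc[symmetric, of "\<sigma> ^ _" s] mult.commute[of _ s])
  qed
  finally show ?thesis .
qed

text \<open>
  The limit \<open>\<sigma> \<rightarrow> 0\<close> of the preceding identity: on the left the damping disappears, and on the right
  \<open>f\<close> is averaged over smaller and smaller neighbourhoods of \<open>z\<close>.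
\<close>

lemma integral_fourier_density_continuous:
  fixes f :: "'a \<Rightarrow> real"
  assumes f: "integrable lborel f" "\<And>x. \<bar>f x\<bar> \<le> B" "continuous_on UNIV f"
  shows "(LINT z|M. f z) = (LINT y|lborel. f y * fourier_density \<psi> y)"
proof (rule LIMSEQ_unique)
  interpret M: prob_space M by fact
  note [measurable_cong] = sets
  have [measurable]: "f \<in> borel_measurable borel" using f(1) by auto
  let ?q = "\<lambda>n. damped_inversion (1 / real (Suc n)) \<psi>" and ?C = "(gauss (0::'a))\<^sup>2 * (LINT \<xi>|lborel. \<bar>\<psi> \<xi>\<bar>)"
  have lim0: "(\<lambda>n. (1 / real (Suc n))) \<longlonglongrightarrow> 0"
    using LIMSEQ_inverse_real_of_nat by (simp add: inverse_eq_divide)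
  show "(\<lambda>n. LINT y|lborel. f y * ?q n y) \<longlonglongrightarrow> (LINT y|lborel. f y * fourier_density \<psi> y)"
  proof (rule integral_dominated_convergence[where w="\<lambda>y. \<bar>f y\<bar> * ?C"])
    show "AE y in lborel. (\<lambda>n. f y * ?q n y) \<longlonglongrightarrow> f y * fourier_density \<psi> y"
      by (intro AE_I2 tendsto_mult tendsto_const damped_inversion_tendsto_fourier_density)
    show "AE y in lborel. norm (f y * ?q n y) \<le> \<bar>f y\<bar> * ?C" for n
      using abs_damped_inversion_le[OF \<psi>] by (intro AE_I2) (simp add: abs_mult mult_left_mono)
    show "integrable lborel (\<lambda>y. \<bar>f y\<bar> * ?C)"
      using f(1) by (intro integrable_mult_left integrable_abs)
  qed measurable
  have bnd: "\<bar>LINT v|lborel. f (z + s *\<^sub>R v) * gauss v\<bar> \<le> B" for z s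
  proof -
    have b: "\<bar>f (z + s *\<^sub>R v) * gauss v\<bar> \<le> B * gauss v" for v :: 'a
      using f(2) by (auto simp: abs_mult gauss_nonneg intro!: mult_right_mono)
    have i: "integrable lborel (\<lambda>v::'a. B * gauss v)" using integrable_gauss by auto
    have "integrable lborel (\<lambda>v. f (z + s *\<^sub>R v) * gauss v)"
      using b by (intro Bochner_Integration.integrable_bound[OF i] AE_I2) (auto intro: order_trans[OF _ abs_ge_self])
    from Bochner_Integration.integral_norm_bound_integral[OF this i] b show ?thesis by (auto simp: integral_gauss)
  qed
  have "(\<lambda>n. LINT z|M. LINT v|lborel. f (z + (1 / real (Suc n)) *\<^sub>R v) * gauss v) \<longlonglongrightarrow> (LINT z|M. f z)"
  proof (rule integral_dominated_convergence[where w="\<lambda>_. B"])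
    show "AE z in M. (\<lambda>n. LINT v|lborel. f (z + (1 / real (Suc n)) *\<^sub>R v) * gauss v) \<longlonglongrightarrow> f z"
    proof (rule AE_I2)
      fix z
      have "(\<lambda>n. LINT v|lborel. f (z + (1 / real (Suc n)) *\<^sub>R v) * gauss v) \<longlonglongrightarrow> (LINT v|lborel. f z * gauss (v::'a))"
      proof (rule integral_dominated_convergence[where w="\<lambda>v. B * gauss v"])
        show "AE v in lborel. (\<lambda>n. f (z + (1 / real (Suc n)) *\<^sub>R v) * gauss v) \<longlonglongrightarrow> f z * gauss v"
        proof (intro AE_I2 tendsto_mult tendsto_const)
          fix v
          have "(\<lambda>n. z + (1 / real (Suc n)) *\<^sub>R v) \<longlonglongrightarrow> z + 0 *\<^sub>R v"
            by (intro tendsto_intros lim0)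
          then show "(\<lambda>n. f (z + (1 / real (Suc n)) *\<^sub>R v)) \<longlonglongrightarrow> f z"
            using continuous_on_tendsto_compose[OF f(3)] by force
        qed
        show "AE v in lborel. norm (f (z + (1 / real (Suc n)) *\<^sub>R v) * gauss v) \<le> B * gauss v" for n
          using f(2) by (auto simp: abs_mult gauss_nonneg intro!: mult_right_mono)
      qed (use integrable_gauss in auto)
      then show "(\<lambda>n. LINT v|lborel. f (z + (1 / real (Suc n)) *\<^sub>R v) * gauss v) \<longlonglongrightarrow> f z"
        by (simp add: integral_gauss)
    qed
  qed (use bnd in auto)
  then show "(\<lambda>n. LINT y|lborel. f y * ?q n y) \<longlonglongrightarrow> (LINT z|M. f z)"
    by (subst integral_smoothed_density[OF f(1,2)]) auto
qed

text \<open>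
  Fourier inversion for measures. Boxes generate the Borel sets and are stable under intersection,
  and the indicator of a box is a limit of continuous functions supported in the box.
\<close>

theorem density_fourier_density: "M = density lborel (fourier_density \<psi>)"
proof (rule measure_eqI_generator_eq)
  interpret M: prob_space M by fact
  note [measurable_cong] = sets
  let ?E = "range (\<lambda>(a, b). box a b::'a set)"
  show "Int_stable ?E" by (auto simp: Int_stable_def box_Int_box)
  show "?E \<subseteq> Pow UNIV" "sets M = sigma_sets UNIV ?E" "sets (density lborel (fourier_density \<psi>)) = sigma_sets UNIV ?E"
    by (simp_all add: borel_eq_box sets)
  show "range (\<lambda>n. box (- real n *\<^sub>R One) (real n *\<^sub>R One) :: 'a set) \<subseteq> ?E" by auto
  show "(\<Union>n. box (- real n *\<^sub>R One) (real n *\<^sub>R One)) = (UNIV :: 'a set)"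
    unfolding UN_box_eq_UNIV[symmetric] by simp
  show "emeasure M (box (- real n *\<^sub>R One) (real n *\<^sub>R One)) \<noteq> \<infinity>" for n by simp
next
  interpret M: prob_space M by fact
  note [measurable_cong] = sets
  fix X :: "'a set"
  assume "X \<in> range (\<lambda>(a, b). box a b::'a set)"
  then obtain a b where X: "X = box a b" by auto
  let ?q = "fourier_density \<psi>"
  let ?C = "(gauss (0::'a))\<^sup>2 * (LINT \<xi>|lborel. \<bar>\<psi> \<xi>\<bar>)"
  have fin: "emeasure lborel X < \<infinity>" by (simp add: X emeasure_lborel_box_eq)
  have cl: "closed (- X)" using X by (simp add: closed_Compl open_box)
  have ne: "- X \<noteq> {}" unfolding X
    by (metis Compl_empty_eq bounded_box compl_eq_compl_iff not_bounded_UNIV double_compl)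
  define f where "f n x = min 1 (real (n::nat) * infdist x (- X))" for n x
  have f01: "0 \<le> f n x" "f n x \<le> 1" "x \<notin> X \<Longrightarrow> f n x = 0" for n x
    by (auto simp: f_def infdist_nonneg)
  have fc: "continuous_on UNIV (f n)" for n
    unfolding f_def by (intro continuous_intros)
  have [measurable]: "f n \<in> borel_measurable borel" for n
    by (rule borel_measurable_continuous_onI[OF fc])
  have [measurable]: "X \<in> sets borel" by (simp add: X)
  have fle: "f n x \<le> indicator X x" for n x using f01(1,2)[of n x] f01(3)[of x n] by (auto simp: indicator_def)
  have iX: "integrable lborel (indicator X :: 'a \<Rightarrow> real)" using fin by simp
  have fi: "integrable lborel (f n)" for n
    by (rule Bochner_Integration.integrable_bound[OF iX]) (auto simp: f01 fle)
  have flim: "(\<lambda>n. f n x) \<longlonglongrightarrow> indicator X x" for x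
  proof (cases "x \<in> X")
    case True
    then have "0 < infdist x (- X)" using cl ne infdist_pos_not_in_closed by fastforce
    then obtain N :: nat where N: "1 < real N * infdist x (- X)"
      using ex_less_of_nat_mult[of "infdist x (- X)" 1] by blast
    have "f n x = 1" if "n \<ge> N" for n
    proof -
      have "real N * infdist x (- X) \<le> real n * infdist x (- X)"
        using that by (intro mult_right_mono) (auto simp: infdist_nonneg)
      then show ?thesis using N by (simp add: f_def)
    qed
    then have "eventually (\<lambda>n. f n x = indicator X x) sequentially"
      using True by (auto simp: eventually_sequentially)
    then show ?thesis by (rule tendsto_eventually)
  qed (simp add: f01(3))
  have qb: "\<bar>?q y\<bar> \<le> ?C" for y by (rule abs_damped_inversion_le[OF \<psi>])
  have iqX: "integrable lborel (\<lambda>y. indicator X y * ?q y)"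
    by (rule Bochner_Integration.integrable_bound[OF integrable_mult_left[OF iX, of ?C]])
      (auto simp: abs_mult indicator_def intro!: AE_I2 order_trans[OF qb] qb)
  have l1: "(\<lambda>n. LINT z|M. f n z) \<longlonglongrightarrow> (LINT z|M. indicator X z)"
    by (rule integral_dominated_convergence[where w="\<lambda>_. 1"]) (use flim f01 in auto)
  have l2: "(\<lambda>n. LINT y|lborel. f n y * ?q y) \<longlonglongrightarrow> (LINT y|lborel. indicator X y * ?q y)"
  proof (rule integral_dominated_convergence[where w="\<lambda>y. indicator X y * ?C"])
    show "AE y in lborel. norm (f n y * ?q y) \<le> indicator X y * ?C" for n
      using fle f01 qb by (auto simp: abs_mult intro!: mult_mono)
  qed (use iX flim in \<open>auto intro!: tendsto_intros\<close>)
  have "(LINT z|M. indicator X z) = (LINT y|lborel. indicator X y * ?q y)"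
  proof (rule LIMSEQ_unique[OF l1])
    show "(\<lambda>n. LINT z|M. f n z) \<longlonglongrightarrow> (LINT y|lborel. indicator X y * ?q y)"
      using l2 integral_fourier_density_continuous[OF fi _ fc, of _ 1] f01 by (simp add: abs_of_nonneg)
  qed
  then have "emeasure M X = ennreal (LINT y|lborel. indicator X y * ?q y)"
    by (simp add: M.emeasure_eq_measure)
  also have "\<dots> = (\<integral>\<^sup>+ y. ennreal (indicator X y * ?q y) \<partial>lborel)"
    by (rule nn_integral_eq_integral[OF iqX, symmetric]) (simp add: fourier_density_nonneg)
  also have "\<dots> = emeasure (density lborel ?q) X"
    by (subst emeasure_density) (auto intro!: nn_integral_cong simp: indicator_def)
  finally show "emeasure M X = emeasure (density lborel ?q) X" .
qed

end

text \<open>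
  This is Scheffe's lemma: the translates have the same integral and converge pointwise.
\<close>

lemma translates_tendsto_L1:
  fixes q :: "'a::euclidean_space \<Rightarrow> real"
  assumes q: "continuous_on UNIV q" "integrable lborel q" and u: "u \<longlonglongrightarrow> x"
  shows "(\<lambda>n. LINT y|lborel. \<bar>q (y - u n) - q (y - x)\<bar>) \<longlonglongrightarrow> 0"
proof -
  have [measurable]: "q \<in> borel_measurable borel" using q(2) by auto
  have i: "integrable lborel (\<lambda>y. q (y - v))" for v
    using lborel_integrable_affine[OF q(2), of 1 "- v"] by simp
  have eq: "(\<integral>\<^sup>+ y. ennreal (norm (q (y - v))) \<partial>lborel) = (\<integral>\<^sup>+ y. ennreal (norm (q y)) \<partial>lborel)" for v
    by (subst lborel_nn_integral_affine[of _ 1 v]) auto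
  have "(\<lambda>n. \<integral>\<^sup>+ y. ennreal (norm (q (y - u n) - q (y - x))) \<partial>lborel) \<longlonglongrightarrow> 0"
  proof (rule Scheffe_lemma2)
    show "AE y in lborel. (\<lambda>n. q (y - u n)) \<longlonglongrightarrow> q (y - x)"
      by (intro AE_I2 continuous_on_tendsto_compose[OF q(1)] tendsto_intros u) auto
  qed (auto intro: i simp: eq[unfolded real_norm_def])
  moreover have "(\<integral>\<^sup>+ y. ennreal (norm (q (y - u n) - q (y - x))) \<partial>lborel) =
      ennreal (LINT y|lborel. \<bar>q (y - u n) - q (y - x)\<bar>)" for n
    unfolding real_norm_def by (rule nn_integral_eq_integral) (auto intro!: i)
  ultimately have "(\<lambda>n. ennreal (LINT y|lborel. \<bar>q (y - u n) - q (y - x)\<bar>)) \<longlonglongrightarrow> ennreal 0"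
    by simp
  then show ?thesis by (rule tendsto_ennrealD) auto
qed

section \<open>Laws and independence on product spaces\<close>

text \<open>
  Independence of increments is given along monotone sequences of times, whereas laws on path space
  are tested on finite sets of times. The sequence is constant after the largest element.
\<close>

lemma finite_set_mono_enumeration:
  fixes T :: "real set"
  assumes "finite T" "T \<noteq> {}"
  obtains \<tau> :: "nat \<Rightarrow> real" and n where "mono \<tau>" "range \<tau> = T" "T = \<tau> ` {..n}"
proof -
  define L where "L = sorted_list_of_set T"
  have L: "sorted L" "set L = T" "L \<noteq> []" using assms by (auto simp: L_def)
  define n where "n = length L - 1"
  define \<tau> where "\<tau> i = L ! min i n" for i
  have n: "i \<le> n \<longleftrightarrow> i < length L" for i using L(3) by (cases L) (auto simp: n_def)
  have mn: "min i n < length L" for i using n[of "min i n"] by simp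
  have "mono \<tau>"
    unfolding \<tau>_def by (intro monoI sorted_nth_mono[OF L(1)] mn) (simp add: min_le_iff_disj)
  moreover have "range \<tau> \<subseteq> T" using nth_mem[OF mn] L(2) by (auto simp: \<tau>_def)
  moreover have "T \<subseteq> \<tau> ` {..n}"
  proof
    fix t assume "t \<in> T"
    then obtain i where "i < length L" "L ! i = t" using L(2) by (metis in_set_conv_nth)
    then show "t \<in> \<tau> ` {..n}" using n[of i] by (intro image_eqI[of _ _ i]) (simp_all add: \<tau>_def min_absorb1)
  qed
  moreover have "\<tau> ` {..n} \<subseteq> range \<tau>" by blast
  ultimately show ?thesis using that[of \<tau> n] by (meson subset_antisym subset_trans)
qed

lemma vimage_prod_emb:
  assumes Y: "Y \<in> measurable M (PiM I S)"
  shows "Y -` prod_emb I S J E \<inter> space M = (\<lambda>\<omega>. restrict (Y \<omega>) J) -` E \<inter> space M"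
  using measurable_space[OF Y] by (auto simp: prod_emb_iff space_PiM PiE_iff)

lemma sigma_sets_vimage_PiM:
  assumes Y: "Y \<in> measurable M (PiM I S)"
  shows "sigma_sets (space M) {Y -` A \<inter> space M | A. A \<in> sets (PiM I S)} =
    sigma_sets (space M) {Y -` A \<inter> space M | A. A \<in> prod_algebra I S}"
proof -
  have "Y \<in> space M \<rightarrow> (\<Pi>\<^sub>E i\<in>I. space (S i))"
    using Y by (auto simp: measurable_def space_PiM)
  then have "{Y -` A \<inter> space M | A. A \<in> sets (PiM I S)} =
      sigma_sets (space M) {Y -` A \<inter> space M | A. A \<in> prod_algebra I S}"
    unfolding sets_PiM by (rule sigma_sets_vimage_commute)
  then show ?thesis by (simp only:) (rule sigma_sets_sigma_sets_eq, auto)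
qed

lemma Int_stable_vimage:
  assumes "Int_stable E"
  shows "Int_stable {Y -` A \<inter> B | A. A \<in> E}"
proof (rule Int_stableI, safe)
  fix A A' assume "A \<in> E" "A' \<in> E"
  then show "\<exists>C. Y -` A \<inter> B \<inter> (Y -` A' \<inter> B) = Y -` C \<inter> B \<and> C \<in> E"
    using assms by (intro exI[of _ "A \<inter> A'"]) (auto simp: Int_stable_def)
qed

text \<open>
  The cylinders form an intersection-stable generator of the product \<open>\<sigma>\<close>-algebra.
\<close>

lemma (in prob_space) indep_var_PiM_of_finite:
  assumes Y: "Y \<in> measurable M (PiM I S)" and Z: "Z \<in> measurable M (PiM K T)"
    and fin: "\<And>J L. finite J \<Longrightarrow> J \<subseteq> I \<Longrightarrow> finite L \<Longrightarrow> L \<subseteq> K \<Longrightarrow>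
      indep_var (PiM J S) (\<lambda>\<omega>. restrict (Y \<omega>) J) (PiM L T) (\<lambda>\<omega>. restrict (Z \<omega>) L)"
  shows "indep_var (PiM I S) Y (PiM K T) Z"
proof -
  let ?G = "{Y -` A \<inter> space M | A. A \<in> prod_algebra I S}" and ?H = "{Z -` A \<inter> space M | A. A \<in> prod_algebra K T}"
  have "indep_set ?G ?H"
    unfolding indep_sets2_eq
  proof (intro conjI ballI)
    show "?G \<subseteq> events" "?H \<subseteq> events"
      using measurable_sets[OF Y] measurable_sets[OF Z] by (auto simp: sets_PiM)
    fix a b assume "a \<in> ?G" "b \<in> ?H"
    then obtain A B where AB: "a = Y -` A \<inter> space M" "A \<in> prod_algebra I S"
        "b = Z -` B \<inter> space M" "B \<in> prod_algebra K T" by auto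
    obtain J E where J: "A = prod_emb I S J (Pi\<^sub>E J E)" "finite J" "J \<subseteq> I" "\<And>i. i \<in> J \<Longrightarrow> E i \<in> sets (S i)"
      using AB(2) by (elim prod_algebraE) auto
    obtain L F where L: "B = prod_emb K T L (Pi\<^sub>E L F)" "finite L" "L \<subseteq> K" "\<And>i. i \<in> L \<Longrightarrow> F i \<in> sets (T i)"
      using AB(4) by (elim prod_algebraE) auto
    have "Pi\<^sub>E J E \<in> sets (PiM J S)" "Pi\<^sub>E L F \<in> sets (PiM L T)"
      using J L by (auto intro!: sets_PiM_I_finite)
    then show "prob (a \<inter> b) = prob a * prob b"
      using fin[OF J(2,3) L(2,3)]
      unfolding AB J(1) L(1) vimage_prod_emb[OF Y] vimage_prod_emb[OF Z] indep_var_eq indep_sets2_eq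
      by (blast intro: sigma_sets.Basic)
  qed
  then have "indep_set (sigma_sets (space M) ?G) (sigma_sets (space M) ?H)"
    by (intro indep_set_sigma_sets Int_stable_vimage Int_stable_prod_algebra)
  then show ?thesis
    unfolding indep_var_eq sigma_sets_vimage_PiM[OF Y] sigma_sets_vimage_PiM[OF Z] using Y Z by blast
qed

lemma emeasure_distr_prod_emb:
  assumes Y: "Y \<in> measurable M (PiM I S)" and J: "finite J" "J \<subseteq> I" "\<And>i. i \<in> J \<Longrightarrow> A i \<in> sets (S i)"
  shows "emeasure (distr M (PiM I S) Y) (prod_emb I S J (Pi\<^sub>E J A)) =
    emeasure (distr M (PiM J S) (\<lambda>\<omega>. restrict (Y \<omega>) J)) (Pi\<^sub>E J A)"
proof -
  have "(\<lambda>\<omega>. restrict (Y \<omega>) J) \<in> measurable M (PiM J S)"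
    using measurable_compose[OF Y measurable_restrict_subset[OF J(2)]] .
  moreover have "prod_emb I S J (Pi\<^sub>E J A) \<in> sets (PiM I S)"
    using J by (intro sets_PiM_I) auto
  moreover have "Pi\<^sub>E J A \<in> sets (PiM J S)" using J by (intro sets_PiM_I_finite) auto
  ultimately show ?thesis using Y by (simp add: emeasure_distr vimage_prod_emb[OF Y])
qed

text \<open>
  All nonnegative times are kept as coordinates: laws on this space are determined by the
  finite-dimensional distributions, but the regularity of paths is not visible in it.
\<close>

abbreviation path_space :: "(real \<Rightarrow> 'a::euclidean_space) measure" where
  "path_space \<equiv> PiM {0..} (\<lambda>_. borel)"

definition translate :: "'a::euclidean_space \<Rightarrow> (real \<Rightarrow> 'a) \<Rightarrow> real \<Rightarrow> 'a" where
  "translate x w = (\<lambda>u\<in>{0..}. x + w u)"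

lemma measurable_translate_pair [measurable]:
  "(\<lambda>(x, w). translate x w) \<in> measurable (borel \<Otimes>\<^sub>M path_space) path_space"
  unfolding translate_def case_prod_beta by measurable

lemma measurable_translate [measurable (raw)]:
  assumes [measurable]: "f \<in> borel_measurable M" "g \<in> measurable M path_space"
  shows "(\<lambda>x. translate (f x) (g x)) \<in> measurable M path_space"
  using measurable_compose[OF measurable_Pair[OF assms] measurable_translate_pair] by simp

section \<open>Law of the recentred path and the Markov property\<close>

locale stable_process = symmetric_stable_process \<alpha> c \<Omega> P X
  for \<alpha> c :: real and \<Omega> :: "'w measure" and P :: "'a::euclidean_space \<Rightarrow> 'w measure"
    and X :: "real \<Rightarrow> 'w \<Rightarrow> 'a" +
  assumes alpha_pos: "0 < \<alpha>" and c_pos: "0 < c"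
begin

sublocale P: prob_space "P x" for x
  by (rule prob_space_P)

lemma space_P: "space (P x) = space \<Omega>"
  using sets_P by (rule sets_eq_imp_space_eq)

lemma measurable_P: "f \<in> measurable \<Omega> N \<Longrightarrow> f \<in> measurable (P x) N"
  by (simp add: measurable_cong_sets[OF sets_P refl])

lemma measurable_X_P [measurable (raw)]: "0 \<le> t \<Longrightarrow> X t \<in> borel_measurable (P x)"
  by (intro measurable_P measurable_X)

definition transition_density :: "real \<Rightarrow> 'a \<Rightarrow> real" where
  "transition_density h = fourier_density (\<lambda>\<xi>. exp (- (c * h * norm \<xi> powr \<alpha>)))"

definition increment_law :: "real \<Rightarrow> 'a measure" where
  "increment_law h = (if h = 0 then return borel 0 else density lborel (transition_density h))"

lemma char_increment:
  assumes "0 \<le> h"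
  shows "(CLINT z|distr (P x) borel (\<lambda>\<omega>. X h \<omega> - X 0 \<omega>). iexp (\<xi> \<bullet> z)) =
    of_real (exp (- (c * h * norm \<xi> powr \<alpha>)))"
proof -
  have "(CLINT z|distr (P x) borel (\<lambda>\<omega>. X h \<omega> - X 0 \<omega>). iexp (\<xi> \<bullet> z)) =
      (CLINT \<omega>|P x. iexp (\<xi> \<bullet> (X h \<omega> - X 0 \<omega>)))"
    using assms by (intro integral_distr) auto
  also have "\<dots> = (CLINT \<omega>|P x. iexp (\<xi> \<bullet> (X h \<omega> - x)))"
    using start[of x] assms by (intro integral_cong_AE) (measurable, auto)
  finally show ?thesis using characteristic_function[OF assms] by simp
qed

lemma integrable_stable_exponent:
  "0 < h \<Longrightarrow> integrable lborel (\<lambda>\<xi>::'a. exp (- (c * h * norm \<xi> powr \<alpha>)))"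
  using alpha_pos c_pos by (intro integrable_exp_minus_norm_powr) auto

lemma prob_space_increment: "0 \<le> s \<Longrightarrow> 0 \<le> h \<Longrightarrow> prob_space (distr (P x) borel (\<lambda>\<omega>. X (s + h) \<omega> - X s \<omega>))"
  by (intro P.prob_space_distr) measurable

text \<open>
  The characteristic function determines the law through the inversion formula. In particular the
  law of an increment is the same under all \<open>P\<^sub>x\<close>.
\<close>

lemma distr_increment:
  assumes "0 \<le> s" "0 \<le> h"
  shows "distr (P x) borel (\<lambda>\<omega>. X (s + h) \<omega> - X s \<omega>) = increment_law h"
proof (cases "h = 0")
  case True
  then show ?thesis
    by (simp add: increment_law_def)
next
  case False
  then have h: "0 < h" using assms by simp
  have ps: "prob_space (distr (P x) borel (\<lambda>\<omega>. X h \<omega> - X 0 \<omega>))"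
    using prob_space_increment[of 0 h] h by simp
  show ?thesis
    unfolding stationary_increments[OF assms]
    using density_fourier_density[OF ps _ char_increment integrable_stable_exponent[OF h]] h
    by (simp add: increment_law_def transition_density_def)
qed

lemma transition_density_properties:
  assumes "0 < h"
  shows "continuous_on UNIV (transition_density h)" "0 \<le> transition_density h y" "\<exists>C. \<forall>y. transition_density h y \<le> C"
    "transition_density h \<in> borel_measurable borel" "integrable lborel (transition_density h)"
proof -
  note ii = integrable_stable_exponent[OF assms]
  have ps: "prob_space (distr (P 0) borel (\<lambda>\<omega>. X h \<omega> - X 0 \<omega>))"
    using prob_space_increment[of 0 h] assms by simp
  show c: "continuous_on UNIV (transition_density h)"
    unfolding transition_density_def by (rule continuous_damped_inversion[OF ii])
  show nn: "0 \<le> transition_density h y" for y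
    unfolding transition_density_def using assms by (intro fourier_density_nonneg[OF ps _ char_increment ii]) auto
  show "\<exists>C. \<forall>y. transition_density h y \<le> C"
    using abs_damped_inversion_le[OF ii, of 0] unfolding transition_density_def by (meson abs_le_D1)
  show [measurable]: "transition_density h \<in> borel_measurable borel"
    by (rule borel_measurable_continuous_onI[OF c])
  have "prob_space (increment_law h)"
    using prob_space_increment[of 0 h 0] distr_increment[of 0 h 0] assms by simp
  then have "(\<integral>\<^sup>+ y. ennreal (transition_density h y) \<partial>lborel) = 1"
    using prob_space.emeasure_space_1[of "increment_law h"] assms
    by (simp add: increment_law_def emeasure_density)
  then show "integrable lborel (transition_density h)"
    using nn by (simp add: integrable_iff_bounded)
qed

definition shifted :: "real \<Rightarrow> 'w \<Rightarrow> real \<Rightarrow> 'a" where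
  "shifted s \<omega> = (\<lambda>u\<in>{0..}. X (s + u) \<omega> - X s \<omega>)"

definition past :: "real \<Rightarrow> 'w \<Rightarrow> real \<Rightarrow> 'a" where
  "past s \<omega> = (\<lambda>u\<in>{0..}. X (min u s) \<omega> - X 0 \<omega>)"

definition path_from :: "real \<Rightarrow> 'w \<Rightarrow> real \<Rightarrow> 'a" where
  "path_from s \<omega> = (\<lambda>u\<in>{0..}. X (s + u) \<omega>)"

definition stopped :: "real \<Rightarrow> 'w \<Rightarrow> real \<Rightarrow> 'a" where
  "stopped s \<omega> = (\<lambda>u\<in>{0..}. X (min u s) \<omega>)"

lemma measurable_shifted [measurable (raw)]: "0 \<le> s \<Longrightarrow> shifted s \<in> measurable (P x) path_space"
  unfolding shifted_def[abs_def] by (intro measurable_restrict borel_measurable_diff measurable_X_P) auto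

lemma measurable_past [measurable (raw)]: "0 \<le> s \<Longrightarrow> past s \<in> measurable (P x) path_space"
  unfolding past_def[abs_def] by (intro measurable_restrict borel_measurable_diff measurable_X_P) auto

lemma measurable_path [measurable (raw)]: "0 \<le> s \<Longrightarrow> path_from s \<in> measurable (P x) path_space"
  unfolding path_from_def[abs_def] by (intro measurable_restrict measurable_X_P) auto

lemma measurable_stopped [measurable (raw)]: "0 \<le> s \<Longrightarrow> stopped s \<in> measurable (P x) path_space"
  unfolding stopped_def[abs_def] by (intro measurable_restrict measurable_X_P) auto

lemma path_eq_translate: "path_from s \<omega> = translate (X s \<omega>) (shifted s \<omega>)"
  by (auto simp: path_from_def translate_def shifted_def)

lemma stopped_eq_translate: "stopped s \<omega> = translate (X 0 \<omega>) (past s \<omega>)"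
  by (auto simp: stopped_def translate_def past_def)

lemma distr_increments:
  assumes "mono \<tau>" "0 \<le> \<tau> 0"
  shows "distr (P x) (PiM {..<Suc n} (\<lambda>_. borel)) (\<lambda>\<omega>. \<lambda>i\<in>{..<Suc n}. X (\<tau> (Suc i)) \<omega> - X (\<tau> i) \<omega>) =
    PiM {..<Suc n} (\<lambda>i. increment_law (\<tau> (Suc i) - \<tau> i))"
proof -
  have nn: "0 \<le> \<tau> i" for i using assms monoD[OF assms(1), of 0 i] by simp
  have "distr (P x) (PiM {..<Suc n} (\<lambda>_. borel)) (\<lambda>\<omega>. \<lambda>i\<in>{..<Suc n}. X (\<tau> (Suc i)) \<omega> - X (\<tau> i) \<omega>) =
    PiM {..<Suc n} (\<lambda>i. distr (P x) borel (\<lambda>\<omega>. X (\<tau> (Suc i)) \<omega> - X (\<tau> i) \<omega>))"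
    using independent_increments[OF assms, of x "Suc n"]
    by (subst (asm) P.indep_vars_iff_distr_eq_PiM') (auto intro!: measurable_X_P nn borel_measurable_diff)
  also have "\<dots> = PiM {..<Suc n} (\<lambda>i. increment_law (\<tau> (Suc i) - \<tau> i))"
  proof (rule PiM_cong[OF refl])
    fix i
    have "\<tau> i \<le> \<tau> (Suc i)" using assms(1) by (simp add: monoD)
    then show "distr (P x) borel (\<lambda>\<omega>. X (\<tau> (Suc i)) \<omega> - X (\<tau> i) \<omega>) = increment_law (\<tau> (Suc i) - \<tau> i)"
      using distr_increment[OF nn, of "\<tau> (Suc i) - \<tau> i" x i] by simp
  qed
  finally show ?thesis .
qed

text \<open>
  Finitely many positions of the recentred path are partial sums of increments along one monotone
  sequence of times, and the joint law of these increments is the product of their laws.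
\<close>

lemma distr_shifted_finite:
  assumes J: "finite J" "J \<subseteq> {0..}" and s: "0 \<le> s" "0 \<le> s'"
  shows "distr (P x) (PiM J (\<lambda>_. borel)) (\<lambda>\<omega>. restrict (shifted s \<omega>) J) =
    distr (P x') (PiM J (\<lambda>_. borel)) (\<lambda>\<omega>. restrict (shifted s' \<omega>) J)"
proof -
  obtain \<tau> :: "nat \<Rightarrow> real" and n where \<tau>: "mono \<tau>" "range \<tau> = insert 0 J" "insert 0 J = \<tau> ` {..n}"
    using finite_set_mono_enumeration[of "insert 0 J"] J(1) by (metis finite_insert insert_not_empty)
  obtain i0 where "\<tau> i0 = 0" using \<tau>(2) by (metis insertI1 rangeE)
  then have "\<tau> 0 \<le> 0" using monoD[OF \<tau>(1), of 0 i0] by simp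
  moreover have "0 \<le> \<tau> i" for i using \<tau>(2) J by (metis atLeast_iff insert_iff order_refl rangeI subsetD)
  ultimately have t0: "\<tau> 0 = 0" by (simp add: antisym)
  have "\<exists>i\<le>n. \<tau> i = u" if "u \<in> J" for u
    using that \<tau>(3) by (metis atMost_iff imageE insertI2)
  then obtain ix where ix: "\<And>u. u \<in> J \<Longrightarrow> ix u \<le> n \<and> \<tau> (ix u) = u" by metis
  define \<Phi> where "\<Phi> w = (\<lambda>u\<in>J. \<Sum>i<ix u. w i)" for w :: "nat \<Rightarrow> 'a"
  have \<Phi>: "\<Phi> \<in> measurable (PiM {..<Suc n} (\<lambda>_. borel)) (PiM J (\<lambda>_. borel))"
    unfolding \<Phi>_def
    by (intro measurable_restrict borel_measurable_sum measurable_component_singleton)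
      (use ix in \<open>force\<close>)
  have main: "distr (P x) (PiM J (\<lambda>_. borel)) (\<lambda>\<omega>. restrict (shifted s \<omega>) J) =
      distr (PiM {..<Suc n} (\<lambda>i. increment_law (\<tau> (Suc i) - \<tau> i))) (PiM J (\<lambda>_. borel)) \<Phi>"
    if s: "0 \<le> s" for x s
  proof -
    have m: "mono (\<lambda>i. s + \<tau> i)" using \<tau>(1) by (auto simp: mono_def)
    have nn: "0 \<le> s + \<tau> i" for i using s \<open>\<And>i. 0 \<le> \<tau> i\<close> by simp
    define Z where "Z \<omega> = (\<lambda>i\<in>{..<Suc n}. X (s + \<tau> (Suc i)) \<omega> - X (s + \<tau> i) \<omega>)" for \<omega>
    have Z: "Z \<in> measurable (P x) (PiM {..<Suc n} (\<lambda>_. borel))"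
      unfolding Z_def by (intro measurable_restrict borel_measurable_diff measurable_X_P nn)
    have "restrict (shifted s \<omega>) J = \<Phi> (Z \<omega>)" for \<omega>
    proof
      fix u
      show "restrict (shifted s \<omega>) J u = \<Phi> (Z \<omega>) u"
      proof (cases "u \<in> J")
        case True
        then have "u \<in> {0..}" using J by auto
        have "(\<Sum>i<ix u. Z \<omega> i) = (\<Sum>i<ix u. X (s + \<tau> (Suc i)) \<omega> - X (s + \<tau> i) \<omega>)"
          using ix[OF True] by (intro sum.cong) (auto simp: Z_def)
        also have "\<dots> = X (s + \<tau> (ix u)) \<omega> - X (s + \<tau> 0) \<omega>"
          by (rule sum_lessThan_telescope)
        finally show ?thesis using True ix[OF True] t0 \<open>u \<in> {0..}\<close> by (simp add: \<Phi>_def shifted_def)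
      qed (simp add: \<Phi>_def)
    qed
    then have fe: "(\<lambda>\<omega>. restrict (shifted s \<omega>) J) = \<Phi> \<circ> Z"
      by (intro ext) (simp only: o_apply)
    have "distr (P x) (PiM J (\<lambda>_. borel)) (\<lambda>\<omega>. restrict (shifted s \<omega>) J) =
        distr (distr (P x) (PiM {..<Suc n} (\<lambda>_. borel)) Z) (PiM J (\<lambda>_. borel)) \<Phi>"
      unfolding fe by (rule distr_distr[OF \<Phi> Z, symmetric])
    also have "distr (P x) (PiM {..<Suc n} (\<lambda>_. borel)) Z =
        PiM {..<Suc n} (\<lambda>i. increment_law (s + \<tau> (Suc i) - (s + \<tau> i)))"
      unfolding Z_def using nn by (intro distr_increments m)
    finally show ?thesis by (simp only: add_diff_cancel_left)
  qed
  show ?thesis using main[OF s(1), of x] main[OF s(2), of x'] by simp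
qed

text \<open>
  The law of the recentred path, which serves every starting point and every time of recentring.
\<close>

definition path_law :: "(real \<Rightarrow> 'a) measure" where
  "path_law = distr (P 0) path_space (shifted 0)"

lemma distr_shifted:
  assumes "0 \<le> s"
  shows "distr (P x) path_space (shifted s) = path_law"
  unfolding path_law_def
proof (rule measure_eqI_PiM_infinite)
  fix A and J :: "real set" assume J: "finite J" "J \<subseteq> {0..}" "\<And>i. i \<in> J \<Longrightarrow> A i \<in> sets (borel::'a measure)"
  show "emeasure (distr (P x) path_space (shifted s)) (prod_emb {0..} (\<lambda>_. borel) J (Pi\<^sub>E J A)) =
      emeasure (distr (P 0) path_space (shifted 0)) (prod_emb {0..} (\<lambda>_. borel) J (Pi\<^sub>E J A))"
    using assms J
    by (subst (1 2) emeasure_distr_prod_emb)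
      (auto intro!: measurable_shifted simp: distr_shifted_finite[OF J(1,2), of s 0 x 0])
next
  show "finite_measure (distr (P x) path_space (shifted s))"
    by (intro P.finite_measure_distr measurable_shifted assms)
qed auto

lemma prob_space_path_law: "prob_space path_law"
  unfolding path_law_def by (intro P.prob_space_distr measurable_shifted) simp

lemma sets_path_law [measurable_cong]: "sets path_law = sets path_space"
  by (simp add: path_law_def)

text \<open>
  Enumerate all times in question, together with \<open>0\<close> and \<open>s\<close>, monotonically. The past depends on the
  increments before \<open>s\<close> and the recentred future on those after \<open>s\<close>: two disjoint blocks of an
  independent family.
\<close>

lemma indep_past_shifted:
  assumes s: "0 \<le> s"
  shows "P.indep_var x path_space (past s) path_space (shifted s)"
proof (rule P.indep_var_PiM_of_finite)
  fix J L :: "real set"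
  assume J: "finite J" "J \<subseteq> {0..}" and L: "finite L" "L \<subseteq> {0..}"
  define T where "T = {0, s} \<union> (\<lambda>u. min u s) ` J \<union> (+) s ` L"
  have T: "finite T" "T \<noteq> {}" using J L by (auto simp: T_def)
  obtain \<tau> :: "nat \<Rightarrow> real" and n where \<tau>: "mono \<tau>" "range \<tau> = T" "T = \<tau> ` {..n}"
    using finite_set_mono_enumeration[OF T] .
  have nn: "0 \<le> \<tau> i" for i
  proof -
    have "\<tau> i \<in> T" using \<tau>(2) by auto
    then show ?thesis using J L s by (auto simp: T_def)
  qed
  have "0 \<in> range \<tau>" using \<tau>(2) by (simp add: T_def)
  then obtain i0 where "\<tau> i0 = 0" by auto
  then have "\<tau> 0 \<le> 0" using monoD[OF \<tau>(1), of 0 i0] by simp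
  then have t0: "\<tau> 0 = 0" using nn[of 0] by simp
  have "s \<in> \<tau> ` {..n}" unfolding \<tau>(3)[symmetric] by (simp add: T_def)
  then obtain k where k: "k \<le> n" "\<tau> k = s" by auto
  have "\<exists>i\<le>k. \<tau> i = min u s" if "u \<in> J" for u
  proof -
    have "min u s \<in> \<tau> ` {..n}" unfolding \<tau>(3)[symmetric] using that by (simp add: T_def)
    then obtain i where i: "\<tau> i = min u s" by auto
    show ?thesis
    proof (cases "i \<le> k")
      case False
      then have "s \<le> min u s" using monoD[OF \<tau>(1), of k i] k i by simp
      then show ?thesis using k by (intro exI[of _ k]) simp
    qed (use i in auto)
  qed
  then obtain a where a: "\<And>u. u \<in> J \<Longrightarrow> a u \<le> k \<and> \<tau> (a u) = min u s" by metis
  have "\<exists>i\<ge>k. i \<le> n \<and> \<tau> i = s + v" if "v \<in> L" for v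
  proof -
    have "s + v \<in> \<tau> ` {..n}" unfolding \<tau>(3)[symmetric] using that by (simp add: T_def)
    then obtain i where i: "i \<le> n" "\<tau> i = s + v" by auto
    show ?thesis
    proof (cases "k \<le> i")
      case False
      then have "s + v \<le> s" using monoD[OF \<tau>(1), of i k] k i by simp
      moreover have "0 \<le> v" using that L by auto
      ultimately show ?thesis using k by (intro exI[of _ k]) simp
    qed (use i in auto)
  qed
  then obtain b where b: "\<And>v. v \<in> L \<Longrightarrow> k \<le> b v \<and> b v \<le> n \<and> \<tau> (b v) = s + v" by metis
  define inc where "inc i \<omega> = X (\<tau> (Suc i)) \<omega> - X (\<tau> i) \<omega>" for i \<omega>
  define \<Phi> where "\<Phi> w = (\<lambda>u\<in>J. \<Sum>i<a u. w i)" for w :: "nat \<Rightarrow> 'a"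
  define \<Psi> where "\<Psi> w = (\<lambda>v\<in>L. \<Sum>i\<in>{k..<b v}. w i)" for w :: "nat \<Rightarrow> 'a"
  have \<Phi>: "\<Phi> \<in> measurable (PiM {..<k} (\<lambda>_. borel)) (PiM J (\<lambda>_. borel))"
    unfolding \<Phi>_def
    by (intro measurable_restrict borel_measurable_sum measurable_component_singleton)
      (use a in force)
  have \<Psi>: "\<Psi> \<in> measurable (PiM {k..<Suc n} (\<lambda>_. borel)) (PiM L (\<lambda>_. borel))"
    unfolding \<Psi>_def
    by (intro measurable_restrict borel_measurable_sum measurable_component_singleton)
      (use b in force)
  have "P.indep_vars x (\<lambda>_. borel) inc {..<Suc n}"
    unfolding inc_def using \<tau>(1) t0 by (intro independent_increments) auto
  then have "P.indep_var x (PiM {..<k} (\<lambda>_. borel)) (\<lambda>\<omega>. restrict (\<lambda>i. inc i \<omega>) {..<k})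
      (PiM {k..<Suc n} (\<lambda>_. borel)) (\<lambda>\<omega>. restrict (\<lambda>i. inc i \<omega>) {k..<Suc n})"
    using k by (intro P.indep_var_restrict) auto
  from P.indep_var_compose[OF this \<Phi> \<Psi>]
  have "P.indep_var x (PiM J (\<lambda>_. borel)) (\<lambda>\<omega>. \<Phi> (restrict (\<lambda>i. inc i \<omega>) {..<k}))
      (PiM L (\<lambda>_. borel)) (\<lambda>\<omega>. \<Psi> (restrict (\<lambda>i. inc i \<omega>) {k..<Suc n}))"
    by (simp add: o_def)
  moreover have "\<Phi> (restrict (\<lambda>i. inc i \<omega>) {..<k}) = restrict (past s \<omega>) J" for \<omega>
  proof
    fix u
    show "\<Phi> (restrict (\<lambda>i. inc i \<omega>) {..<k}) u = restrict (past s \<omega>) J u"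
    proof (cases "u \<in> J")
      case True
      then have "u \<in> {0..}" using J by auto
      have "(\<Sum>i<a u. restrict (\<lambda>i. inc i \<omega>) {..<k} i) = (\<Sum>i<a u. X (\<tau> (Suc i)) \<omega> - X (\<tau> i) \<omega>)"
        using a[OF True] by (intro sum.cong) (auto simp: inc_def)
      also have "\<dots> = X (\<tau> (a u)) \<omega> - X (\<tau> 0) \<omega>" by (rule sum_lessThan_telescope)
      finally show ?thesis using True a[OF True] t0 \<open>u \<in> {0..}\<close> by (simp add: \<Phi>_def past_def)
    qed (simp add: \<Phi>_def)
  qed
  moreover have "\<Psi> (restrict (\<lambda>i. inc i \<omega>) {k..<Suc n}) = restrict (shifted s \<omega>) L" for \<omega>
  proof
    fix v
    show "\<Psi> (restrict (\<lambda>i. inc i \<omega>) {k..<Suc n}) v = restrict (shifted s \<omega>) L v"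
    proof (cases "v \<in> L")
      case True
      then have "v \<in> {0..}" using L by auto
      have "(\<Sum>i\<in>{k..<b v}. restrict (\<lambda>i. inc i \<omega>) {k..<Suc n} i) = (\<Sum>i\<in>{k..<b v}. X (\<tau> (Suc i)) \<omega> - X (\<tau> i) \<omega>)"
        using b[OF True] by (intro sum.cong) (auto simp: inc_def)
      also have "\<dots> = X (\<tau> (b v)) \<omega> - X (\<tau> k) \<omega>"
        using b[OF True] by (intro sum_Suc_diff') auto
      finally show ?thesis using True b[OF True] k \<open>v \<in> {0..}\<close> by (simp add: \<Psi>_def shifted_def)
    qed (simp add: \<Psi>_def)
  qed
  ultimately show "P.indep_var x (PiM J (\<lambda>_. borel)) (\<lambda>\<omega>. restrict (past s \<omega>) J)
      (PiM L (\<lambda>_. borel)) (\<lambda>\<omega>. restrict (shifted s \<omega>) L)"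
    by simp
qed (use s in \<open>auto intro: measurable_past measurable_shifted\<close>)

lemma expectation_path:
  fixes H :: "(real \<Rightarrow> 'a) \<Rightarrow> real"
  assumes [measurable]: "H \<in> borel_measurable path_space"
  shows "(LINT \<omega>|P x. H (path_from 0 \<omega>)) = (LINT w|path_law. H (translate x w))"
proof -
  have "(LINT \<omega>|P x. H (path_from 0 \<omega>)) = (LINT \<omega>|P x. H (translate x (shifted 0 \<omega>)))"
    using start[of x] by (intro integral_cong_AE) (auto simp: path_eq_translate)
  also have "\<dots> = (LINT w|distr (P x) path_space (shifted 0). H (translate x w))"
    by (intro integral_distr[symmetric]) auto
  finally show ?thesis by (simp add: distr_shifted)
qed

text \<open>
  The past and the recentred future are independent, so their joint law is a product. Fubini's
  theorem integrates the future first, with the position at time \<open>s\<close> frozen.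
\<close>

lemma markov_property:
  fixes G H :: "(real \<Rightarrow> 'a) \<Rightarrow> real"
  assumes [measurable]: "G \<in> borel_measurable path_space" "H \<in> borel_measurable path_space"
    and G: "\<And>w. \<bar>G w\<bar> \<le> B" and H: "\<And>w. \<bar>H w\<bar> \<le> C" and s: "0 \<le> s"
  shows "(LINT \<omega>|P x. G (stopped s \<omega>) * H (path_from s \<omega>)) =
    (LINT \<omega>|P x. G (stopped s \<omega>) * (LINT w|path_law. H (translate (X s \<omega>) w)))"
proof -
  interpret N: prob_space path_law by (rule prob_space_path_law)
  interpret A: prob_space "distr (P x) path_space (past s)"
    using s by (intro P.prob_space_distr) auto
  interpret AN: pair_prob_space "distr (P x) path_space (past s)" path_law ..
  have s0: "s \<in> {0..}" using s by simp
  have Xs: "X s \<omega> = X 0 \<omega> + past s \<omega> s" for \<omega> using s by (simp add: past_def)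
  have [measurable]: "X s \<in> borel_measurable (P x)" "past s \<in> measurable (P x) path_space"
    "shifted s \<in> measurable (P x) path_space" "stopped s \<in> measurable (P x) path_space"
    "path_from s \<in> measurable (P x) path_space" "X 0 \<in> borel_measurable (P x)"
    using s by auto
  have [measurable]: "(\<lambda>w. w s) \<in> borel_measurable (path_space :: (real \<Rightarrow> 'a) measure)"
    by (rule measurable_component_singleton[OF s0])
  have [measurable]: "(\<lambda>p. fst p s) \<in> borel_measurable (path_space \<Otimes>\<^sub>M (path_space :: (real \<Rightarrow> 'a) measure))"
    by (rule measurable_compose[OF measurable_fst measurable_component_singleton[OF s0]])
  let ?F = "\<lambda>(a, b). G (translate x a) * H (translate (x + a s) b)"
  have joint: "distr (P x) (path_space \<Otimes>\<^sub>M path_space) (\<lambda>\<omega>. (past s \<omega>, shifted s \<omega>)) =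
      distr (P x) path_space (past s) \<Otimes>\<^sub>M path_law"
    using indep_past_shifted[OF s, of x] unfolding P.indep_var_distribution_eq distr_shifted[OF s] by simp
  have Fm[measurable]: "?F \<in> borel_measurable (path_space \<Otimes>\<^sub>M path_space)"
    unfolding split_beta by measurable
  have int: "integrable (distr (P x) path_space (past s) \<Otimes>\<^sub>M path_law) ?F"
  proof (rule AN.integrable_const_bound[where B="B * C"])
    have "0 \<le> B" using G[of undefined] by linarith
    then show "AE p in distr (P x) path_space (past s) \<Otimes>\<^sub>M path_law. norm (?F p) \<le> B * C"
      using G H by (auto simp: abs_mult split_beta intro!: mult_mono)
  qed (auto simp: measurable_cong_sets[OF sets_pair_measure_cong[OF _ sets_path_law]])
  have "(LINT \<omega>|P x. G (stopped s \<omega>) * H (path_from s \<omega>)) = (LINT \<omega>|P x. ?F (past s \<omega>, shifted s \<omega>))"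
    using start[of x] by (intro integral_cong_AE) (auto simp: path_eq_translate stopped_eq_translate Xs)
  also have "\<dots> = (LINT p|distr (P x) (path_space \<Otimes>\<^sub>M path_space) (\<lambda>\<omega>. (past s \<omega>, shifted s \<omega>)). ?F p)"
    by (intro integral_distr[symmetric]) auto
  also have "\<dots> = (LINT a|distr (P x) path_space (past s). LINT b|path_law. ?F (a, b))"
    unfolding joint by (rule AN.integral_fst'[OF int, symmetric])
  also have "\<dots> = (LINT \<omega>|P x. LINT b|path_law. ?F (past s \<omega>, b))"
    by (intro integral_distr) auto
  also have "\<dots> = (LINT \<omega>|P x. G (stopped s \<omega>) * (LINT w|path_law. H (translate (X s \<omega>) w)))"
    using start[of x] by (intro integral_cong_AE) (auto simp: path_eq_translate stopped_eq_translate Xs)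
  finally show ?thesis .
qed

end

section \<open>Functionals of right continuous paths\<close>

text \<open>
  The first dyadic time of level \<open>n\<close> that is strictly larger than \<open>s\<close>: values along these times
  determine a right continuous path.
\<close>

definition grid :: "nat \<Rightarrow> real \<Rightarrow> real" where
  "grid n s = (real (nat \<lfloor>s * 2 ^ n\<rfloor>) + 1) / 2 ^ n"

lemma grid_bounds:
  assumes "0 \<le> s"
  shows "s < grid n s" "grid n s \<le> s + 1 / 2 ^ n"
proof -
  have "real (nat \<lfloor>s * 2 ^ n\<rfloor>) = of_int \<lfloor>s * 2 ^ n\<rfloor>" using assms by simp
  then show "s < grid n s" "grid n s \<le> s + 1 / 2 ^ n"
    unfolding grid_def using floor_correct[of "s * 2 ^ n"]
    by (simp_all add: field_simps)
qed

lemma filterlim_grid: "0 \<le> s \<Longrightarrow> filterlim (\<lambda>n. grid n s) (at_right s) sequentially"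
proof (rule filterlim_at_withinI)
  assume s: "0 \<le> s"
  have l: "(\<lambda>n. s + 1 / 2 ^ n) \<longlonglongrightarrow> s + 0"
    by (intro tendsto_intros LIMSEQ_divide_realpow_zero) simp
  show "(\<lambda>n. grid n s) \<longlonglongrightarrow> s"
    by (rule tendsto_sandwich[OF _ _ tendsto_const l[simplified]])
      (use grid_bounds[OF s] in \<open>auto intro: less_imp_le always_eventually\<close>)
  show "\<forall>\<^sub>F n in sequentially. grid n s \<in> {s<..} - {s}"
    using grid_bounds[OF s] by (intro always_eventually) (auto simp: less_le)
qed

definition right_cont :: "(real \<Rightarrow> 'a::topological_space) \<Rightarrow> bool" where
  "right_cont w \<longleftrightarrow> (\<forall>t\<ge>0. (w \<longlongrightarrow> w t) (at_right t))"

text \<open>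
  On the product space the evaluation of a path is measurable for each fixed time only. This limit
  is jointly measurable in path and time, which makes time integrals measurable functionals, and it
  is the usual evaluation on right continuous paths.
\<close>

definition eval_path :: "(real \<Rightarrow> 'a::euclidean_space) \<Rightarrow> real \<Rightarrow> 'a" where
  "eval_path w s = lim (\<lambda>n. w (grid n s))"

lemma eval_path_eq: "right_cont w \<Longrightarrow> 0 \<le> s \<Longrightarrow> eval_path w s = w s"
  unfolding eval_path_def right_cont_def
  by (intro limI filterlim_compose[OF _ filterlim_grid]) auto

lemma measurable_eval_path_pair:
  "(\<lambda>(w, s). eval_path w s) \<in> borel_measurable (path_space \<Otimes>\<^sub>M borel)"
proof -
  have "(\<lambda>p. fst p (grid n (snd p))) \<in> borel_measurable ((path_space :: (real \<Rightarrow> 'a) measure) \<Otimes>\<^sub>M borel)" for n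
  proof -
    have "(\<lambda>p. fst p ((real i + 1) / 2 ^ n)) \<in> borel_measurable ((path_space :: (real \<Rightarrow> 'a) measure) \<Otimes>\<^sub>M borel)" for i
      by (rule measurable_compose[OF measurable_fst measurable_component_singleton]) auto
    moreover have "(\<lambda>p. nat \<lfloor>snd p * (2::real) ^ n\<rfloor>) \<in> measurable ((path_space :: (real \<Rightarrow> 'a) measure) \<Otimes>\<^sub>M borel) (count_space UNIV)"
      by measurable
    ultimately show ?thesis unfolding grid_def by (rule measurable_compose_countable)
  qed
  then show ?thesis unfolding eval_path_def split_beta by (rule borel_measurable_lim_metric)
qed

lemma measurable_eval_path [measurable (raw)]:
  assumes [measurable]: "f \<in> measurable M path_space" "g \<in> borel_measurable M"
  shows "(\<lambda>x. eval_path (f x) (g x)) \<in> borel_measurable M"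
  using measurable_compose[OF measurable_Pair[OF assms] measurable_eval_path_pair] by simp

definition path_integral :: "('a::euclidean_space \<Rightarrow> real) \<Rightarrow> real \<Rightarrow> (real \<Rightarrow> 'a) \<Rightarrow> real" where
  "path_integral V t w = (LINT s:{0..t}|lborel. V (eval_path w s))"

lemma measurable_path_integral:
  assumes [measurable]: "V \<in> borel_measurable borel"
  shows "path_integral V t \<in> borel_measurable path_space"
  unfolding path_integral_def[abs_def] set_lebesgue_integral_def by measurable

lemma ball_Suc_max_subset:
  "ball y (1 / real (Suc (max k l))) \<subseteq> ball y (1 / real (Suc k))"
  "ball y (1 / real (Suc (max k l))) \<subseteq> ball y (1 / real (Suc l))"
  by (auto intro!: subset_ball divide_left_mono)

lemma closed_ball_subset: "closed {y::'a::metric_space. ball y r \<subseteq> U}"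
proof -
  have "{y. ball y r \<subseteq> U} = (\<Inter>z\<in>- U. - ball z r)"
    by (auto simp: dist_commute)
  then show ?thesis by (auto intro!: closed_INT)
qed

text \<open>
  The path keeps a positive distance from the complement of \<open>U\<close> on \<open>[0, t]\<close>. Rational multiples of
  \<open>t\<close> suffice by right continuity, and they make the event measurable. The condition differs from
  \<open>t < \<tau>\<^sub>U\<close> for a path that comes arbitrarily close to the complement without meeting it.
\<close>

definition survives :: "'a::euclidean_space set \<Rightarrow> real \<Rightarrow> (real \<Rightarrow> 'a) \<Rightarrow> bool" where
  "survives U t w \<longleftrightarrow> (\<exists>k::nat. \<forall>q\<in>\<rat> \<inter> {0..1}. ball (w (q * t)) (1 / real (Suc k)) \<subseteq> U)"

lemma measurable_survives:
  assumes "0 \<le> t"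
  shows "Measurable.pred path_space (survives U t)"
proof -
  have [measurable]: "{y. ball y r \<subseteq> U} \<in> sets (borel :: 'a measure)" for r
    by (rule borel_closed[OF closed_ball_subset])
  have "Measurable.pred path_space (\<lambda>w. ball (w (q * t)) r \<subseteq> U)" if "q \<in> \<rat> \<inter> {0..1}" for q r
  proof -
    have "(\<lambda>w. w (q * t)) \<in> borel_measurable (path_space :: (real \<Rightarrow> 'a) measure)"
      using that assms by (intro measurable_component_singleton) auto
    then have "(\<lambda>w. w (q * t)) -` {y. ball y r \<subseteq> U} \<inter> space path_space \<in> sets path_space"
      by (rule measurable_sets) simp
    then show ?thesis by (simp add: pred_def vimage_def Int_def conj_commute)
  qed
  moreover have "countable (\<rat> \<inter> {0..1::real})"
    using countable_rat by (rule countable_subset[rotated]) auto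
  ultimately show ?thesis unfolding survives_def pred_def
    by (intro sets.sets_Collect_countable_Ex sets.sets_Collect_countable_All') auto
qed

lemma rational_approx_right:
  assumes w: "right_cont w" and t: "0 < t" and u: "0 \<le> u" "u < t"
  obtains q where "\<And>n::nat. q n \<in> \<rat> \<inter> {0..1::real}" "(\<lambda>n. w (q n * t)) \<longlonglongrightarrow> w u"
proof -
  have ex: "\<exists>q\<in>\<rat>. u / t < q \<and> q < min 1 (u / t + 1 / real (Suc n))" for n
    using t u by (intro Rats_dense_in_real) auto
  then obtain q where q: "\<And>n. q n \<in> \<rat>" "\<And>n. u / t < q n" "\<And>n. q n < min 1 (u / t + 1 / real (Suc n))"
    by metis
  have u0: "0 \<le> u / t" using u t by simp
  have "(\<lambda>n. q n) \<longlonglongrightarrow> u / t"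
  proof (rule tendsto_sandwich[OF _ _ tendsto_const])
    show "(\<lambda>n. u / t + 1 / real (Suc n)) \<longlonglongrightarrow> u / t"
      using tendsto_add[OF tendsto_const LIMSEQ_inverse_real_of_nat, of "u / t"] by (simp add: inverse_eq_divide)
    show "\<forall>\<^sub>F n in sequentially. u / t \<le> q n" "\<forall>\<^sub>F n in sequentially. q n \<le> u / t + 1 / real (Suc n)"
      using q(2,3) by (auto intro!: always_eventually less_imp_le)
  qed
  then have "(\<lambda>n. q n * t) \<longlonglongrightarrow> u / t * t" by (intro tendsto_intros)
  then have "(\<lambda>n. q n * t) \<longlonglongrightarrow> u" using t by simp
  moreover have "u < q n * t" for n using q(2)[of n] t by (simp add: field_simps)
  ultimately have fl: "filterlim (\<lambda>n. q n * t) (at_right u) sequentially"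
    by (intro filterlim_at_withinI) (auto intro!: always_eventually simp: less_le)
  then have "(\<lambda>n. w (q n * t)) \<longlonglongrightarrow> w u"
    using w u unfolding right_cont_def by (intro filterlim_compose[OF _ fl]) auto
  moreover have "q n \<in> \<rat> \<inter> {0..1}" for n
    using q(1)[of n] q(2)[of n] q(3)[of n] u0 by auto
  ultimately show ?thesis using that by blast
qed

lemma closed_rational_times:
  assumes w: "right_cont w" and t: "0 \<le> t" and C: "closed C"
    and q: "\<And>q. q \<in> \<rat> \<inter> {0..1} \<Longrightarrow> w (q * t) \<in> C" and u: "u \<in> {0..t}"
  shows "w u \<in> C"
proof (cases "u = t")
  case True
  then show ?thesis using q[of 1] by simp
next
  case False
  then have "0 < t" "0 \<le> u" "u < t" using u by auto
  then obtain r where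
    r: "\<And>n::nat. r n \<in> \<rat> \<inter> {0..1::real}" "(\<lambda>n. w (r n * t)) \<longlonglongrightarrow> w u" using rational_approx_right[OF w \<open>0 < t\<close>, of u] by metis
  show ?thesis by (rule closed_sequentially[OF C q[OF r(1)] r(2)])
qed

lemma survives_iff:
  assumes w: "right_cont w" and t: "0 \<le> t"
  shows "survives U t w \<longleftrightarrow> (\<exists>k::nat. \<forall>u\<in>{0..t}. ball (w u) (1 / real (Suc k)) \<subseteq> U)"
proof
  assume "survives U t w"
  then obtain k :: nat where "\<And>q. q \<in> \<rat> \<inter> {0..1} \<Longrightarrow> w (q * t) \<in> {y. ball y (1 / real (Suc k)) \<subseteq> U}"
    unfolding survives_def by blast
  from closed_rational_times[OF w t closed_ball_subset this]
  show "\<exists>k::nat. \<forall>u\<in>{0..t}. ball (w u) (1 / real (Suc k)) \<subseteq> U" by blast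
next
  assume "\<exists>k::nat. \<forall>u\<in>{0..t}. ball (w u) (1 / real (Suc k)) \<subseteq> U"
  then obtain k :: nat where k: "\<And>u. u \<in> {0..t} \<Longrightarrow> ball (w u) (1 / real (Suc k)) \<subseteq> U" by blast
  have "q * t \<in> {0..t}" if "q \<in> \<rat> \<inter> {0..1}" for q
    using that t by (auto intro: mult_left_le_one_le)
  then show "survives U t w" using k unfolding survives_def by blast
qed

text \<open>
  The path leaves the closed ball of radius \<open>\<rho>\<close> about \<open>0\<close> by time \<open>h\<close>, again tested at countably many
  times.
\<close>

definition moved :: "real \<Rightarrow> real \<Rightarrow> (real \<Rightarrow> 'a::euclidean_space) \<Rightarrow> bool" where
  "moved h \<rho> w \<longleftrightarrow> (\<exists>q\<in>\<rat> \<inter> {0..1}. \<rho> < norm (w (q * h)))"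

lemma measurable_moved:
  assumes "0 \<le> h"
  shows "Measurable.pred path_space (moved h \<rho>)"
proof -
  have "Measurable.pred path_space (\<lambda>w::real \<Rightarrow> 'a. \<rho> < norm (w (q * h)))" if "q \<in> \<rat> \<inter> {0..1}" for q
  proof -
    have [measurable]: "(\<lambda>w. w (q * h)) \<in> borel_measurable (path_space :: (real \<Rightarrow> 'a) measure)"
      using that assms by (intro measurable_component_singleton) auto
    show ?thesis by measurable
  qed
  moreover have "countable (\<rat> \<inter> {0..1::real})"
    using countable_rat by (rule countable_subset[rotated]) auto
  ultimately show ?thesis unfolding moved_def pred_def
    by (intro sets.sets_Collect_countable_Ex') auto
qed

lemma not_moved_imp_le:
  assumes "right_cont w" "0 \<le> h" "\<not> moved h \<rho> w" "u \<in> {0..h}"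
  shows "norm (w u) \<le> \<rho>"
  using closed_rational_times[OF assms(1,2) closed_cball[of 0 \<rho>] _ assms(4)] assms(3)
  by (force simp: moved_def not_less)

lemma moved_imp_gt:
  assumes "0 \<le> h" "moved h \<rho> w"
  obtains u where "u \<in> {0..h}" "\<rho> < norm (w u)"
proof -
  obtain q where "q \<in> \<rat> \<inter> {0..1}" "\<rho> < norm (w (q * h))" using assms by (auto simp: moved_def)
  then show ?thesis using assms(1) by (intro that[of "q * h"]) (auto intro: mult_left_le_one_le)
qed

text \<open>
  One-sided limits bound the path near each time, and \<open>[0, t]\<close> is compact.
\<close>

lemma bounded_cadlag:
  fixes w :: "real \<Rightarrow> 'a::real_normed_vector"
  assumes r: "right_cont w" and l: "\<And>t. 0 < t \<Longrightarrow> \<exists>l. (w \<longlongrightarrow> l) (at_left t)"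
  shows "bounded (w ` {0..t})"
proof -
  have "\<exists>e>0. bounded (w ` (ball u e \<inter> {0..t}))" if u: "u \<in> {0..t}" for u
  proof -
    have "\<forall>\<^sub>F s in at_right u. dist (w s) (w u) < 1"
      using r u by (auto simp: right_cont_def tendsto_iff)
    then obtain b where b: "u < b" "\<And>s. u < s \<Longrightarrow> s < b \<Longrightarrow> dist (w s) (w u) < 1"
      by (auto simp: eventually_at_right_field)
    have "\<exists>a L. a < u \<and> (\<forall>s. a < s \<and> s < u \<and> 0 \<le> s \<longrightarrow> dist (w s) L < 1)"
    proof (cases "u = 0")
      case True
      then show ?thesis by (intro exI[of _ "-1"]) auto
    next
      case False
      then obtain L where "(w \<longlongrightarrow> L) (at_left u)" using l[of u] u by auto
      then have "\<forall>\<^sub>F s in at_left u. dist (w s) L < 1" by (auto simp: tendsto_iff)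
      then show ?thesis by (auto simp: eventually_at_left_field)
    qed
    then obtain a L where a: "a < u" "\<And>s. a < s \<Longrightarrow> s < u \<Longrightarrow> 0 \<le> s \<Longrightarrow> dist (w s) L < 1" by blast
    define e where "e = min (u - a) (b - u)"
    have "w ` (ball u e \<inter> {0..t}) \<subseteq> insert (w u) (ball (w u) 1 \<union> ball L 1)"
    proof safe
      fix s assume s: "s \<in> ball u e" "s \<in> {0..t}" "w s \<noteq> w u" "w s \<notin> ball L 1"
      then have "s \<noteq> u" "a < s" "s < b" by (auto simp: e_def dist_real_def)
      then show "w s \<in> ball (w u) 1"
        using a(2)[of s] b(2)[of s] s by (cases "s < u") (auto simp: dist_commute)
    qed
    moreover have "bounded (insert (w u) (ball (w u) 1 \<union> ball L 1))" by simp
    ultimately have "bounded (w ` (ball u e \<inter> {0..t}))" by (rule bounded_subset[rotated])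
    moreover have "0 < e" using a b by (simp add: e_def)
    ultimately show ?thesis by blast
  qed
  then obtain e where e: "\<And>u. u \<in> {0..t} \<Longrightarrow> 0 < e u" "\<And>u. u \<in> {0..t} \<Longrightarrow> bounded (w ` (ball u (e u) \<inter> {0..t}))"
    by metis
  have "{0..t} \<subseteq> (\<Union>u\<in>{0..t}. ball u (e u))" using e(1) by force
  then obtain C where C: "C \<subseteq> {0..t}" "finite C" "{0..t} \<subseteq> (\<Union>u\<in>C. ball u (e u))"
    using compactE_image[OF compact_Icc, of "{0..t}" "\<lambda>u. ball u (e u)" 0 t] by blast
  have "w ` {0..t} \<subseteq> (\<Union>u\<in>C. w ` (ball u (e u) \<inter> {0..t}))" using C(3) by fastforce
  moreover have "bounded (\<Union>u\<in>C. w ` (ball u (e u) \<inter> {0..t}))"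
    using C e(2) by (intro bounded_UN) auto
  ultimately show ?thesis by (rule bounded_subset[rotated])
qed

text \<open>
  The multiplicative functional that produces the part of the killed process on \<open>U\<close>.
\<close>

definition weight :: "('a::euclidean_space \<Rightarrow> real) \<Rightarrow> 'a set \<Rightarrow> real \<Rightarrow> (real \<Rightarrow> 'a) \<Rightarrow> real" where
  "weight V U t w = (if survives U t w then exp (- path_integral V t w) else 0)"

lemma measurable_weight:
  assumes [measurable]: "V \<in> borel_measurable borel" and "0 \<le> t"
  shows "weight V U t \<in> borel_measurable path_space"
  unfolding weight_def[abs_def]
  using measurable_path_integral[OF assms(1)] measurable_survives[OF assms(2)] by measurable

lemma path_integral_nonneg:
  assumes "\<And>x. 0 < V x"
  shows "0 \<le> path_integral V t w"
  unfolding path_integral_def set_lebesgue_integral_def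
  by (intro Bochner_Integration.integral_nonneg) (auto simp: indicator_def less_imp_le[OF assms])

lemma weight_bounds:
  assumes "\<And>x. 0 < V x"
  shows "0 \<le> weight V U t w" "weight V U t w \<le> 1"
  using path_integral_nonneg[OF assms] by (auto simp: weight_def)

section \<open>Short-time behaviour and the transition density\<close>

lemma (in prob_space) abs_expectation_le:
  fixes f :: "'a \<Rightarrow> real"
  assumes "f \<in> borel_measurable M" "\<And>x. \<bar>f x\<bar> \<le> C"
  shows "\<bar>expectation f\<bar> \<le> C"
proof -
  have i: "integrable M f" using assms by (intro integrable_const_bound[where B=C]) auto
  have "\<bar>expectation f\<bar> \<le> expectation (\<lambda>x. \<bar>f x\<bar>)" by (rule integral_abs_bound)
  also have "\<dots> \<le> expectation (\<lambda>_. C)" using i assms by (intro integral_mono) auto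
  finally show ?thesis by (simp add: prob_space)
qed

context stable_process
begin

lemma right_cont_path: "\<omega> \<in> space \<Omega> \<Longrightarrow> 0 \<le> s \<Longrightarrow> right_cont (path_from s \<omega>)"
  unfolding right_cont_def
proof (intro allI impI)
  fix t :: real assume *: "\<omega> \<in> space \<Omega>" "0 \<le> s" "0 \<le> t"
  have "((\<lambda>u. X u \<omega>) \<longlongrightarrow> X (s + t) \<omega>) (at_right (s + t))"
    using * by (intro right_continuous_paths) auto
  moreover have "filterlim (\<lambda>u. s + u) (at_right (s + t)) (at_right t)"
    by (intro filterlim_at_withinI tendsto_intros) (auto simp: eventually_at_right_field intro: exI[of _ "t + 1"])
  ultimately have "((\<lambda>u. X (s + u) \<omega>) \<longlongrightarrow> X (s + t) \<omega>) (at_right t)"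
    by (rule filterlim_compose)
  moreover have "\<forall>\<^sub>F u in at_right t. X (s + u) \<omega> = path_from s \<omega> u"
    using * by (auto simp: eventually_at_right_field path_from_def intro!: exI[of _ "t + 1"])
  ultimately have "(path_from s \<omega> \<longlongrightarrow> X (s + t) \<omega>) (at_right t)"
    by (rule Lim_transform_eventually)
  then show "(path_from s \<omega> \<longlongrightarrow> path_from s \<omega> t) (at_right t)" using * by (simp add: path_from_def)
qed

lemma right_cont_translate: "right_cont w \<Longrightarrow> right_cont (translate x w)"
  unfolding right_cont_def
proof (intro allI impI)
  fix t :: real assume *: "\<forall>t\<ge>0. (w \<longlongrightarrow> w t) (at_right t)" "0 \<le> t"
  then have "((\<lambda>u. x + w u) \<longlongrightarrow> x + w t) (at_right t)" by (intro tendsto_intros) auto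
  moreover have "\<forall>\<^sub>F u in at_right t. x + w u = translate x w u"
    using * by (auto simp: eventually_at_right_field translate_def intro!: exI[of _ "t + 1"])
  ultimately have "(translate x w \<longlongrightarrow> x + w t) (at_right t)"
    by (rule Lim_transform_eventually)
  then show "(translate x w \<longlongrightarrow> translate x w t) (at_right t)" using * by (simp add: translate_def)
qed

lemma shifted_eq_translate: "shifted s \<omega> = translate (- X s \<omega>) (path_from s \<omega>)"
  by (auto simp: path_from_def translate_def shifted_def)

lemma right_cont_shifted: "\<omega> \<in> space \<Omega> \<Longrightarrow> 0 \<le> s \<Longrightarrow> right_cont (shifted s \<omega>)"
  unfolding shifted_eq_translate by (intro right_cont_translate right_cont_path)

lemma right_cont_stopped:
  assumes "\<omega> \<in> space \<Omega>" "0 \<le> s"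
  shows "right_cont (stopped s \<omega>)"
  unfolding right_cont_def
proof (intro allI impI)
  fix t :: real assume t: "0 \<le> t"
  show "(stopped s \<omega> \<longlongrightarrow> stopped s \<omega> t) (at_right t)"
  proof (cases "t < s")
    case True
    have "((\<lambda>u. X u \<omega>) \<longlongrightarrow> X t \<omega>) (at_right t)"
      using assms t by (intro right_continuous_paths) auto
    moreover have "\<forall>\<^sub>F u in at_right t. X u \<omega> = stopped s \<omega> u"
      using t True by (auto simp: eventually_at_right_field stopped_def min_def intro!: exI[of _ s])
    ultimately have "(stopped s \<omega> \<longlongrightarrow> X t \<omega>) (at_right t)"
      by (rule Lim_transform_eventually)
    then show ?thesis using t True by (simp add: stopped_def min_def)
  next
    case False
    have "\<forall>\<^sub>F u in at_right t. stopped s \<omega> u = stopped s \<omega> t"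
      using t False by (auto simp: eventually_at_right_field stopped_def min_def intro!: exI[of _ "t + 1"])
    then show ?thesis by (rule tendsto_eventually)
  qed
qed

lemma bounded_path: "\<omega> \<in> space \<Omega> \<Longrightarrow> bounded ((\<lambda>s. X s \<omega>) ` {0..t})"
proof (rule bounded_cadlag)
  assume *: "\<omega> \<in> space \<Omega>"
  then show "right_cont (\<lambda>s. X s \<omega>)" unfolding right_cont_def using right_continuous_paths by auto
  fix t :: real assume "0 < t" then show "\<exists>l. ((\<lambda>s. X s \<omega>) \<longlongrightarrow> l) (at_left t)"
    using left_limits_paths * by auto
qed

text \<open>
  The process moves farther than \<open>\<rho>\<close> from its position at time \<open>s\<close> within time \<open>h\<close>.
\<close>

definition excursion :: "real \<Rightarrow> real \<Rightarrow> real \<Rightarrow> 'w set" where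
  "excursion h \<rho> s = {\<omega> \<in> space \<Omega>. moved h \<rho> (shifted s \<omega>)}"

lemma sets_moved: "0 \<le> h \<Longrightarrow> {w \<in> space path_space. moved h \<rho> w} \<in> sets path_space"
  using measurable_moved by (simp add: pred_def)

lemma excursion_eq_vimage:
  assumes "0 \<le> s"
  shows "excursion h \<rho> s = shifted s -` {w \<in> space path_space. moved h \<rho> w} \<inter> space (P x)"
  using measurable_space[OF measurable_shifted[OF assms, of x]] by (auto simp: excursion_def space_P)

lemma sets_excursion:
  assumes "0 \<le> h" "0 \<le> s"
  shows "excursion h \<rho> s \<in> sets (P x)"
  unfolding excursion_eq_vimage[OF assms(2), of h \<rho> x]
  by (rule measurable_sets[OF measurable_shifted[OF assms(2)] sets_moved[OF assms(1)]])

text \<open>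
  The event depends on the recentred path only, whose law does not depend on \<open>x\<close> and \<open>s\<close>. Hence
  estimates of its probability hold uniformly in the starting point.
\<close>

lemma prob_excursion:
  assumes "0 \<le> h" "0 \<le> s"
  shows "P.prob x (excursion h \<rho> s) = P.prob 0 (excursion h \<rho> 0)"
proof -
  have "P.prob x (excursion h \<rho> s) = measure path_law {w \<in> space path_space. moved h \<rho> w}" if "0 \<le> s" for x s
    unfolding excursion_eq_vimage[OF that, of h \<rho> x] distr_shifted[OF that, of x, symmetric]
    by (rule measure_distr[symmetric, OF measurable_shifted[OF that] sets_moved[OF assms(1)]])
  then show ?thesis using assms(2) by simp
qed

lemma
  assumes "0 \<le> h" "0 \<le> s"
  shows integrable_excursion: "integrable (P x) (indicator (excursion h \<rho> s) :: _ \<Rightarrow> real)"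
    and integral_excursion: "(LINT \<omega>|P x. indicator (excursion h \<rho> s) \<omega>) = P.prob x (excursion h \<rho> s)"
proof -
  have "excursion h \<rho> s \<inter> space (P x) = excursion h \<rho> s" by (auto simp: excursion_def space_P)
  then show "(LINT \<omega>|P x. indicator (excursion h \<rho> s) \<omega>) = P.prob x (excursion h \<rho> s)" by simp
  show "integrable (P x) (indicator (excursion h \<rho> s) :: _ \<Rightarrow> real)"
    using sets_excursion[OF assms] by (intro integrable_real_indicator) (auto simp: P.emeasure_eq_measure)
qed

text \<open>
  By right continuity at time \<open>0\<close>, almost no path has moved by \<open>\<rho>\<close> after a short time.
\<close>

lemma prob_excursion_small:
  assumes "0 < \<rho>" "0 < \<epsilon>" "0 < h0"
  obtains h where "0 < h" "h \<le> h0" "\<And>x s. 0 \<le> s \<Longrightarrow> P.prob x (excursion h \<rho> s) < \<epsilon>"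
proof -
  define hn where "hn n = h0 / real (Suc n)" for n
  have hn: "0 < hn n" "0 \<le> hn n" "hn n \<le> h0" for n using assms(3) by (auto simp: hn_def field_simps)
  have "(\<lambda>n. LINT \<omega>|P 0. indicator (excursion (hn n) \<rho> 0) \<omega>) \<longlonglongrightarrow> (LINT \<omega>|P 0. (0::real))"
  proof (rule integral_dominated_convergence[where w="\<lambda>_. 1"])
    show "AE \<omega> in P 0. (\<lambda>n. indicator (excursion (hn n) \<rho> 0) \<omega>) \<longlonglongrightarrow> (0::real)"
    proof (rule AE_I2)
      fix \<omega> assume "\<omega> \<in> space (P 0)"
      then have \<omega>: "\<omega> \<in> space \<Omega>" by (simp add: space_P)
      have "(shifted 0 \<omega> \<longlongrightarrow> shifted 0 \<omega> 0) (at_right 0)"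
        using right_cont_shifted[OF \<omega>, of 0] by (simp add: right_cont_def)
      then have "(shifted 0 \<omega> \<longlongrightarrow> 0) (at_right 0)" by (simp add: shifted_def)
      then have "\<forall>\<^sub>F u in at_right 0. dist (shifted 0 \<omega> u) 0 < \<rho>"
        using assms(1) by (simp only: tendsto_iff)
      then obtain b where b: "0 < b" "\<And>u. 0 < u \<Longrightarrow> u < b \<Longrightarrow> norm (shifted 0 \<omega> u) < \<rho>"
        by (auto simp: eventually_at_right_field)
      have "hn \<longlonglongrightarrow> h0 * 0"
        unfolding hn_def using tendsto_mult[OF tendsto_const LIMSEQ_inverse_real_of_nat, of h0]
        by (simp add: divide_inverse)
      then have "\<forall>\<^sub>F n in sequentially. hn n < b" using b(1) by (auto dest: order_tendstoD)
      then have "\<forall>\<^sub>F n in sequentially. indicator (excursion (hn n) \<rho> 0) \<omega> = (0::real)"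
      proof eventually_elim
        fix n assume n: "hn n < b"
        have "\<not> moved (hn n) \<rho> (shifted 0 \<omega>)"
        proof
          assume "moved (hn n) \<rho> (shifted 0 \<omega>)"
          then obtain u where u: "u \<in> {0..hn n}" "\<rho> < norm (shifted 0 \<omega> u)"
            using hn by (elim moved_imp_gt[rotated]) (auto intro: less_imp_le)
          show False
          proof (cases "u = 0")
            case True
            then show ?thesis using u(2) assms(1) by (simp add: shifted_def)
          next
            case False
            then show ?thesis using b(2)[of u] u n by auto
          qed
        qed
        then show "indicator (excursion (hn n) \<rho> 0) \<omega> = (0::real)" by (simp add: excursion_def)
      qed
      then show "(\<lambda>n. indicator (excursion (hn n) \<rho> 0) \<omega>) \<longlonglongrightarrow> (0::real)"
        by (rule tendsto_eventually)
    qed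
    show "(\<lambda>\<omega>. indicator (excursion (hn n) \<rho> 0) \<omega> :: real) \<in> borel_measurable (P 0)" for n
      using hn by (intro borel_measurable_indicator sets_excursion) auto
  qed (auto simp: indicator_def)
  then have "(\<lambda>n. P.prob 0 (excursion (hn n) \<rho> 0)) \<longlonglongrightarrow> 0"
    unfolding integral_excursion[OF hn(2) order_refl] by simp
  then have "\<forall>\<^sub>F n in sequentially. P.prob 0 (excursion (hn n) \<rho> 0) < \<epsilon>"
    using assms(2) by (intro order_tendstoD(2))
  then obtain n where "P.prob 0 (excursion (hn n) \<rho> 0) < \<epsilon>"
    by (auto simp: eventually_sequentially)
  then have "P.prob x (excursion (hn n) \<rho> s) < \<epsilon>" if "0 \<le> s" for x s
    using prob_excursion[OF hn(2) that, of x n \<rho>] by simp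
  then show ?thesis using that[of "hn n"] hn(1,3) by blast
qed

definition free_semigroup :: "real \<Rightarrow> ('a \<Rightarrow> real) \<Rightarrow> 'a \<Rightarrow> real" where
  "free_semigroup h g x = (LINT \<omega>|P x. g (X h \<omega>))"

lemma distr_X:
  assumes h: "0 < h"
  shows "distr (P x) borel (X h) = density lborel (\<lambda>y. transition_density h (y - x))"
proof (rule measure_eqI)
  have [measurable]: "transition_density h \<in> borel_measurable borel" by (rule transition_density_properties(4)[OF h])
  have [measurable]: "X h \<in> borel_measurable (P x)" "X 0 \<in> borel_measurable (P x)" using h by auto
  fix A assume "A \<in> sets (distr (P x) borel (X h))"
  then have [measurable]: "A \<in> sets borel" by simp
  have "emeasure (distr (P x) borel (X h)) A = (\<integral>\<^sup>+ y. indicator A y \<partial>distr (P x) borel (X h))" by simp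
  also have "\<dots> = (\<integral>\<^sup>+ \<omega>. indicator A (X h \<omega>) \<partial>P x)" by (rule nn_integral_distr) auto
  also have "\<dots> = (\<integral>\<^sup>+ \<omega>. indicator A (x + (X h \<omega> - X 0 \<omega>)) \<partial>P x)"
    using start[of x] by (intro nn_integral_cong_AE) auto
  also have "\<dots> = (\<integral>\<^sup>+ z. indicator A (x + z) \<partial>distr (P x) borel (\<lambda>\<omega>. X h \<omega> - X 0 \<omega>))"
    by (intro nn_integral_distr[symmetric]) auto
  also have "distr (P x) borel (\<lambda>\<omega>. X h \<omega> - X 0 \<omega>) = density lborel (transition_density h)"
    using distr_increment[of 0 h x] h by (simp add: increment_law_def)
  also have "(\<integral>\<^sup>+ z. indicator A (x + z) \<partial>density lborel (transition_density h)) = (\<integral>\<^sup>+ z. ennreal (transition_density h z) * indicator A (x + z) \<partial>lborel)"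
    by (intro nn_integral_density) auto
  also have "\<dots> = (\<integral>\<^sup>+ y. ennreal (transition_density h (y - x)) * indicator A y \<partial>lborel)"
    by (subst (2) lborel_nn_integral_affine[where c=1 and t=x]) auto
  finally show "emeasure (distr (P x) borel (X h)) A = emeasure (density lborel (\<lambda>y. transition_density h (y - x))) A"
    by (simp add: emeasure_density)
qed simp

lemma
  fixes g :: "'a \<Rightarrow> real"
  assumes h: "0 < h" and [measurable]: "g \<in> borel_measurable borel"
  shows expectation_X: "(LINT \<omega>|P x. g (X h \<omega>)) = (LINT y|lborel. transition_density h (y - x) * g y)"
    and integrable_X: "integrable (P x) (\<lambda>\<omega>. g (X h \<omega>)) \<longleftrightarrow> integrable lborel (\<lambda>y. transition_density h (y - x) * g y)"
proof -
  have [measurable]: "transition_density h \<in> borel_measurable borel" by (rule transition_density_properties(4)[OF h])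
  have m: "X h \<in> borel_measurable (P x)" using h by auto
  note nn = transition_density_properties(2)[OF h]
  have "(LINT \<omega>|P x. g (X h \<omega>)) = (LINT y|density lborel (\<lambda>y. transition_density h (y - x)). g y)"
    unfolding distr_X[OF h, symmetric] by (rule integral_distr[OF m, symmetric]) auto
  then show "(LINT \<omega>|P x. g (X h \<omega>)) = (LINT y|lborel. transition_density h (y - x) * g y)"
    using nn by (simp add: integral_density)
  have "integrable (P x) (\<lambda>\<omega>. g (X h \<omega>)) \<longleftrightarrow> integrable (density lborel (\<lambda>y. transition_density h (y - x))) g"
    unfolding distr_X[OF h, symmetric] by (rule integrable_distr_eq[OF m, symmetric]) auto
  then show "integrable (P x) (\<lambda>\<omega>. g (X h \<omega>)) \<longleftrightarrow> integrable lborel (\<lambda>y. transition_density h (y - x) * g y)"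
    using nn by (simp add: integrable_density)
qed

lemma AE_X_not_in_null:
  assumes h: "0 < h" and N: "N \<in> null_sets lborel"
  shows "AE \<omega> in P x. X h \<omega> \<notin> N"
proof (rule AE_distrD[of "X h" "P x" borel])
  have [measurable]: "transition_density h \<in> borel_measurable borel" by (rule transition_density_properties(4)[OF h])
  show "AE y in distr (P x) borel (X h). y \<notin> N"
    unfolding distr_X[OF h] using AE_not_in[OF N] by (subst AE_density) (auto elim!: eventually_mono)
qed (use h in auto)

text \<open>
  The difference is at most the \<open>L\<^sup>1\<close> distance of two translates of the density, whatever \<open>g\<close> is.
  This uniformity in \<open>g\<close> is stronger than the strong Feller property and is what yields compactness.
\<close>

lemma free_equicontinuous:
  assumes h: "0 < h" and e: "0 < \<epsilon>"
  obtains \<delta> where "0 < \<delta>" "\<And>x g. x \<in> ball x0 \<delta> \<Longrightarrow> g \<in> borel_measurable borel \<Longrightarrow> (\<And>y. \<bar>g y\<bar> \<le> 1) \<Longrightarrow>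
    \<bar>free_semigroup h g x - free_semigroup h g x0\<bar> < \<epsilon>"
proof -
  let ?q = "transition_density h"
  note q = transition_density_properties[OF h]
  have [measurable]: "?q \<in> borel_measurable borel" by (rule q)
  define om where "om x = (LINT y|lborel. \<bar>?q (y - x) - ?q (y - x0)\<bar>)" for x
  have iq: "integrable lborel (\<lambda>y. ?q (y - v))" for v
    using lborel_integrable_affine[OF q(5), of 1 "- v"] by simp
  have bound: "\<bar>free_semigroup h g x - free_semigroup h g x0\<bar> \<le> om x"
    if [measurable]: "g \<in> borel_measurable borel" and g: "\<And>y. \<bar>g y\<bar> \<le> 1" for g x
  proof -
    have ig: "integrable lborel (\<lambda>y. ?q (y - v) * g y)" for v
      by (rule Bochner_Integration.integrable_bound[OF iq[of v]])
        (auto simp: abs_mult intro!: mult_right_le_one_le g)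
    have "free_semigroup h g x - free_semigroup h g x0 = (LINT y|lborel. ?q (y - x) * g y - ?q (y - x0) * g y)"
      unfolding free_semigroup_def expectation_X[OF h that(1)] by (rule Bochner_Integration.integral_diff[symmetric, OF ig ig])
    also have "\<bar>\<dots>\<bar> \<le> om x"
      unfolding om_def real_norm_def[symmetric]
      by (rule Bochner_Integration.integral_norm_bound_integral[OF Bochner_Integration.integrable_diff[OF ig ig]])
        (auto intro!: iq simp: abs_mult mult_right_le_one_le g simp flip: left_diff_distrib)
    finally show ?thesis .
  qed
  have "(om \<longlongrightarrow> 0) (at x0)"
    unfolding tendsto_at_iff_sequentially om_def o_def
    by (auto intro!: translates_tendsto_L1 q)
  then have "\<forall>\<^sub>F x in at x0. om x < \<epsilon>" using e by (rule order_tendstoD)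
  then obtain \<delta> where d: "0 < \<delta>" "\<And>x. x \<noteq> x0 \<Longrightarrow> dist x x0 < \<delta> \<Longrightarrow> om x < \<epsilon>"
    by (auto simp: eventually_at)
  have "om x0 = 0" by (simp add: om_def)
  show ?thesis
  proof (rule that[OF d(1)])
    fix x and g :: "'a \<Rightarrow> real" assume *: "x \<in> ball x0 \<delta>" "g \<in> borel_measurable borel" "\<And>y. \<bar>g y :: real\<bar> \<le> 1"
    have "om x < \<epsilon>" using d(2)[of x] * \<open>om x0 = 0\<close> e by (cases "x = x0") (auto simp: dist_commute)
    then show "\<bar>free_semigroup h g x - free_semigroup h g x0\<bar> < \<epsilon>" using bound[OF *(2,3), of x] by linarith
  qed
qed

end

section \<open>Feynman-Kac semigroups\<close>

lemma set_integrable_const_Icc: "set_integrable lborel {a..b::real} (\<lambda>_. K::real)"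
  unfolding set_integrable_def
  by (intro integrable_scaleR_left integrable_real_indicator) (auto simp: emeasure_lborel_Icc_eq)

lemma set_integral_split_shift:
  fixes f :: "real \<Rightarrow> real"
  assumes f: "set_integrable lborel {0..r + s} f" and r: "0 \<le> r" "0 \<le> s"
  shows "(LINT u:{0..r + s}|lborel. f u) = (LINT u:{0..r}|lborel. f u) + (LINT u:{0..s}|lborel. f (r + u))"
proof -
  have "{0..r + s} = {0..r} \<union> {r<..r + s}" using r by auto
  then have "(LINT u:{0..r + s}|lborel. f u) = (LINT u:{0..r} \<union> {r<..r + s}|lborel. f u)"
    by simp
  also have "\<dots> = (LINT u:{0..r}|lborel. f u) + (LINT u:{r<..r + s}|lborel. f u)"
    by (rule set_integral_Un; (rule set_integrable_subset[OF f])?) (use r in auto)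
  also have "(LINT u:{r<..r + s}|lborel. f u) = (LINT u:{0..s}|lborel. f (r + u))"
  proof -
    have "set_integrable lborel {r<..r + s} f"
      by (rule set_integrable_subset[OF f]) (use r in auto)
    then have m: "(\<lambda>u. indicator {r<..r + s} u *\<^sub>R f u) \<in> borel_measurable borel"
      unfolding set_integrable_def by auto
    have "(LINT u:{r<..r + s}|lborel. f u) = (LINT u|lborel. indicator {r<..r + s} (r + u) *\<^sub>R f (r + u))"
      unfolding set_lebesgue_integral_def
      using lborel_integral_affine[OF m, of 1 r] by simp
    also have "\<dots> = (LINT u|lborel. indicator {0<..s} u *\<^sub>R f (r + u))"
      by (intro Bochner_Integration.integral_cong) (auto simp: indicator_def)
    also have "\<dots> = (LINT u|lborel. indicator {0..s} u *\<^sub>R f (r + u))"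
    proof -
      have m1: "(\<lambda>u. indicator {0<..s} u *\<^sub>R f (r + u)) \<in> borel_measurable borel"
        using measurable_compose[OF _ m, of "\<lambda>u. r + u" borel] by (simp add: indicator_def)
      have eq: "indicator {0..s} u *\<^sub>R f (r + u) = (if u = 0 then indicator {0..s} 0 *\<^sub>R f r else indicator {0<..s} u *\<^sub>R f (r + u))" for u
        by (auto simp: indicator_def)
      have m2: "(\<lambda>u. indicator {0..s} u *\<^sub>R f (r + u)) \<in> borel_measurable borel"
        unfolding eq[abs_def] using m1 by measurable
      have "AE u in lborel. u \<noteq> (0::real)" by (rule AE_lborel_singleton)
      then show ?thesis using m1 m2
        by (intro integral_cong_AE) (auto elim!: eventually_mono simp: indicator_def)
    qed
    finally show ?thesis by (simp add: set_lebesgue_integral_def)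
  qed
  finally show ?thesis .
qed

locale stable_potential = stable_process \<alpha> c \<Omega> P X
  for \<alpha> c :: real and \<Omega> :: "'w measure" and P :: "'a::euclidean_space \<Rightarrow> 'w measure"
    and X :: "real \<Rightarrow> 'w \<Rightarrow> 'a" +
  fixes V :: "'a \<Rightarrow> real"
  assumes measurable_V [measurable]: "V \<in> borel_measurable borel"
    and V_pos: "\<And>x. 0 < V x"
    and V_locally_bounded: "\<And>B. bounded B \<Longrightarrow> \<exists>K. \<forall>x\<in>B. V x \<le> K"
    and V_at_top: "filterlim V at_top at_infinity"
begin

lemma path_apply: "0 \<le> u \<Longrightarrow> path_from s \<omega> u = X (s + u) \<omega>"
  by (simp add: path_from_def)

lemma eval_path_path: "\<omega> \<in> space \<Omega> \<Longrightarrow> 0 \<le> s \<Longrightarrow> 0 \<le> u \<Longrightarrow> eval_path (path_from s \<omega>) u = X (s + u) \<omega>"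
  by (simp add: eval_path_eq[OF right_cont_path] path_apply)

lemma eval_path_stopped:
  "\<omega> \<in> space \<Omega> \<Longrightarrow> 0 \<le> s \<Longrightarrow> 0 \<le> u \<Longrightarrow> eval_path (stopped s \<omega>) u = X (min u s) \<omega>"
  by (subst eval_path_eq[OF right_cont_stopped]) (simp_all add: stopped_def)

lemma set_integrable_V_path:
  assumes \<omega>: "\<omega> \<in> space \<Omega>" and a: "0 \<le> a"
  shows "set_integrable lborel {a..b} (\<lambda>u. V (X u \<omega>))"
proof -
  obtain K where K: "\<And>u. u \<in> {0..b} \<Longrightarrow> V (X u \<omega>) \<le> K"
    using V_locally_bounded[OF bounded_path[OF \<omega>, of b]] by blast
  have [measurable]: "path_from 0 \<omega> \<in> space path_space" by (auto simp: path_from_def space_PiM)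
  have eq: "indicator {a..b} u *\<^sub>R V (X u \<omega>) = indicator {a..b} u *\<^sub>R V (eval_path (path_from 0 \<omega>) u)" for u
    using a eval_path_path[OF \<omega>, of 0 u] by (auto simp: indicator_def)
  show ?thesis
    unfolding set_integrable_def
  proof (rule Bochner_Integration.integrable_bound)
    show "integrable lborel (\<lambda>u. indicator {a..b} u *\<^sub>R K)"
      using set_integrable_const_Icc by (simp add: set_integrable_def)
    show "(\<lambda>u. indicator {a..b} u *\<^sub>R V (X u \<omega>)) \<in> borel_measurable lborel"
      unfolding eq by measurable
    show "AE u in lborel. norm (indicator {a..b} u *\<^sub>R V (X u \<omega>)) \<le> norm (indicator {a..b} u *\<^sub>R K)"
      using K a V_pos by (intro AE_I2) (auto simp: indicator_def abs_of_pos intro: order_trans[OF _ abs_ge_self])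
  qed
qed

lemma path_integral_path:
  assumes "\<omega> \<in> space \<Omega>" "0 \<le> s"
  shows "path_integral V t (path_from s \<omega>) = (LINT u:{0..t}|lborel. V (X (s + u) \<omega>))"
  unfolding path_integral_def
  by (rule set_lebesgue_integral_cong)
    (simp_all add: eval_path_path assms)

lemma path_integral_stopped:
  assumes "\<omega> \<in> space \<Omega>" "0 \<le> s"
  shows "path_integral V s (stopped s \<omega>) = path_integral V s (path_from 0 \<omega>)"
  unfolding path_integral_def
  by (rule set_lebesgue_integral_cong)
    (simp_all add: eval_path_path eval_path_stopped assms min_absorb1)

lemma additive_functional_eq:
  "\<omega> \<in> space \<Omega> \<Longrightarrow> additive_functional X V t \<omega> = path_integral V t (path_from 0 \<omega>)"
  by (simp add: path_integral_path additive_functional_def)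

lemma path_integral_add:
  assumes "\<omega> \<in> space \<Omega>" "0 \<le> r" "0 \<le> s"
  shows "path_integral V (r + s) (path_from 0 \<omega>) = path_integral V r (path_from 0 \<omega>) + path_integral V s (path_from r \<omega>)"
  using set_integral_split_shift[OF set_integrable_V_path[OF assms(1), of 0] assms(2,3)] assms
  by (simp add: path_integral_path)

lemma survives_add:
  assumes "\<omega> \<in> space \<Omega>" "0 \<le> r" "0 \<le> s"
  shows "survives U (r + s) (path_from 0 \<omega>) \<longleftrightarrow> survives U r (path_from 0 \<omega>) \<and> survives U s (path_from r \<omega>)"
proof -
  have s0: "survives U t (path_from a \<omega>) \<longleftrightarrow> (\<exists>k::nat. \<forall>u\<in>{0..t}. ball (X (a + u) \<omega>) (1 / real (Suc k)) \<subseteq> U)"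
    if "0 \<le> t" "0 \<le> a" for t a
    using survives_iff[OF right_cont_path[OF assms(1) that(2)] that(1)]
    by (auto simp: path_from_def)
  show ?thesis
  proof
    assume "survives U (r + s) (path_from 0 \<omega>)"
    then have "\<exists>k::nat. \<forall>u\<in>{0..r + s}. ball (X (0 + u) \<omega>) (1 / real (Suc k)) \<subseteq> U"
      using s0[of "r + s" 0] assms by simp
    then obtain k :: nat where k: "\<forall>u\<in>{0..r + s}. ball (X (0 + u) \<omega>) (1 / real (Suc k)) \<subseteq> U" by blast
    have "\<forall>u\<in>{0..r}. ball (X (0 + u) \<omega>) (1 / real (Suc k)) \<subseteq> U"
      "\<forall>u\<in>{0..s}. ball (X (r + u) \<omega>) (1 / real (Suc k)) \<subseteq> U"
      using assms k by auto
    then show "survives U r (path_from 0 \<omega>) \<and> survives U s (path_from r \<omega>)"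
      using s0[OF assms(2) order_refl] s0[OF assms(3,2)] by blast
  next
    assume "survives U r (path_from 0 \<omega>) \<and> survives U s (path_from r \<omega>)"
    then obtain k l :: nat where
      k: "\<And>u. u \<in> {0..r} \<Longrightarrow> ball (X (0 + u) \<omega>) (1 / real (Suc k)) \<subseteq> U" and
      l: "\<And>u. u \<in> {0..s} \<Longrightarrow> ball (X (r + u) \<omega>) (1 / real (Suc l)) \<subseteq> U"
      using s0[OF assms(2) order_refl] s0[OF assms(3,2)] by blast
    have "ball (X (0 + u) \<omega>) (1 / real (Suc (max k l))) \<subseteq> U" if "u \<in> {0..r + s}" for u
    proof (cases "u \<le> r")
      case True
      then show ?thesis using k[of u] ball_Suc_max_subset(1)[of "X u \<omega>" k l] that by auto
    next
      case False
      then have "u - r \<in> {0..s}" using that by auto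
      from l[OF this] have "ball (X (0 + u) \<omega>) (1 / real (Suc l)) \<subseteq> U" by simp
      then show ?thesis using ball_Suc_max_subset(2)[of "X u \<omega>" k l] by simp
    qed
    then show "survives U (r + s) (path_from 0 \<omega>)"
      using s0[of "r + s" 0] assms by (simp only: add_nonneg_nonneg order_refl) blast
  qed
qed

lemma weight_add:
  assumes "\<omega> \<in> space \<Omega>" "0 \<le> r" "0 \<le> s"
  shows "weight V U (r + s) (path_from 0 \<omega>) = weight V U r (path_from 0 \<omega>) * weight V U s (path_from r \<omega>)"
  unfolding weight_def using survives_add[OF assms] path_integral_add[OF assms]
  by (auto simp: exp_add[symmetric])

lemma weight_stopped:
  assumes "\<omega> \<in> space \<Omega>" "0 \<le> r"
  shows "weight V U r (stopped r \<omega>) = weight V U r (path_from 0 \<omega>)"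
proof -
  have "survives U r (stopped r \<omega>) = survives U r (path_from 0 \<omega>)"
  proof -
    have "stopped r \<omega> (q * r) = path_from 0 \<omega> (q * r)" if "q \<in> \<rat> \<inter> {0..1}" for q
    proof -
      have "q * r \<le> r" "0 \<le> q * r" using that assms by (auto intro: mult_left_le_one_le)
      then show ?thesis by (simp add: stopped_def path_from_def min_absorb1)
    qed
    then show ?thesis unfolding survives_def by simp
  qed
  then show ?thesis using path_integral_stopped[OF assms] by (simp add: weight_def)
qed

lemma measurable_weight_V: "0 \<le> t \<Longrightarrow> weight V U t \<in> borel_measurable path_space"
  by (rule measurable_weight[OF measurable_V])

lemma weight_V_bounds: "0 \<le> weight V U t w" "weight V U t w \<le> 1"
  using weight_bounds[of V, OF V_pos] by auto

text \<open>
  The Feynman-Kac semigroup of \<open>V\<close> on paths that survive in \<open>U\<close>. It is the killed semigroup if \<open>U\<close> is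
  the whole space. At points of an open set \<open>U\<close> it is the semigroup of the part on \<open>U\<close>; elsewhere it
  vanishes, because survival includes time \<open>0\<close>.
\<close>

definition kernel :: "'a set \<Rightarrow> real \<Rightarrow> ('a \<Rightarrow> real) \<Rightarrow> 'a \<Rightarrow> real" where
  "kernel U t f x = (LINT \<omega>|P x. weight V U t (path_from 0 \<omega>) * f (X t \<omega>))"

lemma measurable_weight_path [measurable (raw)]:
  assumes "0 \<le> t" "0 \<le> s"
  shows "(\<lambda>\<omega>. weight V U t (path_from s \<omega>)) \<in> borel_measurable (P x)"
  using measurable_compose[OF measurable_path[OF assms(2)] measurable_weight_V[OF assms(1)]] .

lemma abs_weight_mult_le:
  assumes "\<bar>a\<bar> \<le> C"
  shows "\<bar>weight V U t w * a\<bar> \<le> C"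
proof -
  have "\<bar>weight V U t w\<bar> * \<bar>a\<bar> \<le> 1 * C"
    using weight_V_bounds[of U t w] assms by (intro mult_mono) auto
  then show ?thesis by (simp add: abs_mult)
qed

lemma kernel_eq_path_law:
  assumes [measurable]: "f \<in> borel_measurable borel" and t: "0 \<le> t"
  shows "kernel U t f x = (LINT w|path_law. weight V U t (translate x w) * f (translate x w t))"
proof -
  have [measurable]: "weight V U t \<in> borel_measurable path_space" by (rule measurable_weight_V[OF t])
  have [measurable]: "(\<lambda>w. w t) \<in> borel_measurable (path_space :: (real \<Rightarrow> 'a) measure)"
    using t by (intro measurable_component_singleton) auto
  have "kernel U t f x = (LINT \<omega>|P x. (\<lambda>w. weight V U t w * f (w t)) (path_from 0 \<omega>))"
    using t by (simp add: kernel_def path_from_def)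
  also have "\<dots> = (LINT w|path_law. weight V U t (translate x w) * f (translate x w t))"
    by (rule expectation_path) measurable
  finally show ?thesis .
qed

lemma measurable_kernel:
  assumes f[measurable]: "f \<in> borel_measurable borel" and t: "0 \<le> t"
  shows "kernel U t f \<in> borel_measurable borel"
proof -
  interpret N: prob_space path_law by (rule prob_space_path_law)
  have [measurable]: "weight V U t \<in> borel_measurable path_space" by (rule measurable_weight_V[OF t])
  have T: "(\<lambda>p. translate (fst p) (snd p)) \<in> measurable (borel \<Otimes>\<^sub>M path_law) path_space"
    using measurable_translate_pair by (simp add: split_beta measurable_cong_sets[OF sets_pair_measure_cong[OF refl sets_path_law] refl])
  have "(\<lambda>p. translate (fst p) (snd p) t) \<in> borel_measurable (borel \<Otimes>\<^sub>M path_law)"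
    using t by (intro measurable_compose[OF T measurable_component_singleton]) auto
  then have "(\<lambda>p. weight V U t (translate (fst p) (snd p)) * f (translate (fst p) (snd p) t)) \<in> borel_measurable (borel \<Otimes>\<^sub>M path_law)"
    using T by measurable
  then have "(\<lambda>x. LINT w|path_law. weight V U t (translate x w) * f (translate x w t)) \<in> borel_measurable borel"
    by (intro N.borel_measurable_lebesgue_integral) (simp add: split_beta)
  then show ?thesis using kernel_eq_path_law[OF f t] by (simp cong: measurable_cong)
qed

lemma abs_kernel_le:
  assumes [measurable]: "f \<in> borel_measurable borel" and t: "0 \<le> t" and f: "\<And>y. \<bar>f y\<bar> \<le> C"
  shows "\<bar>kernel U t f x\<bar> \<le> C"
  unfolding kernel_def
proof (rule P.abs_expectation_le)
  show "(\<lambda>\<omega>. weight V U t (path_from 0 \<omega>) * f (X t \<omega>)) \<in> borel_measurable (P x)"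
    using t by measurable
qed (intro abs_weight_mult_le f)

text \<open>
  Survival and the time integral split at time \<open>r\<close>, so this is the Markov property. The right-hand
  side is \<open>kernel U r (kernel U s f) x\<close>.
\<close>

lemma kernel_add:
  assumes f[measurable]: "f \<in> borel_measurable borel" and C: "\<And>y. \<bar>f y\<bar> \<le> C" and r: "0 \<le> r" "0 \<le> s"
  shows "kernel U (r + s) f x = (LINT \<omega>|P x. weight V U r (path_from 0 \<omega>) * kernel U s f (X r \<omega>))"
proof -
  have [measurable]: "weight V U r \<in> borel_measurable path_space" "weight V U s \<in> borel_measurable path_space"
    using r by (auto intro: measurable_weight_V)
  have [measurable]: "(\<lambda>w. w s) \<in> borel_measurable (path_space :: (real \<Rightarrow> 'a) measure)"
    using r by (intro measurable_component_singleton) auto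
  have "kernel U (r + s) f x =
      (LINT \<omega>|P x. weight V U r (stopped r \<omega>) * (\<lambda>w. weight V U s w * f (w s)) (path_from r \<omega>))"
    unfolding kernel_def using r
    by (intro Bochner_Integration.integral_cong)
      (simp_all add: space_P weight_add weight_stopped path_apply)
  also have "\<dots> = (LINT \<omega>|P x. weight V U r (stopped r \<omega>) *
      (LINT w|path_law. (\<lambda>w. weight V U s w * f (w s)) (translate (X r \<omega>) w)))"
  proof (rule markov_property[where B=1 and C=C])
    show "\<bar>weight V U r w\<bar> \<le> 1" for w using weight_V_bounds[of U r w] by simp
    show "\<bar>weight V U s w * f (w s)\<bar> \<le> C" for w by (rule abs_weight_mult_le[OF C])
  qed (use r in measurable)
  also have "\<dots> = (LINT \<omega>|P x. weight V U r (path_from 0 \<omega>) * kernel U s f (X r \<omega>))"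
    using r by (intro Bochner_Integration.integral_cong) (simp_all add: space_P weight_stopped kernel_eq_path_law[OF f])
  finally show ?thesis .
qed

text \<open>
  As long as the process has not moved by \<open>\<rho>\<close>, it stays in a ball that is contained in \<open>U\<close> and on
  which \<open>V\<close> is bounded.
\<close>

lemma weight_ge:
  assumes \<omega>: "\<omega> \<in> space \<Omega>" and X0: "X 0 \<omega> = x" and h: "0 \<le> h" and \<rho>: "0 < \<rho>"
    and x: "x \<in> ball x0 \<rho>" and U: "ball x0 (3 * \<rho>) \<subseteq> U"
    and K: "\<And>y. y \<in> ball x0 (3 * \<rho>) \<Longrightarrow> V y \<le> K" and nm: "\<not> moved h \<rho> (shifted 0 \<omega>)"
  shows "1 - K * h \<le> weight V U h (path_from 0 \<omega>)"
proof -
  have near: "dist x0 (X u \<omega>) < 2 * \<rho>" if "u \<in> {0..h}" for u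
  proof -
    have "norm (shifted 0 \<omega> u) \<le> \<rho>"
      using that h by (intro not_moved_imp_le[OF right_cont_shifted[OF \<omega>] _ nm]) auto
    then have "dist x (X u \<omega>) \<le> \<rho>"
      using that by (simp add: shifted_def X0 dist_norm norm_minus_commute)
    moreover have "dist x0 x < \<rho>" using x by simp
    ultimately show ?thesis using dist_triangle[of x0 "X u \<omega>" x] by linarith
  qed
  have in_ball: "X u \<omega> \<in> ball x0 (3 * \<rho>)" if "u \<in> {0..h}" for u using near[OF that] \<rho> by simp
  obtain k :: nat where k: "1 / real (Suc k) < \<rho>" using \<rho> nat_approx_posE by blast
  have "survives U h (path_from 0 \<omega>)"
    unfolding survives_iff[OF right_cont_path[OF \<omega> order_refl] h]
  proof (intro exI ballI)
    fix u assume u: "u \<in> {0..h}"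
    have "ball (X u \<omega>) (1 / real (Suc k)) \<subseteq> ball x0 (3 * \<rho>)"
    proof
      fix z assume "z \<in> ball (X u \<omega>) (1 / real (Suc k))"
      then have "dist (X u \<omega>) z < \<rho>" using k unfolding mem_ball by linarith
      then show "z \<in> ball x0 (3 * \<rho>)" using near[OF u] dist_triangle[of x0 z "X u \<omega>"] by simp
    qed
    then show "ball (path_from 0 \<omega> u) (1 / real (Suc k)) \<subseteq> U" using U u by (simp add: path_from_def)
  qed
  moreover have "path_integral V h (path_from 0 \<omega>) \<le> K * h"
  proof -
    have "path_integral V h (path_from 0 \<omega>) = (LINT u:{0..h}|lborel. V (X u \<omega>))"
      by (simp add: path_integral_path[OF \<omega>])
    also have "\<dots> \<le> (LINT u:{0..h}|lborel. K)"
      using set_integrable_V_path[OF \<omega>, of 0 h] in_ball K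
      by (intro set_integral_mono set_integrable_const_Icc) auto
    also have "\<dots> = K * h" using h by (simp add: set_lebesgue_integral_def)
    finally show ?thesis .
  qed
  ultimately show ?thesis
    using exp_ge_add_one_self[of "- path_integral V h (path_from 0 \<omega>)"] by (simp add: weight_def)
qed

text \<open>
  Over a short initial time \<open>h\<close> the weight may be replaced by \<open>1\<close>, at a cost of \<open>1 - weight\<close>. By
  local boundedness of \<open>V\<close> this cost is uniform for starting points near \<open>x0\<close>, and it does not depend
  on \<open>f\<close>.
\<close>

lemma kernel_close_to_free:
  assumes U: "open U" "x0 \<in> U" and s: "0 < s" and e: "0 < \<epsilon>"
  obtains h \<rho> where "0 < h" "h < s" "0 < \<rho>"
    "\<And>x f. x \<in> ball x0 \<rho> \<Longrightarrow> f \<in> borel_measurable borel \<Longrightarrow> (\<And>y. \<bar>f y\<bar> \<le> 1) \<Longrightarrow>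
      \<bar>kernel U s f x - free_semigroup h (kernel U (s - h) f) x\<bar> \<le> \<epsilon>"
proof -
  obtain \<rho>' where r': "0 < \<rho>'" "ball x0 \<rho>' \<subseteq> U" using U by (auto simp: open_contains_ball)
  define \<rho> where "\<rho> = \<rho>' / 3"
  have \<rho>: "0 < \<rho>" "ball x0 (3 * \<rho>) \<subseteq> U" using r' by (auto simp: \<rho>_def)
  obtain K0 where "\<forall>y\<in>ball x0 (3 * \<rho>). V y \<le> K0" using V_locally_bounded[OF bounded_ball] by blast
  then have K: "\<And>y. y \<in> ball x0 (3 * \<rho>) \<Longrightarrow> V y \<le> max K0 1" by fastforce
  define K where "K = max K0 1"
  have K1: "1 \<le> K" by (simp add: K_def)
  \<comment> \<open>killing costs at most \<open>K h \<le> \<epsilon> / 2\<close>; the other half of \<open>\<epsilon>\<close> is for the excursions\<close>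
  define h0 where "h0 = min (s / 2) (\<epsilon> / (2 * K))"
  have h0: "0 < h0" using s e K1 by (simp add: h0_def)
  obtain h where h: "0 < h" "h \<le> h0"
    and mv: "\<And>x s. 0 \<le> s \<Longrightarrow> P.prob x (excursion h \<rho> s) < \<epsilon> / 2"
    using prob_excursion_small[OF \<rho>(1), of "\<epsilon> / 2" h0] e h0 by auto
  have hs: "h < s" "K * h \<le> \<epsilon> / 2"
  proof -
    have "h \<le> s / 2" "h \<le> \<epsilon> / (2 * K)" using h h0 by (auto simp: h0_def)
    then show "h < s" "K * h \<le> \<epsilon> / 2" using s K1 by (auto simp: field_simps)
  qed
  show ?thesis
  proof (rule that[OF h(1) hs(1) \<rho>(1)])
    fix x and f :: "'a \<Rightarrow> real" assume x: "x \<in> ball x0 \<rho>" and f[measurable]: "f \<in> borel_measurable borel" and f1: "\<And>y. \<bar>f y :: real\<bar> \<le> 1"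
    define g where "g = kernel U (s - h) f"
    have g[measurable]: "g \<in> borel_measurable borel" unfolding g_def using hs by (intro measurable_kernel f) auto
    have g1: "\<bar>g y\<bar> \<le> 1" for y unfolding g_def using hs by (intro abs_kernel_le f f1) auto
    have [measurable]: "X h \<in> borel_measurable (P x)" using h by auto
    have wm[measurable]: "(\<lambda>\<omega>. weight V U h (path_from 0 \<omega>)) \<in> borel_measurable (P x)"
      using h by (intro measurable_weight_path) auto
    have i1: "integrable (P x) (\<lambda>\<omega>. weight V U h (path_from 0 \<omega>) * g (X h \<omega>))"
      by (rule P.integrable_const_bound[where B=1]) (auto intro: abs_weight_mult_le g1)
    have i2: "integrable (P x) (\<lambda>\<omega>. g (X h \<omega>))"
      by (rule P.integrable_const_bound[where B=1]) (auto intro: g1)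
    have i3: "integrable (P x) (\<lambda>\<omega>. K * h + indicator (excursion h \<rho> 0) \<omega>)"
      using h by (intro Bochner_Integration.integrable_add integrable_excursion) auto
    have "kernel U s f x - free_semigroup h g x = (LINT \<omega>|P x. weight V U h (path_from 0 \<omega>) * g (X h \<omega>) - g (X h \<omega>))"
      using kernel_add[OF f f1, of h "s - h" U x] h hs i1 i2
      by (simp add: free_semigroup_def g_def)
    also have "\<bar>\<dots>\<bar> \<le> (LINT \<omega>|P x. \<bar>weight V U h (path_from 0 \<omega>) * g (X h \<omega>) - g (X h \<omega>)\<bar>)"
      by (rule integral_abs_bound)
    also have "\<dots> \<le> (LINT \<omega>|P x. K * h + indicator (excursion h \<rho> 0) \<omega>)"
    proof (rule integral_mono_AE)
      show "AE \<omega> in P x. \<bar>weight V U h (path_from 0 \<omega>) * g (X h \<omega>) - g (X h \<omega>)\<bar> \<le>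
          K * h + indicator (excursion h \<rho> 0) \<omega>"
        using start[of x] AE_space
      proof eventually_elim
        fix \<omega> assume X0: "X 0 \<omega> = x" and "\<omega> \<in> space (P x)"
        then have \<omega>: "\<omega> \<in> space \<Omega>" by (simp add: space_P)
        let ?w = "weight V U h (path_from 0 \<omega>)"
        have "\<bar>?w * g (X h \<omega>) - g (X h \<omega>)\<bar> = (1 - ?w) * \<bar>g (X h \<omega>)\<bar>"
        proof -
          have "?w * g (X h \<omega>) - g (X h \<omega>) = - ((1 - ?w) * g (X h \<omega>))" by (simp add: algebra_simps)
          then show ?thesis using weight_V_bounds[of U h "path_from 0 \<omega>"] by (simp only: abs_minus_cancel abs_mult)
        qed
        also have "\<dots> \<le> (1 - ?w) * 1"
          using weight_V_bounds[of U h "path_from 0 \<omega>"] by (intro mult_left_mono g1) auto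
        also have "\<dots> \<le> K * h + indicator (excursion h \<rho> 0) \<omega>"
        proof (cases "moved h \<rho> (shifted 0 \<omega>)")
          case True
          have "0 \<le> K * h" using K1 h by (intro mult_nonneg_nonneg) auto
          then show ?thesis using True weight_V_bounds[of U h "path_from 0 \<omega>"] \<omega> by (simp add: excursion_def)
        next
          case False
          then show ?thesis
            using weight_ge[OF \<omega> X0 _ \<rho>(1) x \<rho>(2) K[folded K_def] False] h by (simp add: excursion_def)
        qed
        finally show "\<bar>?w * g (X h \<omega>) - g (X h \<omega>)\<bar> \<le> K * h + indicator (excursion h \<rho> 0) \<omega>" .
      qed
    qed (use i1 i2 i3 in auto)
    also have "\<dots> = K * h + P.prob x (excursion h \<rho> 0)"
      using integrable_excursion[of h 0 x \<rho>] integral_excursion[of h 0 x \<rho>] h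
      by (subst Bochner_Integration.integral_add) (simp_all add: P.prob_space)
    also have "\<dots> \<le> \<epsilon>" using hs(2) mv[of 0 x] by simp
    finally show "\<bar>kernel U s f x - free_semigroup h (kernel U (s - h) f) x\<bar> \<le> \<epsilon>" unfolding g_def .
  qed
qed

text \<open>
  The approximants \<open>free_semigroup h (kernel U (s - h) f)\<close> are equicontinuous, because
  \<open>kernel U (s - h) f\<close> is again bounded by \<open>1\<close>.
\<close>

theorem kernel_equicontinuous:
  assumes U: "open U" "x0 \<in> U" and s: "0 < s" and e: "0 < \<epsilon>"
  obtains \<delta> where "0 < \<delta>"
    "\<And>x f. x \<in> ball x0 \<delta> \<Longrightarrow> f \<in> borel_measurable borel \<Longrightarrow> (\<And>y. \<bar>f y\<bar> \<le> 1) \<Longrightarrow>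
      \<bar>kernel U s f x - kernel U s f x0\<bar> < \<epsilon>"
proof -
  obtain h \<rho> where h: "0 < h" "h < s" "0 < \<rho>" and close:
    "\<And>x f. x \<in> ball x0 \<rho> \<Longrightarrow> f \<in> borel_measurable borel \<Longrightarrow> (\<And>y. \<bar>f y\<bar> \<le> 1) \<Longrightarrow>
      \<bar>kernel U s f x - free_semigroup h (kernel U (s - h) f) x\<bar> \<le> \<epsilon> / 4"
    using kernel_close_to_free[OF U s, of "\<epsilon> / 4"] e by auto
  obtain \<delta> where d: "0 < \<delta>" and eq: "\<And>x g. x \<in> ball x0 \<delta> \<Longrightarrow> g \<in> borel_measurable borel \<Longrightarrow> (\<And>y. \<bar>g y\<bar> \<le> 1) \<Longrightarrow>
    \<bar>free_semigroup h g x - free_semigroup h g x0\<bar> < \<epsilon> / 2"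
    using free_equicontinuous[OF h(1), of "\<epsilon> / 2" x0] e by auto
  show ?thesis
  proof (rule that[of "min \<rho> \<delta>"])
    show "0 < min \<rho> \<delta>" using d h by simp
    fix x and f :: "'a \<Rightarrow> real" assume x: "x \<in> ball x0 (min \<rho> \<delta>)" and f: "f \<in> borel_measurable borel" "\<And>y. \<bar>f y :: real\<bar> \<le> 1"
    have "\<bar>free_semigroup h (kernel U (s - h) f) x - free_semigroup h (kernel U (s - h) f) x0\<bar> < \<epsilon> / 2"
      using x h f by (intro eq measurable_kernel abs_kernel_le) auto
    moreover have "\<bar>kernel U s f x - free_semigroup h (kernel U (s - h) f) x\<bar> \<le> \<epsilon> / 4"
      "\<bar>kernel U s f x0 - free_semigroup h (kernel U (s - h) f) x0\<bar> \<le> \<epsilon> / 4"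
      using x h by (intro close f; simp)+
    ultimately show "\<bar>kernel U s f x - kernel U s f x0\<bar> < \<epsilon>" by linarith
  qed
qed

lemma weight_nonzero_imp_in:
  assumes "weight V U t (path_from 0 \<omega>) \<noteq> 0" "0 \<le> t"
  shows "X t \<omega> \<in> U"
proof -
  have "survives U t (path_from 0 \<omega>)" using assms by (auto simp: weight_def split: if_splits)
  then obtain k :: nat where "ball (path_from 0 \<omega> (1 * t)) (1 / real (Suc k)) \<subseteq> U"
    unfolding survives_def by fastforce
  then show ?thesis using assms(2) by (auto simp: path_from_def)
qed

text \<open>
  The transition density is bounded, and surviving paths end in \<open>U\<close>.
\<close>

lemma abs_kernel_le_L1:
  assumes s: "0 < s"
  obtains C where "0 \<le> C" "\<And>f x. f \<in> borel_measurable borel \<Longrightarrow> integrable lborel (\<lambda>y. indicator U y * \<bar>f y\<bar>) \<Longrightarrow>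
    U \<in> sets borel \<Longrightarrow> \<bar>kernel U s f x\<bar> \<le> C * (LINT y|lborel. indicator U y * \<bar>f y\<bar>)"
proof -
  obtain C where C: "\<And>y. transition_density s y \<le> C" using transition_density_properties(3)[OF s] by blast
  have C0: "0 \<le> C" using C[of 0] transition_density_properties(2)[OF s, of 0] by linarith
  have [measurable]: "transition_density s \<in> borel_measurable borel" by (rule transition_density_properties(4)[OF s])
  show ?thesis
  proof (rule that[OF C0])
    fix f :: "'a \<Rightarrow> real" and x assume f[measurable]: "f \<in> borel_measurable borel"
      and int: "integrable lborel (\<lambda>y. indicator U y * \<bar>f y\<bar>)" and U[measurable]: "U \<in> sets borel"
    have [measurable]: "X s \<in> borel_measurable (P x)" using s by auto
    have [measurable]: "(\<lambda>\<omega>. weight V U s (path_from 0 \<omega>)) \<in> borel_measurable (P x)"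
      using s by (intro measurable_weight_path) auto
    let ?F = "\<lambda>y. indicator U y * \<bar>f y\<bar>"
    have id: "integrable lborel (\<lambda>y. transition_density s (y - x) * ?F y)"
    proof (rule Bochner_Integration.integrable_bound)
      show "integrable lborel (\<lambda>y. C * ?F y)" using int by auto
      show "AE y in lborel. norm (transition_density s (y - x) * ?F y) \<le> norm (C * ?F y)"
        using C transition_density_properties(2)[OF s] C0 by (auto simp: abs_mult intro!: mult_right_mono)
    qed measurable
    have iF: "integrable (P x) (\<lambda>\<omega>. ?F (X s \<omega>))"
      using id by (subst integrable_X[OF s]) auto
    have le: "\<bar>weight V U s (path_from 0 \<omega>) * f (X s \<omega>)\<bar> \<le> ?F (X s \<omega>)" for \<omega>
    proof (cases "weight V U s (path_from 0 \<omega>) = 0")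
      case False
      then have "X s \<omega> \<in> U" using s by (intro weight_nonzero_imp_in) auto
      then show ?thesis using abs_weight_mult_le[of "f (X s \<omega>)" "\<bar>f (X s \<omega>)\<bar>" U s] by simp
    qed simp
    have "\<bar>kernel U s f x\<bar> \<le> (LINT \<omega>|P x. \<bar>weight V U s (path_from 0 \<omega>) * f (X s \<omega>)\<bar>)"
      unfolding kernel_def by (rule integral_abs_bound)
    also have "\<dots> \<le> (LINT \<omega>|P x. ?F (X s \<omega>))"
      using iF le by (intro integral_mono_AE Bochner_Integration.integrable_bound[OF iF]) (auto intro: order_trans[OF _ abs_ge_self])
    also have "\<dots> = (LINT y|lborel. transition_density s (y - x) * ?F y)"
      by (rule expectation_X[OF s]) measurable
    also have "\<dots> \<le> (LINT y|lborel. C * ?F y)"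
      using id int C by (intro integral_mono_AE) (auto intro!: mult_right_mono AE_I2)
    finally show "\<bar>kernel U s f x\<bar> \<le> C * (LINT y|lborel. indicator U y * \<bar>f y\<bar>)" by simp
  qed
qed

end

section \<open>Exit times\<close>

lemma (in prob_space) prob_liminf_le:
  assumes E: "\<And>n::nat. E n \<in> events" and q: "\<And>n. prob (E n) \<le> q"
  shows "(\<Union>N. \<Inter>n\<in>{N..}. E n) \<in> events" "prob (\<Union>N. \<Inter>n\<in>{N..}. E n) \<le> q"
proof -
  have F: "(\<Inter>n\<in>{N..}. E n) \<in> events" for N using E by (intro sets.countable_INT) auto
  show "(\<Union>N. \<Inter>n\<in>{N..}. E n) \<in> events" using F by auto
  have "incseq (\<lambda>N. \<Inter>n\<in>{N..}. E n)" by (intro incseq_SucI) force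
  then have lim: "(\<lambda>N. prob (\<Inter>n\<in>{N..}. E n)) \<longlonglongrightarrow> prob (\<Union>N. \<Inter>n\<in>{N..}. E n)"
    using F by (intro finite_Lim_measure_incseq) auto
  have "prob (\<Inter>n\<in>{N..}. E n) \<le> q" for N
    using q[of N] finite_measure_mono[OF _ E[of N], of "\<Inter>n\<in>{N..}. E n"] by fastforce
  then show "prob (\<Union>N. \<Inter>n\<in>{N..}. E n) \<le> q" by (intro LIMSEQ_le_const2[OF lim]) auto
qed

context stable_process
begin

text \<open>
  The first of the times \<open>0, a, 2a, \<dots>\<close> at which the process is in \<open>C\<close> is \<open>k a\<close>. Almost surely
  under \<open>P\<^sub>x\<close> the point \<open>x + (X u \<omega> - X 0 \<omega>)\<close> is \<open>X u \<omega>\<close>; in this form the event is a function of the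
  recentred past.
\<close>

definition first_entry :: "'a set \<Rightarrow> real \<Rightarrow> 'a \<Rightarrow> nat \<Rightarrow> 'w set" where
  "first_entry C a x k = {\<omega> \<in> space \<Omega>. (\<forall>j<k. x + (X (real j * a) \<omega> - X 0 \<omega>) \<notin> C) \<and> x + (X (real k * a) \<omega> - X 0 \<omega>) \<in> C}"

definition moved_after_entry :: "'a set \<Rightarrow> real \<Rightarrow> real \<Rightarrow> real \<Rightarrow> 'a \<Rightarrow> 'w set" where
  "moved_after_entry C a h \<rho> x = (\<Union>k. first_entry C a x k \<inter> excursion h \<rho> (real k * a))"

text \<open>
  The strong Markov property for a time with values in a grid: decompose according to the value of
  that time. On each piece the excursion is independent of the past, and the pieces are disjoint.
\<close>

lemma prob_moved_after_entry:
  assumes C[measurable]: "C \<in> sets borel" and a: "0 \<le> a" and h: "0 \<le> h"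
    and q: "\<And>s. 0 \<le> s \<Longrightarrow> P.prob x (excursion h \<rho> s) \<le> q"
  shows "moved_after_entry C a h \<rho> x \<in> sets (P x)" "P.prob x (moved_after_entry C a h \<rho> x) \<le> q"
proof -
  define M where "M k = excursion h \<rho> (real k * a)" for k
  define A where "A = first_entry C a x"
  have [simp]: "0 \<le> real k * a" for k using a by simp
  define S :: "nat \<Rightarrow> (real \<Rightarrow> 'a) set" where
    "S k = {w \<in> space path_space. (\<forall>j<k. x + w (real j * a) \<notin> C) \<and> x + w (real k * a) \<in> C}" for k
  have S: "S k \<in> sets path_space" for k
  proof -
    have [measurable]: "(\<lambda>w. w (real j * a)) \<in> borel_measurable (path_space :: (real \<Rightarrow> 'a) measure)" for j
      by (rule measurable_component_singleton) simp
    show ?thesis unfolding S_def by measurable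
  qed
  define R :: "(real \<Rightarrow> 'a) set" where "R = {w \<in> space path_space. moved h \<rho> w}"
  have R: "R \<in> sets path_space" unfolding R_def by (rule sets_moved[OF h])
  have Aeq: "A k = past (real k * a) -` S k \<inter> space (P x)" for k
  proof -
    have "past (real k * a) \<omega> (real j * a) = X (real j * a) \<omega> - X 0 \<omega>" if "j \<le> k" for j \<omega>
      using that a by (simp add: past_def min_absorb1 mult_right_mono)
    then show ?thesis
      using measurable_space[OF measurable_past[of "real k * a" x]]
      by (auto simp: A_def first_entry_def S_def space_P)
  qed
  have Meq: "M k = shifted (real k * a) -` R \<inter> space (P x)" for k
    unfolding M_def R_def by (rule excursion_eq_vimage) simp
  have As: "A k \<in> sets (P x)" for k unfolding Aeq by (rule measurable_sets[OF measurable_past S]) simp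
  have Ms: "M k \<in> sets (P x)" for k unfolding M_def using h by (intro sets_excursion) simp_all
  have prod: "P.prob x (A k \<inter> M k) = P.prob x (A k) * P.prob x (M k)" for k
  proof -
    have "A k \<inter> M k = (\<lambda>\<omega>. (past (real k * a) \<omega>, shifted (real k * a) \<omega>)) -` (S k \<times> R) \<inter> space (P x)"
      unfolding Aeq Meq by auto
    then show ?thesis
      using P.indep_varD[OF indep_past_shifted[of "real k * a" x] S[of k] R] by (simp add: Aeq Meq)
  qed
  have E: "moved_after_entry C a h \<rho> x = (\<Union>k. A k \<inter> M k)"
    by (simp add: moved_after_entry_def A_def M_def)
  show "moved_after_entry C a h \<rho> x \<in> sets (P x)" unfolding E using As Ms by auto
  have dis: "disjoint_family A"
  proof (unfold disjoint_family_on_def, intro ballI impI)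
    fix k l :: nat assume "k \<noteq> l"
    then show "A k \<inter> A l = {}" by (cases k l rule: linorder_cases) (auto simp: A_def first_entry_def)
  qed
  have sA: "(\<lambda>k. P.prob x (A k)) sums P.prob x (\<Union>k. A k)"
    using As dis by (intro P.finite_measure_UNION) auto
  have sAM: "(\<lambda>k. P.prob x (A k \<inter> M k)) sums P.prob x (\<Union>k. A k \<inter> M k)"
    using As Ms disjoint_family_subset[OF dis, of "\<lambda>k. A k \<inter> M k"]
    by (intro P.finite_measure_UNION) auto
  have "P.prob x (\<Union>k. A k \<inter> M k) \<le> q * P.prob x (\<Union>k. A k)"
  proof (rule sums_le[OF _ sAM sums_mult[OF sA]])
    show "P.prob x (A k \<inter> M k) \<le> q * P.prob x (A k)" for k
    proof -
      have "P.prob x (M k) \<le> q" unfolding M_def by (rule q) simp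
      then show ?thesis unfolding prod by (simp add: mult.commute[of q] mult_left_mono)
    qed
  qed
  also have "\<dots> \<le> q * 1"
  proof (rule mult_left_mono)
    show "0 \<le> q" using q[of 0] measure_nonneg[of "P x"] by (meson order_refl order_trans)
  qed simp
  finally show "P.prob x (moved_after_entry C a h \<rho> x) \<le> q" unfolding E by simp
qed

text \<open>
  At time \<open>s\<close> the process approaches a point \<open>L\<close> of the complement of \<open>U\<close> from the left, but jumps
  away from it by more than \<open>\<rho>\<close>. Before \<open>s\<close> it keeps a positive distance from the complement, so
  that \<open>s\<close> is announced by the times at which this distance becomes small.
\<close>

definition bad_jump :: "'a set \<Rightarrow> real \<Rightarrow> 'w \<Rightarrow> bool" where
  "bad_jump U \<rho> \<omega> \<longleftrightarrow> (\<exists>s L. 0 < s \<and> ((\<lambda>u. X u \<omega>) \<longlongrightarrow> L) (at_left s) \<and> L \<notin> U \<and> \<rho> < dist L (X s \<omega>) \<and>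
     (\<forall>r. 0 \<le> r \<and> r < s \<longrightarrow> (\<exists>k::nat. \<forall>u\<in>{0..r}. ball (X u \<omega>) (1 / real (Suc k)) \<subseteq> U)))"

text \<open>
  Let the distance \<open>1 / (i + 1)\<close> be small, and then let the grid be fine. Then the first grid
  time at which the process is that close to the complement lies just before \<open>s\<close>, so the jump at
  \<open>s\<close> is an excursion within time \<open>h\<close> after it.
\<close>

lemma bad_jump_imp_moved_after_entry:
  assumes \<omega>: "\<omega> \<in> space \<Omega>" and X0: "X 0 \<omega> = x" and h: "0 < h" and bad: "bad_jump U \<rho> \<omega>"
  shows "\<exists>I. \<forall>i\<ge>I. \<exists>M. \<forall>m\<ge>M. \<omega> \<in> moved_after_entry {y. \<not> ball y (1 / real (Suc i)) \<subseteq> U} (1 / real (Suc m)) h \<rho> x"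
proof -
  obtain s L where s: "0 < s" and L: "((\<lambda>u. X u \<omega>) \<longlongrightarrow> L) (at_left s)" "L \<notin> U" and jump: "\<rho> < dist L (X s \<omega>)"
    and good: "\<And>r. 0 \<le> r \<Longrightarrow> r < s \<Longrightarrow> \<exists>k::nat. \<forall>u\<in>{0..r}. ball (X u \<omega>) (1 / real (Suc k)) \<subseteq> U"
    using bad unfolding bad_jump_def by blast
  have "\<forall>\<^sub>F u in at_left s. dist (X u \<omega>) L < dist L (X s \<omega>) - \<rho>"
    using L(1) jump by (intro tendstoD) auto
  then obtain b where b: "b < s" "\<And>u. b < u \<Longrightarrow> u < s \<Longrightarrow> dist (X u \<omega>) L < dist L (X s \<omega>) - \<rho>"
    by (auto simp: eventually_at_left_field)
  \<comment> \<open>after \<open>s1\<close> the process is so near \<open>L\<close> that the jump at \<open>s\<close> takes it farther than \<open>\<rho>\<close> away, and less than \<open>h\<close> is left until \<open>s\<close>\<close>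
  define s1 where "s1 = max 0 (max b (s - h))"
  have s1: "0 \<le> s1" "s1 < s" "b \<le> s1" "s - h \<le> s1" using s b h by (auto simp: s1_def)
  obtain I :: nat where I: "\<And>u. u \<in> {0..s1} \<Longrightarrow> ball (X u \<omega>) (1 / real (Suc I)) \<subseteq> U"
    using good[OF s1(1,2)] by blast
  have mv: "moved h \<rho> (shifted u \<omega>)" if u: "s1 < u" "u < s" for u
  proof (rule ccontr)
    assume "\<not> moved h \<rho> (shifted u \<omega>)"
    then have "norm (shifted u \<omega> (s - u)) \<le> \<rho>"
      using u s1 h by (intro not_moved_imp_le[OF right_cont_shifted[OF \<omega>]]) auto
    then have "dist (X s \<omega>) (X u \<omega>) \<le> \<rho>" using u by (simp add: shifted_def dist_norm)
    moreover have "dist (X u \<omega>) L < dist L (X s \<omega>) - \<rho>" using u s1 by (intro b) auto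
    ultimately show False using dist_triangle[of L "X s \<omega>" "X u \<omega>"] by (simp add: dist_commute)
  qed
  show ?thesis
  proof (rule exI[of _ I], intro allI impI)
    fix i assume i: "I \<le> i"
    let ?C = "{y. \<not> ball y (1 / real (Suc i)) \<subseteq> U}"
    have before: "X u \<omega> \<notin> ?C" if "u \<in> {0..s1}" for u
    proof -
      have "1 / real (Suc i) \<le> 1 / real (Suc I)" using i by (auto intro!: divide_left_mono)
      then have "ball (X u \<omega>) (1 / real (Suc i)) \<subseteq> ball (X u \<omega>) (1 / real (Suc I))" by (rule subset_ball)
      then show ?thesis using I[OF that] by auto
    qed
    have "\<forall>\<^sub>F u in at_left s. dist (X u \<omega>) L < 1 / real (Suc i)"
      using L(1) by (intro tendstoD) auto
    then obtain b' where b': "b' < s" "\<And>u. b' < u \<Longrightarrow> u < s \<Longrightarrow> dist (X u \<omega>) L < 1 / real (Suc i)"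
      by (auto simp: eventually_at_left_field)
    have in_C: "X u \<omega> \<in> ?C" if "b' < u" "u < s" for u
      using b'(2)[OF that] L(2) by (auto simp: subset_iff)
    define s2 where "s2 = max b' s1"
    have s2: "0 \<le> s2" "s2 < s" "b' \<le> s2" using s1 b' by (auto simp: s2_def)
    obtain M :: nat where M: "1 / real (Suc M) < s - s2" using s2 nat_approx_posE[of "s - s2"] by auto
    show "\<exists>M. \<forall>m\<ge>M. \<omega> \<in> moved_after_entry ?C (1 / real (Suc m)) h \<rho> x"
    proof (intro exI[of _ M] allI impI)
      fix m assume m: "M \<le> m"
      define a where "a = 1 / real (Suc m)"
      have a: "0 < a" "a < s - s2"
      proof -
        have "a \<le> 1 / real (Suc M)" unfolding a_def using m by (auto intro!: divide_left_mono)
        then show "a < s - s2" using M by simp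
      qed (simp add: a_def)
      \<comment> \<open>the grid is finer than \<open>s - s2\<close>, so it has a point between \<open>s2\<close> and \<open>s\<close>\<close>
      define k0 where "k0 = nat (\<lfloor>s2 / a\<rfloor> + 1)"
      have k0: "s2 < real k0 * a" "real k0 * a < s"
      proof -
        have "real k0 = of_int \<lfloor>s2 / a\<rfloor> + 1" using s2 a by (simp add: k0_def)
        then have "s2 / a < real k0" "real k0 \<le> s2 / a + 1" by linarith+
        then show "s2 < real k0 * a" "real k0 * a < s" using a by (simp_all add: field_simps)
      qed
      have ex: "X (real k0 * a) \<omega> \<in> ?C" using k0 s2 by (intro in_C) auto
      define k where "k = (LEAST k. X (real k * a) \<omega> \<in> ?C)"
      have k: "X (real k * a) \<omega> \<in> ?C" unfolding k_def by (rule LeastI[of "\<lambda>k. X (real k * a) \<omega> \<in> ?C", OF ex])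
      have kl: "k \<le> k0" unfolding k_def by (rule Least_le[of "\<lambda>k. X (real k * a) \<omega> \<in> ?C", OF ex])
      have kf: "X (real j * a) \<omega> \<notin> ?C" if "j < k" for j
        using not_less_Least[of j "\<lambda>k. X (real k * a) \<omega> \<in> ?C"] that unfolding k_def by blast
      have "real k * a \<le> real k0 * a" using kl a by (intro mult_right_mono) auto
      then have ks: "real k * a < s" using k0 by simp
      have "s1 < real k * a"
      proof (rule ccontr)
        assume "\<not> s1 < real k * a"
        then have "real k * a \<in> {0..s1}" using a by auto
        then show False using before k by blast
      qed
      then have "moved h \<rho> (shifted (real k * a) \<omega>)" using ks by (intro mv)
      then show "\<omega> \<in> moved_after_entry ?C (1 / real (Suc m)) h \<rho> x"
        unfolding moved_after_entry_def first_entry_def excursion_def a_def[symmetric] using \<omega> k kf X0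
        by (intro UN_I[of k]) auto
    qed
  qed
qed

text \<open>
  A form of quasi-left-continuity: the jump would be an excursion of size \<open>\<rho>\<close> within an arbitrarily
  short time after a stopping time, and the probability of such excursions tends to \<open>0\<close>.
\<close>

lemma AE_not_bad_jump:
  assumes \<rho>: "0 < \<rho>"
  shows "AE \<omega> in P x. \<not> bad_jump U \<rho> \<omega>"
proof -
  have "\<exists>D. D \<in> sets (P x) \<and> P.prob x D \<le> 1 / real (Suc n) \<and> {\<omega> \<in> space \<Omega>. X 0 \<omega> = x \<and> bad_jump U \<rho> \<omega>} \<subseteq> D" for n
  proof -
    have pos: "0 < 1 / real (Suc n)" by simp
    obtain h where h: "0 < h" "h \<le> 1" "\<And>x s. 0 \<le> s \<Longrightarrow> P.prob x (excursion h \<rho> s) < 1 / real (Suc n)"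
      by (rule prob_excursion_small[OF \<rho> pos zero_less_one]) (rule that; assumption)
    define B where "B i m = moved_after_entry {y. \<not> ball y (1 / real (Suc i)) \<subseteq> U} (1 / real (Suc m)) h \<rho> x" for i m
    have C: "{y. \<not> ball y (1 / real (Suc i)) \<subseteq> U} \<in> sets borel" for i
      using closed_ball_subset[of "1 / real (Suc i)" U] by (intro borel_open) (simp add: closed_def Collect_neg_eq)
    have B: "B i m \<in> sets (P x)" "P.prob x (B i m) \<le> 1 / real (Suc n)" for i m
    proof -
      have a: "0 \<le> 1 / real (Suc m)" by simp
      note moved = prob_moved_after_entry[OF C a less_imp_le[OF h(1)] less_imp_le[OF h(3)]]
      show "B i m \<in> sets (P x)" "P.prob x (B i m) \<le> 1 / real (Suc n)"
        unfolding B_def by (rule moved, assumption)+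
    qed
    \<comment> \<open>first the grid is refined, then the distance is shrunk; a lower limit of events does not increase the bound\<close>
    define E where "E i = (\<Union>N. \<Inter>m\<in>{N..}. B i m)" for i
    have E: "E i \<in> sets (P x)" "P.prob x (E i) \<le> 1 / real (Suc n)" for i
      unfolding E_def using P.prob_liminf_le[of "B i" x "1 / real (Suc n)"] B by blast+
    define D where "D = (\<Union>N. \<Inter>i\<in>{N..}. E i)"
    have "D \<in> sets (P x)" "P.prob x D \<le> 1 / real (Suc n)"
      unfolding D_def using P.prob_liminf_le[of E x "1 / real (Suc n)"] E by blast+
    moreover have "{\<omega> \<in> space \<Omega>. X 0 \<omega> = x \<and> bad_jump U \<rho> \<omega>} \<subseteq> D"
    proof safe
      fix \<omega> assume \<omega>: "\<omega> \<in> space \<Omega>" "bad_jump U \<rho> \<omega>" "x = X 0 \<omega>"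
      then have "\<exists>I. \<forall>i\<ge>I. \<exists>M. \<forall>m\<ge>M. \<omega> \<in> B i m"
        unfolding B_def by (intro bad_jump_imp_moved_after_entry h) auto
      then show "\<omega> \<in> D"
        by (simp add: D_def E_def) (simp add: Ball_def)
    qed
    ultimately show ?thesis by blast
  qed
  then obtain D where D: "\<And>n. D n \<in> sets (P x)" "\<And>n. P.prob x (D n) \<le> 1 / real (Suc n)"
    "\<And>n. {\<omega> \<in> space \<Omega>. X 0 \<omega> = x \<and> bad_jump U \<rho> \<omega>} \<subseteq> D n" by metis
  have I: "(\<Inter>n. D n) \<in> sets (P x)" using D by auto
  have le: "P.prob x (\<Inter>n. D n) \<le> 1 / real (Suc n)" for n
    using P.finite_measure_mono[OF _ D(1)[of n], of "\<Inter>n. D n"] D(2)[of n] by (meson INF_lower UNIV_I order_trans)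
  have "P.prob x (\<Inter>n. D n) = 0"
  proof (rule ccontr)
    assume "P.prob x (\<Inter>n. D n) \<noteq> 0"
    then have "0 < P.prob x (\<Inter>n. D n)" by (simp add: zero_less_measure_iff)
    then obtain n where "1 / real (Suc n) < P.prob x (\<Inter>n. D n)" using nat_approx_posE by blast
    then show False using le[of n] by simp
  qed
  then have "(\<Inter>n. D n) \<in> null_sets (P x)" using I by (auto simp: null_sets_def P.emeasure_eq_measure)
  then have "AE \<omega> in P x. \<omega> \<notin> (\<Inter>n. D n)" by (rule AE_not_in)
  with start[of x] AE_space show ?thesis
    by eventually_elim (use D(3) in \<open>auto simp: space_P\<close>)
qed

text \<open>
  Consider the supremum \<open>s\<close> of the times up to which the distance from the complement is bounded
  below. The process is in \<open>U\<close> at \<open>s\<close>, so by right continuity the distance cannot start to vanish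
  after \<open>s\<close>. Hence it vanishes from the left: the left limit at \<open>s\<close> is outside \<open>U\<close>, and the process
  jumps at \<open>s\<close>.
\<close>

lemma leaves_by_jump:
  assumes \<omega>: "\<omega> \<in> space \<Omega>" and U: "open U" "X 0 \<omega> \<in> U" and t: "0 < t"
    and stays: "\<And>s. 0 < s \<Longrightarrow> s \<le> t \<Longrightarrow> X s \<omega> \<in> U" and ns: "\<not> survives U t (path_from 0 \<omega>)"
  shows "\<exists>j::nat. bad_jump U (1 / real (Suc j)) \<omega>"
proof -
  define good where "good s \<longleftrightarrow> (\<exists>k::nat. \<forall>u\<in>{0..s}. ball (X u \<omega>) (1 / real (Suc k)) \<subseteq> U)" for s
  have inU: "X s \<omega> \<in> U" if "0 \<le> s" "s \<le> t" for s using that stays[of s] U(2) by (cases "s = 0") auto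
  \<comment> \<open>a bound up to \<open>s\<close> and a bound \<open>e\<close> after \<open>s\<close> combine\<close>
  have good_ext: "good s'" if g: "good s" and l: "\<And>u. s < u \<Longrightarrow> u \<le> s' \<Longrightarrow> ball (X u \<omega>) e \<subseteq> U" and e: "0 < e" for s s' e
  proof -
    obtain k where k: "\<And>u. u \<in> {0..s} \<Longrightarrow> ball (X u \<omega>) (1 / real (Suc k)) \<subseteq> U" using g good_def by blast
    obtain l where l': "1 / real (Suc l) < e" using nat_approx_posE[OF e] by blast
    have "ball (X u \<omega>) (1 / real (Suc (max k l))) \<subseteq> U" if u: "u \<in> {0..s'}" for u
    proof (cases "u \<le> s")
      case True
      then show ?thesis using k[of u] ball_Suc_max_subset(1)[of "X u \<omega>" k l] u by auto
    next
      case False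
      then have "ball (X u \<omega>) (1 / real (Suc l)) \<subseteq> U"
        using l[of u] u subset_ball[of "1 / real (Suc l)" e "X u \<omega>"] l' by auto
      then show ?thesis using ball_Suc_max_subset(2)[of "X u \<omega>" k l] by simp
    qed
    then show ?thesis unfolding good_def by blast
  qed
  have half: "\<exists>e>0. \<forall>z\<in>ball y e. ball z e \<subseteq> U" if y: "y \<in> U" for y
  proof -
    obtain e where e: "0 < e" "ball y e \<subseteq> U" using openE[OF U(1) y] by metis
    have "ball z (e / 2) \<subseteq> U" if "z \<in> ball y (e / 2)" for z
    proof
      fix v assume "v \<in> ball z (e / 2)"
      then have "dist y v < e" using that dist_triangle_half_r[of z y e v] by (simp add: dist_commute)
      then show "v \<in> U" using e by auto
    qed
    then show ?thesis using e by (intro exI[of _ "e / 2"]) auto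
  qed
  have good0: "good 0"
  proof -
    obtain e where "0 < e" "ball (X 0 \<omega>) e \<subseteq> U" using openE[OF U] by metis
    moreover obtain l where "1 / real (Suc l) < e" using nat_approx_posE[OF \<open>0 < e\<close>] by blast
    ultimately have "ball (X 0 \<omega>) (1 / real (Suc l)) \<subseteq> U" using subset_ball[of "1 / real (Suc l)" e "X 0 \<omega>"] by auto
    then show ?thesis unfolding good_def by auto
  qed
  have step: "\<exists>s'>s. s' \<le> t \<and> good s'" if s: "0 \<le> s" "s < t" "good s" for s
  proof -
    obtain e where e: "0 < e" "\<And>z. z \<in> ball (X s \<omega>) e \<Longrightarrow> ball z e \<subseteq> U" using half[OF inU[of s]] s by auto
    have "\<forall>\<^sub>F u in at_right s. dist (X u \<omega>) (X s \<omega>) < e"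
      using right_continuous_paths[OF \<omega> s(1)] e(1) by (rule tendstoD)
    then obtain b where b: "s < b" "\<And>u. s < u \<Longrightarrow> u < b \<Longrightarrow> dist (X u \<omega>) (X s \<omega>) < e"
      by (auto simp: eventually_at_right_field)
    define s' where "s' = min t ((s + b) / 2)"
    have s': "s < s'" "s' \<le> t" "s' < b" using s b(1) by (auto simp: s'_def min_less_iff_disj)
    have "good s'"
      by (rule good_ext[OF s(3) _ e(1)]) (use e(2) b(2) s' in \<open>force simp: dist_commute\<close>)
    then show ?thesis using s' by blast
  qed
  have notgood: "\<not> good t"
    using ns t unfolding survives_iff[OF right_cont_path[OF \<omega> order_refl] less_imp_le[OF t]] good_def
    by (auto simp: path_from_def)
  have mono: "good s" if "good s'" "s \<le> s'" for s s' using that unfolding good_def by fastforce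
  define T where "T = {s \<in> {0..t}. good s}"
  define s where "s = Sup T"
  have T: "0 \<in> T" "bdd_above T" using good0 t by (auto simp: T_def intro: bdd_aboveI[of _ t])
  have st: "s \<le> t" unfolding s_def using T by (intro cSup_least) (auto simp: T_def)
  have up: "s' \<le> s" if "s' \<in> T" for s' unfolding s_def using that T by (intro cSup_upper)
  have s0: "0 < s"
  proof -
    obtain s' where "s' > 0" "s' \<le> t" "good s'" using step[of 0] good0 t by auto
    then show ?thesis using up[of s'] by (auto simp: T_def)
  qed
  have below: "good r" if r: "r < s" for r
  proof -
    obtain s' where "s' \<in> T" "r < s'" using less_cSup_iff[of T r] r T unfolding s_def by auto
    then show ?thesis using mono[of s' r] by (auto simp: T_def)
  qed
  have ng: "\<not> good s"
  proof
    assume g: "good s"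
    then have "s < t" using notgood st by (cases "s = t") auto
    then obtain s' where "s' > s" "s' \<le> t" "good s'" using step[of s] g s0 by auto
    then show False using up[of s'] s0 by (auto simp: T_def)
  qed
  obtain L where L: "((\<lambda>u. X u \<omega>) \<longlongrightarrow> L) (at_left s)" using left_limits_paths[OF \<omega> s0] by blast
  have LU: "L \<notin> U"
  proof
    assume "L \<in> U"
    then obtain e where e: "0 < e" "\<And>z. z \<in> ball L e \<Longrightarrow> ball z e \<subseteq> U" using half[of L] by blast
    have "X s \<omega> \<in> U" using s0 st by (intro inU) auto
    then obtain e' where e': "0 < e'" "ball (X s \<omega>) e' \<subseteq> U" using half by (metis centre_in_ball)
    have "\<forall>\<^sub>F u in at_left s. dist (X u \<omega>) L < e" using L e(1) by (rule tendstoD)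
    then obtain b where b: "b < s" "\<And>u. b < u \<Longrightarrow> u < s \<Longrightarrow> dist (X u \<omega>) L < e"
      by (auto simp: eventually_at_left_field)
    have "good s"
    proof (rule good_ext[OF below[OF b(1)], of _ "min e e'"])
      fix u assume u: "b < u" "u \<le> s"
      show "ball (X u \<omega>) (min e e') \<subseteq> U"
      proof (cases "u = s")
        case True
        then show ?thesis using e' subset_ball[of "min e e'" e' "X s \<omega>"] by auto
      next
        case False
        then have "X u \<omega> \<in> ball L e" using b(2)[of u] u by (auto simp: dist_commute)
        then show ?thesis using e(2) subset_ball[of "min e e'" e "X u \<omega>"] by (meson min.cobounded1 order_trans)
      qed
    qed (use e e' in auto)
    then show False using ng by simp
  qed
  have "X s \<omega> \<in> U" using s0 st by (intro inU) auto
  then have "0 < dist L (X s \<omega>)" using LU by auto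
  then obtain j where "1 / real (Suc j) < dist L (X s \<omega>)" using nat_approx_posE by blast
  then show ?thesis
    unfolding bad_jump_def using s0 L LU below unfolding good_def by blast
qed

lemma less_exit_time_iff:
  assumes \<omega>: "\<omega> \<in> space \<Omega>" and U: "open U" and t: "0 < t"
  shows "ereal t < exit_time X U \<omega> \<longleftrightarrow> (\<forall>s. 0 < s \<and> s \<le> t \<longrightarrow> X s \<omega> \<in> U)"
proof
  assume l: "ereal t < exit_time X U \<omega>"
  show "\<forall>s. 0 < s \<and> s \<le> t \<longrightarrow> X s \<omega> \<in> U"
  proof (intro allI impI, rule ccontr)
    fix s assume s: "0 < s \<and> s \<le> t" "X s \<omega> \<notin> U"
    then have "exit_time X U \<omega> \<le> ereal s" unfolding exit_time_def by (intro Inf_lower) auto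
    also have "\<dots> \<le> ereal t" using s by simp
    finally show False using l by simp
  qed
next
  assume st: "\<forall>s. 0 < s \<and> s \<le> t \<longrightarrow> X s \<omega> \<in> U"
  then have "X t \<omega> \<in> U" using t by simp
  then have "\<forall>\<^sub>F u in at_right t. X u \<omega> \<in> U"
    using right_continuous_paths[OF \<omega>, of t] U t by (intro topological_tendstoD) auto
  then obtain b where b: "t < b" "\<And>u. t < u \<Longrightarrow> u < b \<Longrightarrow> X u \<omega> \<in> U"
    by (auto simp: eventually_at_right_field)
  have "ereal b \<le> exit_time X U \<omega>"
    unfolding exit_time_def
  proof (rule Inf_greatest, safe)
    fix s assume "0 < s" "X s \<omega> \<notin> U"
    then show "ereal b \<le> ereal s" using st b(2)[of s] by (cases "s \<le> t"; cases "s < b") auto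
  qed
  then show "ereal t < exit_time X U \<omega>" using b(1) by (meson ereal_less_eq(3) less_ereal.simps(1) less_le_trans)
qed

text \<open>
  The event \<open>t < \<tau>\<^sub>U\<close> is thereby measurable for the completion of \<open>P\<^sub>x\<close>, and its indicator may be
  replaced by a measurable functional of the path.
\<close>

theorem AE_less_exit_time_iff_survives:
  assumes U: "open U" and x: "x \<in> U" and t: "0 < t"
  shows "AE \<omega> in P x. ereal t < exit_time X U \<omega> \<longleftrightarrow> survives U t (path_from 0 \<omega>)"
proof -
  have "AE \<omega> in P x. \<forall>j::nat. \<not> bad_jump U (1 / real (Suc j)) \<omega>"
    unfolding AE_all_countable by (intro allI AE_not_bad_jump) simp
  with start[of x] AE_space show ?thesis
  proof eventually_elim
    fix \<omega> assume X0: "X 0 \<omega> = x" and "\<omega> \<in> space (P x)" and nb: "\<forall>j::nat. \<not> bad_jump U (1 / real (Suc j)) \<omega>"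
    then have \<omega>: "\<omega> \<in> space \<Omega>" by (simp add: space_P)
    show "ereal t < exit_time X U \<omega> \<longleftrightarrow> survives U t (path_from 0 \<omega>)"
      unfolding less_exit_time_iff[OF \<omega> U t]
    proof
      assume "\<forall>s. 0 < s \<and> s \<le> t \<longrightarrow> X s \<omega> \<in> U"
      then show "survives U t (path_from 0 \<omega>)"
        using leaves_by_jump[OF \<omega> U _ t] X0 x nb by blast
    next
      assume "survives U t (path_from 0 \<omega>)"
      then obtain k :: nat where "\<forall>u\<in>{0..t}. ball (path_from 0 \<omega> u) (1 / real (Suc k)) \<subseteq> U"
        using survives_iff[OF right_cont_path[OF \<omega> order_refl] less_imp_le[OF t]] by blast
      then have "ball (X s \<omega>) (1 / real (Suc k)) \<subseteq> U" if "0 < s" "s \<le> t" for s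
        using that by (simp add: path_from_def)
      moreover have "X s \<omega> \<in> ball (X s \<omega>) (1 / real (Suc k))" for s by simp
      ultimately show "\<forall>s. 0 < s \<and> s \<le> t \<longrightarrow> X s \<omega> \<in> U" by blast
    qed
  qed
qed

end

section \<open>Strong Feller property and tightness\<close>

lemma tendsto_at_infinity_sequentially:
  fixes f :: "'a::real_normed_vector \<Rightarrow> 'b::metric_space"
  assumes "\<And>u. filterlim u at_infinity sequentially \<Longrightarrow> (\<lambda>n. f (u n)) \<longlonglongrightarrow> l"
  shows "(f \<longlongrightarrow> l) at_infinity"
proof (rule ccontr)
  assume "\<not> (f \<longlongrightarrow> l) at_infinity"
  then obtain e where e: "0 < e" "\<not> (\<exists>b. \<forall>x. b \<le> norm x \<longrightarrow> dist (f x) l < e)"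
    by (auto simp: tendsto_iff eventually_at_infinity)
  then have "\<forall>n::nat. \<exists>x. real n \<le> norm x \<and> \<not> dist (f x) l < e" by blast
  then obtain u where u: "\<And>n. real n \<le> norm (u n)" "\<And>n. \<not> dist (f (u n)) l < e" by metis
  have "filterlim u at_infinity sequentially"
    unfolding filterlim_at_infinity_conv_norm_at_top
    by (rule filterlim_at_top_mono[OF filterlim_real_sequentially]) (use u(1) in \<open>auto intro!: always_eventually\<close>)
  from assms[OF this] e(1) have "\<forall>\<^sub>F n in sequentially. dist (f (u n)) l < e" by (rule tendstoD)
  then show False using u(2) by (auto simp: eventually_sequentially)
qed

context stable_potential
begin

lemma survives_UNIV: "survives UNIV t w"
  by (simp add: survives_def)

lemma killed_semigroup_eq: "killed_semigroup P X V t f x = kernel UNIV t f x"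
  unfolding killed_semigroup_def kernel_def
  by (intro Bochner_Integration.integral_cong)
    (auto simp: space_P additive_functional_eq weight_def survives_UNIV)

text \<open>
  With high probability the path stays within a fixed distance of its starting point during
  \<open>[0, t]\<close>. If it starts far away, \<open>V\<close> is large along all of it.
\<close>

lemma kernel_tendsto_0:
  assumes t: "0 < t"
  shows "((\<lambda>x. kernel UNIV t (\<lambda>_. 1) x) \<longlongrightarrow> 0) at_infinity"
proof (rule tendstoI)
  fix e :: real assume e: "0 < e"
  define M where "M n = excursion t (real n) 0" for n
  have Ms: "M n \<in> sets (P x)" for n x unfolding M_def using t by (intro sets_excursion) auto
  have Mp: "P.prob x (M n) = P.prob 0 (M n)" for n x unfolding M_def using t by (intro prob_excursion) auto
  have "(\<lambda>n. P.prob 0 (M n)) \<longlonglongrightarrow> P.prob 0 (\<Inter>n. M n)"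
  proof (rule P.finite_Lim_measure_decseq)
    show "range M \<subseteq> sets (P 0)" using Ms by auto
    show "decseq M" by (intro decseq_SucI) (force simp: M_def excursion_def moved_def)
  qed
  moreover have "(\<Inter>n. M n) = {}"
  proof (rule equals0I)
    fix \<omega> assume *: "\<omega> \<in> (\<Inter>n. M n)"
    then have \<omega>: "\<omega> \<in> space \<Omega>" by (auto simp: M_def excursion_def)
    obtain R where R: "\<And>u. u \<in> {0..t} \<Longrightarrow> norm (X u \<omega>) \<le> R"
      using bounded_path[OF \<omega>, of t] unfolding bounded_iff by blast
    obtain n :: nat where n: "R + R < real n" using reals_Archimedean2 by blast
    have "moved t (real n) (shifted 0 \<omega>)" using * by (auto simp: M_def excursion_def)
    then obtain u where u: "u \<in> {0..t}" "real n < norm (shifted 0 \<omega> u)"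
      using t by (elim moved_imp_gt[rotated]) auto
    have "norm (shifted 0 \<omega> u) \<le> norm (X u \<omega>) + norm (X 0 \<omega>)"
      using u by (simp add: shifted_def norm_triangle_ineq4)
    then show False using u R[of u] R[of 0] n t by auto
  qed
  ultimately have "(\<lambda>n. P.prob 0 (M n)) \<longlonglongrightarrow> 0" by simp
  then have "\<forall>\<^sub>F n in sequentially. P.prob 0 (M n) < e / 2" using e by (intro order_tendstoD(2)) auto
  then obtain n where n: "P.prob 0 (M n) < e / 2" by (auto simp: eventually_sequentially)
  \<comment> \<open>the level at which \<open>exp (- K t)\<close> is \<open>exp (- 1)\<close> times \<open>e / 2\<close>\<close>
  define K where "K = (1 - ln (e / 2)) / t"
  have "exp (- (K * t)) = exp (ln (e / 2) - 1)" using t by (simp add: K_def)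
  also have "\<dots> < exp (ln (e / 2))" by simp
  finally have K: "exp (- (K * t)) < e / 2" using e by simp
  have "\<forall>\<^sub>F x in at_infinity. K \<le> V x" using V_at_top by (simp add: filterlim_at_top)
  then obtain b where b: "\<And>x. b \<le> norm x \<Longrightarrow> K \<le> V x" by (auto simp: eventually_at_infinity)
  have "\<bar>kernel UNIV t (\<lambda>_. 1) x\<bar> < e" if x: "b + real n \<le> norm x" for x
  proof -
    let ?w = "\<lambda>\<omega>. weight V UNIV t (path_from 0 \<omega>)"
    have wm: "?w \<in> borel_measurable (P x)" using t by (intro measurable_weight_path) auto
    have i1: "integrable (P x) ?w"
      using wm weight_V_bounds by (intro P.integrable_const_bound[where B=1]) auto
    have iB: "integrable (P x) (indicator (M n) :: _ \<Rightarrow> real)"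
      and B: "(LINT \<omega>|P x. indicator (M n) \<omega>) = P.prob x (M n)"
      unfolding M_def using t by (intro integrable_excursion integral_excursion; simp)+
    have "kernel UNIV t (\<lambda>_. 1) x = (LINT \<omega>|P x. ?w \<omega>)" by (simp add: kernel_def)
    also have "\<dots> \<le> (LINT \<omega>|P x. exp (- (K * t)) + indicator (M n) \<omega>)"
    proof (rule integral_mono_AE[OF i1])
      show "AE \<omega> in P x. ?w \<omega> \<le> exp (- (K * t)) + indicator (M n) \<omega>"
        using start[of x] AE_space
      proof eventually_elim
        fix \<omega> assume X0: "X 0 \<omega> = x" and "\<omega> \<in> space (P x)"
        then have \<omega>: "\<omega> \<in> space \<Omega>" by (simp add: space_P)
        show "?w \<omega> \<le> exp (- (K * t)) + indicator (M n) \<omega>"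
        proof (cases "moved t (real n) (shifted 0 \<omega>)")
          case True
          then have "\<omega> \<in> M n" using \<omega> by (simp add: M_def excursion_def)
          then show ?thesis using weight_V_bounds(2)[of UNIV t "path_from 0 \<omega>"] exp_gt_zero[of "- (K * t)"]
            by (simp add: add_increasing)
        next
          case False
          have "K \<le> V (X u \<omega>)" if u: "u \<in> {0..t}" for u
          proof -
            have "norm (shifted 0 \<omega> u) \<le> real n"
              using u t False by (intro not_moved_imp_le[OF right_cont_shifted[OF \<omega>]]) auto
            then have "norm (X u \<omega> - x) \<le> real n" using u X0 by (simp add: shifted_def)
            then have "b \<le> norm (X u \<omega>)"
              using x norm_triangle_sub[of x "X u \<omega>"] by (simp add: norm_minus_commute)
            then show ?thesis by (rule b)
          qed
          then have "(LINT u:{0..t}|lborel. K) \<le> (LINT u:{0..t}|lborel. V (X u \<omega>))"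
            using set_integrable_V_path[OF \<omega>, of 0 t]
            by (intro set_integral_mono set_integrable_const_Icc) auto
          then have "K * t \<le> path_integral V t (path_from 0 \<omega>)"
            using t by (simp add: path_integral_path[OF \<omega>] set_lebesgue_integral_def mult.commute)
          then have "exp (- path_integral V t (path_from 0 \<omega>)) \<le> exp (- (K * t))" by simp
          then show ?thesis by (simp add: weight_def survives_UNIV add_increasing2)
        qed
      qed
    qed (use iB in simp)
    also have "\<dots> = exp (- (K * t)) + P.prob x (M n)"
      using iB B by (subst Bochner_Integration.integral_add) (simp_all add: P.prob_space)
    also have "\<dots> < e" using K n Mp[of x n] by simp
    finally have "kernel UNIV t (\<lambda>_. 1) x < e" .
    moreover have "0 \<le> kernel UNIV t (\<lambda>_. 1) x"
      unfolding kernel_def by (simp add: weight_V_bounds)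
    ultimately show ?thesis by simp
  qed
  then show "\<forall>\<^sub>F x in at_infinity. dist (kernel UNIV t (\<lambda>_. 1) x) 0 < e"
    by (auto simp: eventually_at_infinity)
qed

lemma measurable_kernel_time: "(\<lambda>t. kernel UNIV t (\<lambda>_. 1) x) \<in> borel_measurable borel"
proof -
  have [measurable]: "path_from 0 \<in> measurable (P x) path_space" by simp
  have "(\<lambda>p. path_integral V (fst p) (path_from 0 (snd p))) \<in> borel_measurable (borel \<Otimes>\<^sub>M P x)"
  proof -
    have eq: "(\<lambda>p. path_integral V (fst p) (path_from 0 (snd p))) =
        (\<lambda>p. LINT s|lborel. of_bool (0 \<le> s \<and> s \<le> fst p) * V (eval_path (path_from 0 (snd p)) s))"
      unfolding path_integral_def set_lebesgue_integral_def
      by (intro ext Bochner_Integration.integral_cong) (auto simp: indicator_def)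
    show ?thesis
      unfolding eq by (rule lborel.borel_measurable_lebesgue_integral) measurable
  qed
  then have "(\<lambda>p. exp (- path_integral V (fst p) (path_from 0 (snd p)))) \<in> borel_measurable (borel \<Otimes>\<^sub>M P x)"
    by measurable
  then have "(\<lambda>t. LINT \<omega>|P x. exp (- path_integral V t (path_from 0 \<omega>))) \<in> borel_measurable borel"
    by (intro P.borel_measurable_lebesgue_integral) (simp add: split_beta)
  then show ?thesis by (simp add: kernel_def weight_def survives_UNIV)
qed

theorem resolvent_tendsto_0: "((\<lambda>x. killed_resolvent1 P X V (\<lambda>_. 1) x) \<longlongrightarrow> 0) at_infinity"
proof (rule tendsto_at_infinity_sequentially)
  fix u :: "nat \<Rightarrow> 'a" assume u: "filterlim u at_infinity sequentially"
  let ?F = "\<lambda>x t. indicator {0..} t *\<^sub>R (exp (- t) * kernel UNIV t (\<lambda>_. 1) x)"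
  have eq: "killed_resolvent1 P X V (\<lambda>_. 1) x = (LINT t|lborel. ?F x t)" for x
    by (simp add: killed_resolvent1_def set_lebesgue_integral_def killed_semigroup_eq)
  have [measurable]: "(\<lambda>t. kernel UNIV t (\<lambda>_. 1) x) \<in> borel_measurable borel" for x
    by (rule measurable_kernel_time)
  have "(\<lambda>n. LINT t|lborel. ?F (u n) t) \<longlonglongrightarrow> (LINT t|(lborel :: real measure). (0::real))"
  proof (rule integral_dominated_convergence[where w="\<lambda>t::real. indicator {0..} t *\<^sub>R exp (- t)"])
    have "((\<lambda>t. exp (- t)) has_integral 1) {0::real..}"
      using has_integral_exp_minus_to_infinity[of 1 0] by simp
    then have "(\<lambda>t::real. exp (- t)) absolutely_integrable_on {0..}"
      by (intro nonnegative_absolutely_integrable_1) (auto simp: integrable_on_def)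
    then show "integrable lborel (\<lambda>t::real. indicator {0..} t *\<^sub>R exp (- t))"
      unfolding set_integrable_def by (subst (asm) integrable_completion) auto
    show "AE t in lborel. (\<lambda>n. ?F (u n) t) \<longlonglongrightarrow> 0"
    proof -
      have "AE t in lborel. t \<noteq> (0::real)" by (rule AE_lborel_singleton)
      then show ?thesis
      proof eventually_elim
        fix t :: real assume t: "t \<noteq> 0"
        show "(\<lambda>n. ?F (u n) t) \<longlonglongrightarrow> 0"
        proof (cases "0 < t")
          case True
          have "(\<lambda>n. kernel UNIV t (\<lambda>_. 1) (u n)) \<longlonglongrightarrow> 0"
            by (rule filterlim_compose[OF kernel_tendsto_0[OF True] u])
          then have "(\<lambda>n. ?F (u n) t) \<longlonglongrightarrow> indicator {0..} t *\<^sub>R (exp (- t) * 0)"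
            by (intro tendsto_intros)
          then show ?thesis by simp
        qed (use t in \<open>simp add: indicator_def\<close>)
      qed
    qed
    show "AE t in lborel. norm (?F (u n) t) \<le> indicator {0..} t *\<^sub>R exp (- t)" for n
    proof (rule AE_I2)
      fix t :: real
      have "\<bar>kernel UNIV t (\<lambda>_. 1) (u n)\<bar> \<le> 1" if "0 \<le> t" using that by (intro abs_kernel_le) auto
      then show "norm (?F (u n) t) \<le> indicator {0..} t *\<^sub>R exp (- t)"
        by (auto simp: indicator_def abs_mult intro!: mult_left_le)
    qed
  qed measurable
  then show "(\<lambda>n. killed_resolvent1 P X V (\<lambda>_. 1) (u n)) \<longlonglongrightarrow> 0" by (simp add: eq)
qed

text \<open>
  The case \<open>U = UNIV\<close> of equicontinuity, for a single function.
\<close>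

theorem killed_semigroup_strong_feller:
  assumes t: "0 < t" and f: "f \<in> borel_measurable borel" "bounded (range f)"
  shows "continuous_on UNIV (killed_semigroup P X V t f)" "bounded (range (killed_semigroup P X V t f))"
proof -
  obtain C where C: "0 < C" "\<And>y. \<bar>f y\<bar> \<le> C"
    using f(2) unfolding bounded_pos by auto
  have "\<bar>kernel UNIV t f x\<bar> \<le> C" for x using t f C by (intro abs_kernel_le) auto
  then show "bounded (range (killed_semigroup P X V t f))"
    unfolding bounded_iff killed_semigroup_eq by auto
  have scale: "kernel UNIV t f x = C * kernel UNIV t (\<lambda>y. f y / C) x" for x
    using C(1) by (simp add: kernel_def)
  have "isCont (kernel UNIV t (\<lambda>y. f y / C)) x0" for x0
    unfolding continuous_at_eps_delta
  proof (intro allI impI)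
    fix e :: real assume e: "0 < e"
    obtain d where d: "0 < d" "\<And>x f. x \<in> ball x0 d \<Longrightarrow> f \<in> borel_measurable borel \<Longrightarrow> (\<And>y. \<bar>f y\<bar> \<le> 1) \<Longrightarrow>
      \<bar>kernel UNIV t f x - kernel UNIV t f x0\<bar> < e"
      using kernel_equicontinuous[OF open_UNIV UNIV_I t e, of x0] by metis
    show "\<exists>d>0. \<forall>x. dist x x0 < d \<longrightarrow> dist (kernel UNIV t (\<lambda>y. f y / C) x) (kernel UNIV t (\<lambda>y. f y / C) x0) < e"
      using d C f(1) by (intro exI[of _ d]) (auto simp: dist_real_def dist_commute intro!: d(2))
  qed
  then show "continuous_on UNIV (killed_semigroup P X V t f)"
    unfolding killed_semigroup_eq[abs_def] scale[abs_def]
    by (intro continuous_intros continuous_at_imp_continuous_on) auto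
qed

end

section \<open>Compactness on essentially bounded functions\<close>

lemma borel_measurable_completion_AE:
  fixes f :: "'a \<Rightarrow> real"
  assumes h: "h \<in> borel_measurable M" and eq: "AE x in M. f x = h x"
  shows "f \<in> borel_measurable (completion M)"
proof (rule measurableI)
  fix S :: "real set" assume S: "S \<in> sets borel"
  have "AE x in completion M. f x = h x" using eq by (rule AE_completion)
  with AE_space have "AE x in completion M. x \<in> h -` S \<inter> space M \<longleftrightarrow> x \<in> f -` S \<inter> space M"
    by eventually_elim auto
  then have "f -` S \<inter> space M \<in> sets (completion M)"
    using measurable_sets[OF h S] by (rule completion.in_sets_AE[OF _ sets_completionI_sets]) simp
  then show "f -` S \<inter> space (completion M) \<in> sets (completion M)" by simp
qed simp

text \<open>
  An essentially bounded function on \<open>U\<close> may be neither Borel nor bounded off \<open>U\<close>, and on \<open>U\<close> it may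
  exceed the bound on a null set. This is a bounded Borel representative.
\<close>

definition restrict_clamp :: "'a set \<Rightarrow> real \<Rightarrow> ('a \<Rightarrow> real) \<Rightarrow> 'a \<Rightarrow> real" where
  "restrict_clamp U C f y = max (- C) (min C (indicator U y * f y))"

lemma restrict_clamp_bound: "0 \<le> C \<Longrightarrow> \<bar>restrict_clamp U C f y\<bar> \<le> C"
  by (auto simp: restrict_clamp_def)

lemma restrict_clamp_eq: "\<bar>f y\<bar> \<le> C \<Longrightarrow> y \<in> U \<Longrightarrow> restrict_clamp U C f y = f y"
  by (auto simp: restrict_clamp_def)

lemma AE_restrict_lborel_iff:
  "open U \<Longrightarrow> (AE x in restrict_space lborel U. Q x) \<longleftrightarrow> (AE x in lborel. x \<in> U \<longrightarrow> Q x)"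
  by (rule AE_restrict_space_iff) auto

lemma borel_measurable_restrict_clamp:
  assumes U: "open U" and f: "f \<in> borel_measurable (restrict_space lborel U)"
  shows "restrict_clamp U C f \<in> borel_measurable borel"
proof -
  have "(\<lambda>x. indicator U x *\<^sub>R f x) \<in> borel_measurable lborel"
    using U f by (subst (asm) borel_measurable_restrict_space_iff) auto
  then have [measurable]: "(\<lambda>x. indicator U x * f x) \<in> borel_measurable borel" by simp
  show ?thesis unfolding restrict_clamp_def[abs_def] by measurable
qed

context stable_potential
begin

lemma measurable_kernel_integrand:
  assumes "f \<in> borel_measurable borel" "0 \<le> t"
  shows "(\<lambda>\<omega>. weight V U t (path_from 0 \<omega>) * f (X t \<omega>)) \<in> borel_measurable (P x)"
  using assms by (intro borel_measurable_times measurable_weight_path measurable_compose[OF measurable_X_P]) auto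

text \<open>
  The law of \<open>X t\<close> is absolutely continuous and surviving paths end in \<open>U\<close>, so only the class of \<open>f\<close>
  on \<open>U\<close> matters.
\<close>

lemma part_semigroup_eq_kernel:
  assumes U: "open U" and x: "x \<in> U" and t: "0 < t" and g[measurable]: "g \<in> borel_measurable borel"
    and fg: "AE y in lborel. y \<in> U \<longrightarrow> f y = g y"
  shows "part_semigroup P X V U t f x = kernel U t g x"
proof -
  let ?h = "\<lambda>\<omega>. weight V U t (path_from 0 \<omega>) * g (X t \<omega>)"
  let ?f = "\<lambda>\<omega>. indicator {\<omega>. ereal t < exit_time X U \<omega>} \<omega> * (exp (- additive_functional X V t \<omega>) * f (X t \<omega>))"
  obtain N where N: "N \<in> null_sets lborel" "{y. \<not> (y \<in> U \<longrightarrow> f y = g y)} \<subseteq> N"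
    using fg by (auto simp: eventually_ae_filter)
  have h: "?h \<in> borel_measurable (P x)" using t by (intro measurable_kernel_integrand g) simp
  have eq: "AE \<omega> in P x. ?f \<omega> = ?h \<omega>"
    using AE_less_exit_time_iff_survives[OF U x t] AE_X_not_in_null[OF t N(1), of x] AE_space
  proof eventually_elim
    fix \<omega> assume e: "ereal t < exit_time X U \<omega> \<longleftrightarrow> survives U t (path_from 0 \<omega>)" and n: "X t \<omega> \<notin> N" and "\<omega> \<in> space (P x)"
    then have \<omega>: "\<omega> \<in> space \<Omega>" by (simp add: space_P)
    show "?f \<omega> = ?h \<omega>"
    proof (cases "survives U t (path_from 0 \<omega>)")
      case True
      then have "weight V U t (path_from 0 \<omega>) \<noteq> 0" by (simp add: weight_def)
      then have "X t \<omega> \<in> U" using t by (intro weight_nonzero_imp_in) auto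
      then have "f (X t \<omega>) = g (X t \<omega>)" using n N(2) by auto
      then show ?thesis using True e by (simp add: weight_def additive_functional_eq[OF \<omega>])
    qed (use e in \<open>simp add: weight_def\<close>)
  qed
  have "part_semigroup P X V U t f x = (LINT \<omega>|completion (P x). ?h \<omega>)"
    unfolding part_semigroup_def
    by (intro integral_cong_AE borel_measurable_completion_AE[OF h eq] AE_completion eq measurable_completion h)
  also have "\<dots> = kernel U t g x" unfolding kernel_def by (rule integral_completion[OF h])
  finally show ?thesis .
qed

lemma kernel_linear:
  assumes [measurable]: "f \<in> borel_measurable borel" "g \<in> borel_measurable borel"
    and fg: "\<And>y. \<bar>f y\<bar> \<le> C" "\<And>y. \<bar>g y\<bar> \<le> C" and t: "0 \<le> t"
  shows "kernel U t (\<lambda>y. a * f y + b * g y) x = a * kernel U t f x + b * kernel U t g x"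
proof -
  have i: "integrable (P x) (\<lambda>\<omega>. weight V U t (path_from 0 \<omega>) * h (X t \<omega>))"
    if "h \<in> borel_measurable borel" and "\<And>y. \<bar>h y\<bar> \<le> C" for h
    using t that by (intro P.integrable_const_bound[where B=C] measurable_kernel_integrand)
      (auto intro: abs_weight_mult_le)
  have "kernel U t (\<lambda>y. a * f y + b * g y) x =
      (LINT \<omega>|P x. a * (weight V U t (path_from 0 \<omega>) * f (X t \<omega>)) + b * (weight V U t (path_from 0 \<omega>) * g (X t \<omega>)))"
    unfolding kernel_def by (simp add: algebra_simps)
  also have "\<dots> = a * kernel U t f x + b * kernel U t g x"
    using i[of f] i[of g] fg unfolding kernel_def by simp
  finally show ?thesis .
qed

lemma Linf_linear_part_semigroup:
  assumes U: "open U" and t: "0 < t"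
  shows "Linf_linear (restrict_space lborel U) (part_semigroup P X V U t)"
proof -
  let ?M = "restrict_space lborel U :: 'a measure" and ?T = "part_semigroup P X V U t"
  have sp: "space ?M = U" by (simp add: space_restrict_space)
  have rep: "\<exists>C\<ge>0. restrict_clamp U C f \<in> borel_measurable borel \<and> (\<forall>y. \<bar>restrict_clamp U C f y\<bar> \<le> C) \<and>
      (AE y in lborel. y \<in> U \<longrightarrow> f y = restrict_clamp U C f y)" if f: "f \<in> Linf_functions ?M" for f
  proof -
    obtain C where C: "AE y in ?M. \<bar>f y\<bar> \<le> C" and fm: "f \<in> borel_measurable ?M"
      using f by (auto simp: Linf_functions_def)
    from C have "AE y in ?M. f y = restrict_clamp U (max C 0) f y"
      using AE_space by eventually_elim (auto simp: sp intro!: restrict_clamp_eq[symmetric])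
    then have "AE y in lborel. y \<in> U \<longrightarrow> f y = restrict_clamp U (max C 0) f y"
      by (simp add: AE_restrict_lborel_iff[OF U])
    then show ?thesis
      using borel_measurable_restrict_clamp[OF U fm] restrict_clamp_bound[of "max C 0" U f]
      by (intro exI[of _ "max C 0"]) simp
  qed
  have 1: "?T f \<in> Linf_functions ?M" if f: "f \<in> Linf_functions ?M" for f
  proof -
    obtain C where C: "restrict_clamp U C f \<in> borel_measurable borel" "\<And>y. \<bar>restrict_clamp U C f y\<bar> \<le> C"
      "AE y in lborel. y \<in> U \<longrightarrow> f y = restrict_clamp U C f y" using rep[OF f] by blast
    have eq: "?T f x = kernel U t (restrict_clamp U C f) x" if "x \<in> U" for x
      by (rule part_semigroup_eq_kernel[OF U that t C(1,3)])
    have "kernel U t (restrict_clamp U C f) \<in> borel_measurable lborel"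
      using measurable_kernel[OF C(1), of t U] t by simp
    then have "kernel U t (restrict_clamp U C f) \<in> borel_measurable ?M" by (rule measurable_restrict_space1)
    then have "?T f \<in> borel_measurable ?M"
      using eq by (subst measurable_cong[of ?M _ "kernel U t (restrict_clamp U C f)"]) (auto simp: sp)
    moreover have "AE x in ?M. \<bar>?T f x\<bar> \<le> C"
      using t by (intro AE_I2) (auto simp: sp eq intro!: abs_kernel_le C)
    ultimately show ?thesis by (auto simp: Linf_functions_def)
  qed
  have 2: "AE x in ?M. ?T f x = ?T g x"
    if f: "f \<in> Linf_functions ?M" and g: "g \<in> Linf_functions ?M" and fg: "AE x in ?M. f x = g x" for f g
  proof (rule AE_I2)
    fix x assume "x \<in> space ?M"
    then have x: "x \<in> U" by (simp add: sp)
    obtain C where C: "restrict_clamp U C g \<in> borel_measurable borel"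
      "AE y in lborel. y \<in> U \<longrightarrow> g y = restrict_clamp U C g y" using rep[OF g] by blast
    have "AE y in lborel. y \<in> U \<longrightarrow> f y = g y" using fg by (simp add: AE_restrict_lborel_iff[OF U])
    with C(2) have "AE y in lborel. y \<in> U \<longrightarrow> f y = restrict_clamp U C g y" by eventually_elim simp
    then show "?T f x = ?T g x"
      using part_semigroup_eq_kernel[OF U x t C(1)] C(2) by simp
  qed
  have 3: "AE x in ?M. ?T (\<lambda>y. a * f y + b * g y) x = a * ?T f x + b * ?T g x"
    if f: "f \<in> Linf_functions ?M" and g: "g \<in> Linf_functions ?M" for f g a b
  proof (rule AE_I2)
    fix x assume "x \<in> space ?M"
    then have x: "x \<in> U" by (simp add: sp)
    obtain C where C: "restrict_clamp U C f \<in> borel_measurable borel" "\<And>y. \<bar>restrict_clamp U C f y\<bar> \<le> C"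
      "AE y in lborel. y \<in> U \<longrightarrow> f y = restrict_clamp U C f y" using rep[OF f] by blast
    obtain D where D: "restrict_clamp U D g \<in> borel_measurable borel" "\<And>y. \<bar>restrict_clamp U D g y\<bar> \<le> D"
      "AE y in lborel. y \<in> U \<longrightarrow> g y = restrict_clamp U D g y" using rep[OF g] by blast
    have [measurable]: "restrict_clamp U C f \<in> borel_measurable borel" "restrict_clamp U D g \<in> borel_measurable borel"
      using C D by auto
    from C(3) D(3) have ae: "AE y in lborel. y \<in> U \<longrightarrow>
        a * f y + b * g y = a * restrict_clamp U C f y + b * restrict_clamp U D g y"
      by eventually_elim simp
    have "?T (\<lambda>y. a * f y + b * g y) x = kernel U t (\<lambda>y. a * restrict_clamp U C f y + b * restrict_clamp U D g y) x"
      by (rule part_semigroup_eq_kernel[OF U x t _ ae]) measurable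
    also have "\<dots> = a * kernel U t (restrict_clamp U C f) x + b * kernel U t (restrict_clamp U D g) x"
      using C(2) D(2) t
      by (intro kernel_linear[where C="max C D"] C(1) D(1)) (auto intro: order_trans[OF _ max.cobounded1] order_trans[OF _ max.cobounded2])
    also have "\<dots> = a * ?T f x + b * ?T g x"
      by (simp add: part_semigroup_eq_kernel[OF U x t C(1,3)] part_semigroup_eq_kernel[OF U x t D(1,3)])
    finally show "?T (\<lambda>y. a * f y + b * g y) x = a * ?T f x + b * ?T g x" .
  qed
  show ?thesis unfolding Linf_linear_def using 1 2 3 by blast
qed

text \<open>
  A diagonal argument gives convergence on a countable dense set, and equicontinuity carries the
  Cauchy property to every point of \<open>U\<close>.
\<close>

lemma kernel_pointwise_subsequence:
  assumes U: "open U" and s: "0 < s" and g: "\<And>n. g n \<in> borel_measurable borel" and C: "0 < C" "\<And>n y. \<bar>g n y\<bar> \<le> C"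
  obtains k :: "nat \<Rightarrow> nat" where "strict_mono k" "\<And>x. x \<in> U \<Longrightarrow> convergent (\<lambda>n. kernel U s (g (k n)) x)"
proof -
  obtain D :: "'a set" where D: "countable D" "\<And>X. open X \<Longrightarrow> X \<noteq> {} \<Longrightarrow> \<exists>d\<in>D. d \<in> X"
    using countable_dense_exists by blast
  have le: "norm (kernel U s (g n) x) \<le> C" for n x
    using abs_kernel_le[OF g[of n], of s C U x] C s by auto
  obtain k where k: "strict_mono k" "\<And>x. x \<in> D \<Longrightarrow> \<exists>l. (\<lambda>n. kernel U s (g (k n)) x) \<longlonglongrightarrow> l"
    using function_convergent_subsequence[OF D(1), of "\<lambda>n. kernel U s (g n)" C] le by metis
  have "convergent (\<lambda>n. kernel U s (g (k n)) x)" if x: "x \<in> U" for x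
    unfolding Cauchy_convergent_iff[symmetric]
  proof (rule metric_CauchyI)
    fix e :: real assume e: "0 < e"
    then have e3: "0 < e / (3 * C)" using C by simp
    obtain d where d: "0 < d" "\<And>y f. y \<in> ball x d \<Longrightarrow> f \<in> borel_measurable borel \<Longrightarrow> (\<And>y. \<bar>f y\<bar> \<le> 1) \<Longrightarrow>
      \<bar>kernel U s f y - kernel U s f x\<bar> < e / (3 * C)"
      using kernel_equicontinuous[OF U x s e3] by metis
    obtain y where y: "y \<in> D" "y \<in> ball x d" using D(2)[of "ball x d"] d by auto
    have scale: "kernel U s (g n) z = C * kernel U s (\<lambda>y. g n y / C) z" for n z
      using C(1) by (simp add: kernel_def)
    have close: "dist (kernel U s (g n) y) (kernel U s (g n) x) < e / 3" for n
    proof -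
      have "\<bar>kernel U s (\<lambda>y. g n y / C) y - kernel U s (\<lambda>y. g n y / C) x\<bar> < e / (3 * C)"
        using C g[of n] by (intro d(2) y) auto
      then have "C * \<bar>kernel U s (\<lambda>y. g n y / C) y - kernel U s (\<lambda>y. g n y / C) x\<bar> < C * (e / (3 * C))"
        using C(1) by (intro mult_strict_left_mono)
      then show ?thesis using C(1) unfolding scale[of n] dist_real_def
        by (simp add: abs_mult flip: right_diff_distrib)
    qed
    have "Cauchy (\<lambda>n. kernel U s (g (k n)) y)" using k(2)[OF y(1)] by (auto intro: LIMSEQ_imp_Cauchy)
    then obtain N where N: "\<And>m n. m \<ge> N \<Longrightarrow> n \<ge> N \<Longrightarrow> dist (kernel U s (g (k m)) y) (kernel U s (g (k n)) y) < e / 3"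
      using metric_CauchyD[of _ "e / 3"] e by (metis divide_pos_pos zero_less_numeral)
    show "\<exists>N. \<forall>m\<ge>N. \<forall>n\<ge>N. dist (kernel U s (g (k m)) x) (kernel U s (g (k n)) x) < e"
    proof (intro exI[of _ N] allI impI)
      fix m n assume "N \<le> m" "N \<le> n"
      then show "dist (kernel U s (g (k m)) x) (kernel U s (g (k n)) x) < e"
        using N[of m n] close[of "k m"] close[of "k n"] unfolding dist_real_def by linarith
    qed
  qed
  then show ?thesis using that k(1) by blast
qed

text \<open>
  Compactness through \<open>L\<^sup>1\<close>. Half of the time is spent on pointwise convergence on \<open>U\<close>, which is
  convergence in \<open>L\<^sup>1(U)\<close> because the functions are bounded and \<open>U\<close> has finite measure. The other
  half turns convergence in \<open>L\<^sup>1(U)\<close> into uniform convergence.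
\<close>

lemma kernel_uniform_subsequence:
  assumes U: "open U" "emeasure lborel U < \<infinity>" and t: "0 < t"
    and g: "\<And>n. g n \<in> borel_measurable borel" and C: "0 < C" "\<And>n y. \<bar>g n y\<bar> \<le> C"
  obtains k :: "nat \<Rightarrow> nat" and l e where "strict_mono k" "l \<in> borel_measurable borel" "\<And>y. \<bar>l y\<bar> \<le> C"
    "e \<longlonglongrightarrow> (0::real)" "\<And>n x. \<bar>kernel U t (g (k n)) x - l x\<bar> \<le> e n"
proof -
  define s where "s = t / 2"
  have s: "0 < s" "s + s = t" using t by (auto simp: s_def)
  obtain k where k: "strict_mono k" "\<And>x. x \<in> U \<Longrightarrow> convergent (\<lambda>n. kernel U s (g (k n)) x)"
    by (rule kernel_pointwise_subsequence[OF U(1) s(1) g C]) (rule that; assumption)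
  define u where "u n = kernel U s (g (k n))" for n
  have um[measurable]: "u n \<in> borel_measurable borel" for n
    unfolding u_def using s by (intro measurable_kernel g) auto
  have uC: "\<bar>u n y\<bar> \<le> C" for n y unfolding u_def using s by (intro abs_kernel_le g C) auto
  \<comment> \<open>off \<open>U\<close> the sequence need not converge; clamping keeps \<open>v\<close> bounded there\<close>
  define v where "v y = max (- C) (min C (lim (\<lambda>n. u n y)))" for y
  have vm[measurable]: "v \<in> borel_measurable borel"
    unfolding v_def using borel_measurable_lim_metric[OF um] by measurable
  have vC: "\<bar>v y\<bar> \<le> C" for y using C(1) by (auto simp: v_def)
  have lim: "(\<lambda>n. u n x) \<longlonglongrightarrow> v x" if x: "x \<in> U" for x
  proof -
    have l: "(\<lambda>n. u n x) \<longlonglongrightarrow> lim (\<lambda>n. u n x)"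
      using k(2)[OF x] by (simp add: u_def convergent_LIMSEQ_iff)
    have "\<bar>lim (\<lambda>n. u n x)\<bar> \<le> C"
      by (rule LIMSEQ_le_const2[OF tendsto_rabs[OF l]]) (auto intro: uC)
    then have "v x = lim (\<lambda>n. u n x)" by (auto simp: v_def)
    then show ?thesis using l by simp
  qed
  have [measurable]: "U \<in> sets borel" using U by auto
  have iU: "integrable lborel (\<lambda>y. indicator U y * (2 * C))"
    using U by (intro integrable_mult_left) (simp add: integrable_real_indicator)
  have diff: "\<bar>u n y - v y\<bar> \<le> 2 * C" for n y using uC[of n y] vC[of y] by linarith
  have iu: "integrable lborel (\<lambda>y. indicator U y * \<bar>u n y - v y\<bar>)" for n
    by (rule Bochner_Integration.integrable_bound[OF iU])
      (use diff C(1) in \<open>auto simp: indicator_def intro!: AE_I2\<close>)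
  have "(\<lambda>n. LINT y|lborel. indicator U y * \<bar>u n y - v y\<bar>) \<longlonglongrightarrow> (LINT y|(lborel::'a measure). 0)"
  proof (rule integral_dominated_convergence[OF _ _ iU])
    show "AE y in lborel. (\<lambda>n. indicator U y * \<bar>u n y - v y\<bar>) \<longlonglongrightarrow> 0"
    proof (rule AE_I2)
      fix y
      show "(\<lambda>n. indicator U y * \<bar>u n y - v y\<bar>) \<longlonglongrightarrow> 0"
      proof (cases "y \<in> U")
        case True
        then show ?thesis using lim[of y] by (auto simp: LIM_zero_iff intro!: tendsto_rabs_zero)
      qed simp
    qed
    show "AE y in lborel. norm (indicator U y * \<bar>u n y - v y\<bar>) \<le> indicator U y * (2 * C)" for n
      using diff by (intro AE_I2) (auto simp: indicator_def)
  qed measurable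
  then have L1: "(\<lambda>n. LINT y|lborel. indicator U y * \<bar>u n y - v y\<bar>) \<longlonglongrightarrow> 0" by simp
  obtain K where K: "0 \<le> K" "\<And>f x. f \<in> borel_measurable borel \<Longrightarrow> integrable lborel (\<lambda>y. indicator U y * \<bar>f y\<bar>) \<Longrightarrow>
    U \<in> sets borel \<Longrightarrow> \<bar>kernel U s f x\<bar> \<le> K * (LINT y|lborel. indicator U y * \<bar>f y\<bar>)"
    by (rule abs_kernel_le_L1[OF s(1), of U]) (rule that; assumption)
  define e where "e n = K * (LINT y|lborel. indicator U y * \<bar>u n y - v y\<bar>)" for n
  show ?thesis
  proof (rule that[OF k(1), of "kernel U s v" e])
    show "kernel U s v \<in> borel_measurable borel" using s by (intro measurable_kernel vm) auto
    show "\<bar>kernel U s v y\<bar> \<le> C" for y using s by (intro abs_kernel_le vm vC) auto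
    show "e \<longlonglongrightarrow> 0" unfolding e_def using tendsto_mult[OF tendsto_const L1, of K] by simp
    show "\<bar>kernel U t (g (k n)) x - kernel U s v x\<bar> \<le> e n" for n x
    proof -
      have "kernel U t (g (k n)) x = kernel U s (u n) x"
        using kernel_add[OF g[of "k n"] C(2), where r=s and s=s and U=U and x=x] s by (simp add: kernel_def[of U s "kernel U s (g (k n))"] u_def)
      then have "kernel U t (g (k n)) x - kernel U s v x = kernel U s (\<lambda>y. 1 * u n y + (- 1) * v y) x"
        using s by (subst kernel_linear[where C=C, OF um vm uC vC]) auto
      also have "\<bar>\<dots>\<bar> \<le> e n"
        unfolding e_def using iu[of n] by (simp add: K(2)[of "\<lambda>y. u n y - v y" x])
      finally show ?thesis .
    qed
  qed
qed

lemma Linf_map_class: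
  assumes T: "Linf_linear M T" and f: "f \<in> Linf_functions M"
  shows "Linf_map M T (Linf_rel M `` {f}) = Linf_rel M `` {T f}"
proof -
  have "Linf_rel M `` {T g} = Linf_rel M `` {T f}" if "(f, g) \<in> Linf_rel M" for g
  proof (rule equiv_class_eq[OF equiv_Linf_rel, symmetric])
    show "(T f, T g) \<in> Linf_rel M" using that T by (auto simp: Linf_rel_def Linf_linear_def)
  qed
  moreover have "(f, f) \<in> Linf_rel M" using f by (auto simp: Linf_rel_def)
  ultimately show ?thesis unfolding Linf_map_def by blast
qed

text \<open>
  By the Bolzano-Weierstrass criterion it is enough to find an accumulation point of every infinite
  subset of the image.
\<close>

theorem compact_part_semigroup:
  assumes U: "open U" "emeasure lborel U < \<infinity>" and t: "0 < t"
  shows "Linf_compact_operator (restrict_space lborel U) (part_semigroup P X V U t)"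
  unfolding Linf_compact_operator_def
proof (intro conjI allI impI)
  let ?M = "restrict_space lborel U :: 'a measure" and ?T = "part_semigroup P X V U t"
  have sp: "space ?M = U" by (simp add: space_restrict_space)
  show lin: "Linf_linear ?M ?T" by (rule Linf_linear_part_semigroup[OF U(1) t])
  interpret L: Metric_space "Linf ?M" "Linf_dist ?M" by (rule Metric_space_Linf)
  fix B assume B: "B \<subseteq> Linf ?M \<and> Linf_bounded ?M B"
  show "compactin (Linf_topology ?M) (Linf_topology ?M closure_of (Linf_map ?M ?T ` B))"
    unfolding Linf_topology_def L.compact_closure_of_eq_Bolzano_Weierstrass
  proof (intro allI impI)
    fix Q assume Q: "infinite Q \<and> Q \<subseteq> Linf_map ?M ?T ` B \<and> Q \<subseteq> Linf ?M"
    then have inf: "infinite Q" and sub: "Q \<subseteq> Linf_map ?M ?T ` B" by auto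
    obtain G :: "nat \<Rightarrow> ('a \<Rightarrow> real) set" where G: "inj G" "range G \<subseteq> Q"
      using infinite_countable_subset[OF inf] by (elim exE conjE)
    have "\<exists>F\<in>B. G n = Linf_map ?M ?T F" for n
      using subsetD[OF sub subsetD[OF G(2) rangeI[of G n]]] by (elim imageE) auto
    then obtain F where F: "\<And>n. F n \<in> B" "\<And>n. G n = Linf_map ?M ?T (F n)" by metis
    have FL: "F n \<in> Linf ?M" for n using F B by auto
    have "\<exists>f. f \<in> Linf_functions ?M \<and> F n = Linf_rel ?M `` {f}" for n using FL[of n] by (elim Linf_cases) auto
    then obtain f where f: "\<And>n. f n \<in> Linf_functions ?M" "\<And>n. F n = Linf_rel ?M `` {f n}" by metis
    obtain R where R: "\<And>x y. x \<in> B \<Longrightarrow> y \<in> B \<Longrightarrow> Linf_dist ?M x y \<le> R"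
      using B unfolding Linf_bounded_def L.mbounded_alt by blast
    obtain C0 where C0: "AE y in ?M. \<bar>f 0 y\<bar> \<le> C0" using f(1)[of 0] by (auto simp: Linf_functions_def)
    define C where "C = max 1 (C0 + R)"
    have C: "0 < C" by (simp add: C_def)
    have fC: "AE y in ?M. \<bar>f n y\<bar> \<le> C" for n
    proof -
      have R: "Linf_norm ?M (\<lambda>y. f n y - f 0 y) \<le> R"
        using R[OF F(1)[of n] F(1)[of 0]] unfolding f(2) Linf_dist_class[OF f(1) f(1)] .
      from Linf_norm_AE[OF Linf_functions_diff[OF f(1)[of n] f(1)[of 0]]] C0 show ?thesis
        by eventually_elim (use R in \<open>auto simp: C_def\<close>)
    qed
    define g where "g n = restrict_clamp U C (f n)" for n
    have gm: "g n \<in> borel_measurable borel" for n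
      unfolding g_def using f(1)[of n] by (intro borel_measurable_restrict_clamp[OF U(1)]) (auto simp: Linf_functions_def)
    have gC: "\<bar>g n y\<bar> \<le> C" for n y unfolding g_def using C by (intro restrict_clamp_bound) simp
    have fg: "AE y in lborel. y \<in> U \<longrightarrow> f n y = g n y" for n
      unfolding AE_restrict_lborel_iff[OF U(1), symmetric]
      using fC[of n] AE_space by eventually_elim (simp add: g_def sp restrict_clamp_eq)
    have Tf: "?T (f n) x = kernel U t (g n) x" if "x \<in> U" for n x
      by (rule part_semigroup_eq_kernel[OF U(1) that t gm fg])
    obtain k l e where k: "strict_mono k" and l: "l \<in> borel_measurable borel" "\<And>y. \<bar>l y\<bar> \<le> C"
      and e: "e \<longlonglongrightarrow> (0::real)" "\<And>n x. \<bar>kernel U t (g (k n)) x - l x\<bar> \<le> e n"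
      by (rule kernel_uniform_subsequence[OF U t gm C gC]) (rule that; assumption)
    have lL: "l \<in> Linf_functions ?M"
    proof -
      have "l \<in> borel_measurable lborel" using l(1) by simp
      then have "l \<in> borel_measurable ?M" by (rule measurable_restrict_space1)
      then show ?thesis using l(2) by (auto simp: Linf_functions_def)
    qed
    have TL: "?T (f n) \<in> Linf_functions ?M" for n using lin f(1) by (simp add: Linf_linear_def)
    have Gn: "G n = Linf_rel ?M `` {?T (f n)}" for n
      unfolding F(2) f(2) by (rule Linf_map_class[OF lin f(1)])
    let ?l = "Linf_rel ?M `` {l}"
    have lLinf: "?l \<in> Linf ?M" using lL by (simp add: Linf_def quotientI)
    have GL: "G n \<in> Linf ?M" for n using TL by (simp add: Gn Linf_def quotientI)
    have dist: "Linf_dist ?M ?l (G (k n)) \<le> e n" for n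
    proof -
      have "0 \<le> e n" using e(2)[of n undefined] by linarith
      moreover have "AE x in ?M. \<bar>l x - ?T (f (k n)) x\<bar> \<le> e n"
        by (rule AE_I2) (use e(2) in \<open>auto simp: sp Tf abs_minus_commute\<close>)
      ultimately show ?thesis
        unfolding Gn Linf_dist_class[OF lL TL]
        using Linf_functions_diff[OF lL TL, of "k n"] by (intro Linf_norm_le) (auto simp: Linf_functions_def)
    qed
    have "?l \<in> L.mtopology derived_set_of Q"
      unfolding L.metric_derived_set_of
    proof (intro CollectI conjI allI impI lLinf)
      fix r :: real assume r: "0 < r"
      have "\<forall>\<^sub>F n in sequentially. e n < r" using e(1) r by (intro order_tendstoD(2)) auto
      then obtain N where N: "\<And>n. N \<le> n \<Longrightarrow> e n < r" by (auto simp: eventually_sequentially)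
      \<comment> \<open>the sequence \<open>G\<close> is injective, so it meets its limit at most once\<close>
      have "k N \<noteq> k (Suc N)" using strict_monoD[OF k, of N "Suc N"] by simp
      then have "G (k N) \<noteq> G (k (Suc N))" using G(1) by (auto dest: injD)
      then obtain n where n: "N \<le> n" "G (k n) \<noteq> ?l" by (metis le_refl le_SucI)
      have "G (k n) \<in> L.mball ?l r" using dist[of n] N[OF n(1)] lLinf GL by auto
      moreover have "G (k n) \<in> Q" using G(2) by blast
      ultimately show "\<exists>y\<in>Q. y \<noteq> ?l \<and> y \<in> L.mball ?l r" using n(2) by blast
    qed
    then show "L.mtopology derived_set_of Q \<noteq> {}" by blast
  qed
qed

end

section \<open>The three properties of the killed process\<close>

theorem theorem4p5:
  fixes \<alpha> c :: real
    and \<Omega> :: "'w measure"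
    and P :: "'a::euclidean_space \<Rightarrow> 'w measure"
    and X :: "real \<Rightarrow> 'w \<Rightarrow> 'a"
    and V :: "'a \<Rightarrow> real"
  assumes "0 < \<alpha>" and "\<alpha> \<le> 2" and "0 < c"
    and "symmetric_stable_process \<alpha> c \<Omega> P X"
    and "V \<in> borel_measurable borel" and "\<And>x. 0 < V x"
    and V1: "\<And>G. open G \<Longrightarrow> compact (closure G) \<Longrightarrow> bdd_above (V ` G)"
    and V2: "filterlim V at_top at_infinity"
  shows "(\<forall>t>0. \<forall>f. f \<in> borel_measurable borel \<and> bounded (range f) \<longrightarrow>
            continuous_on UNIV (killed_semigroup P X V t f) \<and>
            bounded (range (killed_semigroup P X V t f)))
       \<and> ((\<lambda>x. killed_resolvent1 P X V (\<lambda>_. 1) x) \<longlongrightarrow> 0) at_infinity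
       \<and> (\<forall>t>0. \<forall>U. open U \<and> emeasure lborel U < \<infinity> \<longrightarrow>
            Linf_compact_operator (restrict_space lborel U) (part_semigroup P X V U t))"
proof -
  interpret stable_potential \<alpha> c \<Omega> P X V
  proof (intro stable_potential.intro stable_process.intro stable_process_axioms.intro stable_potential_axioms.intro assms)
    fix B :: "'a set" assume "bounded B"
    then obtain r where r: "B \<subseteq> ball 0 r" by (metis bounded_subset_ballD)
    have "bdd_above (V ` ball 0 r)" by (rule V1) auto
    then show "\<exists>K. \<forall>x\<in>B. V x \<le> K" using r by (force simp: bdd_above_def)
  qed
  show ?thesis
    using killed_semigroup_strong_feller resolvent_tendsto_0 compact_part_semigroup by blast
qed

end
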